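(* Let $\alpha>0$, $\varepsilon>0$ and $0<\tau_2\le4\tau_1$. Suppose: (A) $f$ is path-differentiable with convex-valued conservative field $\mathcal D_f$; $c$ is path-differentiable with convex-valued conservative Jacobian $\mathcal D_c$; and $\inf_{x\in\mathcal X}f(x)>-\infty$. (B) The set $\{g(x): x\in\mathcal X,\ 0\in\mathcal D_g(x)+\mathcal N_{\mathcal X}(x)\}$ has empty interior in $\mathbb R$. (C) For the method (ADAM-LALM) described in the context: (1) $\{(x_k,y_k,v_k)\}$ is uniformly bounded in $\mathcal X\times\mathbb R^n\times\mathbb R^n$; (2) there is a nonnegative sequence $\{\delta_k\}$ with $\lim_k\delta_k=0$ such that $d_k\in\mathcal D_f^{\delta_k}(x_k)$, $J_{c,k}\in\mathcal D_c^{\delta_k}(x_k)$ and $\|w_k-c(x_k)\|\le\delta_k$ for all $k\ge0$; (3) $\{\xi_k\}$ is uniformly bounded, $\eta_k>0$, $\lim_k\eta_k=0$, $\sum_{k=0}^\infty\eta_k=+\infty$, and for every $T>0$, $\lim_{i\to\infty}\sup_{i\le j\le\Lambda(\sigma_i+T)}\big\|\sum_{k=i}^j\eta_k\xi_{k+1}\big\|=0$; (4) there exist $0<\theta_{\min}\le\theta_{\max}<\beta$ with $\theta_{\min}\le\theta_k\le\theta_{\max}$ for all $k\ge0$. Then for any sequence $\{x_k\}$ generated by (ADAM-LALM), any cluster point of $\{x_k\}$ lies in $\{x\in\mathcal X:0\in\mathcal D_g(x)+\mathcal N_{\mathcal X}(x)\}$, and the sequence $\{g(x_k)\}$ converges.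 Moreover, if in addition there is $\nu>0$ with $\nu\|c(x)\|\le\mathrm{dist}(-\mathcal D_c(x)c(x),\mathcal N_{\mathcal X}(x))$ for all $x\in\mathcal X$, $f$ is $M_f$-Lipschitz continuous, and $\beta>\frac{M_f}{\nu}$ in (ADAM-LALM), then any cluster point of $\{x_k\}$ is a $(\mathcal D_f,\mathcal D_c)$-KKT point of $\min_{x\in\mathcal X}f(x)$ s.t. $c(x)=0$, and the sequence $\{f(x_k)\}$ converges.
   Context: Setting: $\mathcal X\subseteq\mathbb R^n$ is a closed convex set, $f:\mathbb R^n\to\mathbb R$ and $c:\mathbb R^n\to\mathbb R^p$ are locally Lipschitz. $\mathcal N_{\mathcal X}(x)$ is the normal cone of $\mathcal X$ at $x\in\mathcal X$; $\mathrm{dist}$ between two sets (or a set and a point) is the infimum of distances between their elements. $\odot$, $\sqrt{\cdot}$ and adding a scalar to a vector are componentwise. $\widetilde{\mathrm{prox}}_{\mathcal X}(x,y;v)=\arg\min_{z\in\mathcal X}\{\langle y,z-x\rangle+\frac12\langle v\odot(z-x),z-x\rangle\}$. Conservative Jacobian: for a locally Lipschitz $H:\mathbb R^n\to\mathbb R^s$, a set-valued $\mathcal D_H:\mathbb R^n\rightrightarrows\mathbb R^{n\times s}$ that is nonempty-valued, locally bounded, graph-closed, and such that for every absolutely continuous curve $\gamma:\mathbb R_+\to\mathbb R^n$, for almost every $t$, $\frac{d(H\circ\gamma)}{dt}(t)=J^\top\dot\gamma(t)$ for all $J\in\mathcal D_H(\gamma(t))$. For $s=1$ it is called a conservative field.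 $H$ is path-differentiable if it is locally Lipschitz and admits a conservative Jacobian. KKT point: $x\in\mathcal X$ is a $(\mathcal D_f,\mathcal D_c)$-KKT point if $c(x)=0$ and $0\in\mathcal D_f(x)+\mathrm{span}(\mathcal D_c(x))+\mathcal N_{\mathcal X}(x)$, where for $\mathcal Z\subseteq\mathbb R^{n\times p}$, $\mathrm{span}(\mathcal Z)$ is the smallest linear subspace of $\mathbb R^n$ containing $\{Z\lambda:Z\in\mathcal Z,\lambda\in\mathbb R^p\}$. $\delta$-expansion: $\mathcal D^\delta(x)=\{w:\exists z,\ \|z-x\|\le\delta,\ \mathrm{dist}(w,\mathcal D(z))\le\delta\}$. For positive stepsizes $\{\eta_k\}$: $\sigma_0=0$, $\sigma_i=\sum_{k=0}^{i-1}\eta_k$, $\Lambda(t)=\sup\{k\ge0:\sigma_k\le t\}$. Parameters $\beta>0$, $\rho\ge0$. $\mathrm{regu}(y)=y/\|y\|$ if $y\ne0$ and $\mathrm{regu}(0)=0$. $\mathcal T_{regu}(y)=\{y/\|y\|\}$ if $y\neq0$ and $\mathcal T_{regu}(0)=\{u\in\mathbb R^p:\|u\|\le1\}$. $g(x)=f(x)+\beta\|c(x)\|+\frac\rho2\|c(x)\|^2$, $\mathcal D_g(x)=\mathrm{conv}\big(\mathcal D_f(x)+\mathcal D_c(x)(\beta\mathcal T_{regu}(c(x))+\rho c(x))\big)$, where $\mathcal W\mathcal Y=\{Wy:W\in\mathcal W,y\in\mathcal Y\}$; $\mathcal D_g$ is a convex-valued conservative field of $g$. Method (ADAM-LALM):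 starting from some $x_0\in\mathcal X$, $y_0,v_0\in\mathbb R^n$, $w_0,\lambda_0\in\mathbb R^p$, for $k\ge0$: $l_{x,k}=d_k+J_{c,k}(\lambda_k+\rho w_k)+\xi_{k+1}$; $y_{k+1}=y_k-\tau_1\eta_k(y_k-l_{x,k})$; $v_{k+1}=v_k-\tau_2\eta_k(v_k-l_{x,k}\odot l_{x,k})$; $x_{k+1}=(1-\eta_k)x_k+\eta_k\widetilde{\mathrm{prox}}_{\mathcal X}\big(x_k,y_{k+1};\frac1\alpha\sqrt{v_{k+1}+\varepsilon}\big)$; $w_{k+1}\in\mathbb R^p$ is an approximate evaluation of $c(x_{k+1})$; $\lambda_{k+1}=\lambda_k+\theta_k(\mathrm{regu}(w_{k+1})-\frac1\beta\lambda_k)$. Here $d_k\in\mathbb R^n$, $J_{c,k}\in\mathbb R^{n\times p}$, $\xi_{k+1}\in\mathbb R^n$.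
   Formalization: In the "Moreover" part it is additionally assumed that every element of D_f(x), x in X, has norm at most M_f; for a general conservative field of an M_f-Lipschitz f this can fail and the claim is then false (e.g. f=0, D_f(1)=[-10,10], c(x)=x, x_k=1). *)

theory Defs
  imports "HOL-Analysis.Analysis"
begin

text \<open>Conventions: \<open>n \<times> p\<close> matrices are elements of \<^typ>\<open>real^'p^'n\<close>; the product \<open>*\<close> on vectors is
  the componentwise one; \<open>+\<close> on sets is the Minkowski sum.\<close>

subsection \<open>Conservative fields and Jacobians\<close>

definition locally_lipschitz :: "('a::metric_space \<Rightarrow> 'b::metric_space) \<Rightarrow> bool" where
  "locally_lipschitz H \<longleftrightarrow> (\<forall>x. \<exists>r>0. \<exists>L. L-lipschitz_on (ball x r) H)"

text \<open>Absolute continuity on every interval \<open>[0,b]\<close>. A finite family of intervals \<open>[s,t]\<close> is given as a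
  set of pairs \<open>(s,t)\<close>; values of the curve at negative times are irrelevant.\<close>

definition abs_cont_curve :: "(real \<Rightarrow> 'a::real_normed_vector) \<Rightarrow> bool" where
  "abs_cont_curve \<gamma> \<longleftrightarrow>
     (\<forall>b\<ge>0. \<forall>e>0. \<exists>d>0. \<forall>I :: (real \<times> real) set.
        finite I \<and> (\<forall>(s,t)\<in>I. 0 \<le> s \<and> s \<le> t \<and> t \<le> b) \<and>
        disjoint_family_on (\<lambda>(s,t). {s<..<t}) I \<and> (\<Sum>(s,t)\<in>I. t - s) < d
        \<longrightarrow> (\<Sum>(s,t)\<in>I. norm (\<gamma> t - \<gamma> s)) < e)"

text \<open>Common core of the two notions below: \<open>act J u\<close> is the value on the velocity \<open>u\<close> of the linear map
  represented by \<open>J\<close>. The differentiability of \<open>\<gamma>\<close> and \<open>H \<circ> \<gamma>\<close> at almost every time is part of the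
  almost-everywhere statement.\<close>

definition conservative_wrt ::
  "('d::real_normed_vector \<Rightarrow> 'a::euclidean_space \<Rightarrow> 'b::euclidean_space) \<Rightarrow> ('a \<Rightarrow> 'b) \<Rightarrow> ('a \<Rightarrow> 'd set) \<Rightarrow> bool"
where
  "conservative_wrt act H D \<longleftrightarrow>
     locally_lipschitz H \<and>
     (\<forall>x. D x \<noteq> {}) \<and>
     (\<forall>x. \<exists>r>0. bounded (\<Union>z\<in>ball x r. D z)) \<and>
     closed {(x, J). J \<in> D x} \<and>
     (\<forall>\<gamma>. abs_cont_curve \<gamma> \<longrightarrow>
        (AE t in lebesgue. 0 \<le> t \<longrightarrow>
           (\<exists>u. (\<gamma> has_vector_derivative u) (at t) \<and>
                (\<forall>J\<in>D (\<gamma> t). ((H \<circ> \<gamma>) has_vector_derivative act J u) (at t)))))"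

definition conservative_jacobian ::
  "(real^'n \<Rightarrow> real^'s) \<Rightarrow> (real^'n \<Rightarrow> (real^'s^'n) set) \<Rightarrow> bool" where
  "conservative_jacobian H D \<longleftrightarrow> conservative_wrt (\<lambda>J u. transpose J *v u) H D"

text \<open>The case \<open>s = 1\<close>, with \<open>n \<times> 1\<close> matrices read as vectors.\<close>

definition conservative_field :: "(real^'n \<Rightarrow> real) \<Rightarrow> (real^'n \<Rightarrow> (real^'n) set) \<Rightarrow> bool" where
  "conservative_field f D \<longleftrightarrow> conservative_wrt (\<lambda>d u. d \<bullet> u) f D"

definition expansion :: "real \<Rightarrow> ('a::metric_space \<Rightarrow> 'd::metric_space set) \<Rightarrow> 'a \<Rightarrow> 'd set" where
  "expansion \<delta> D x = {w. \<exists>z. dist z x \<le> \<delta> \<and> infdist w (D z) \<le> \<delta>}"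

subsection \<open>The constrained problem and its exact penalty function\<close>

definition normal_cone :: "'a::real_inner set \<Rightarrow> 'a \<Rightarrow> 'a set" where
  "normal_cone X x = {v. \<forall>z\<in>X. v \<bullet> (z - x) \<le> 0}"

definition stationary :: "'a::real_inner set \<Rightarrow> ('a \<Rightarrow> 'a set) \<Rightarrow> 'a set" where
  "stationary X D = {x \<in> X. 0 \<in> D x + normal_cone X x}"

definition matrix_span :: "(real^'p^'n) set \<Rightarrow> (real^'n) set" where
  "matrix_span Z = span {A *v u | A u. A \<in> Z}"

definition kkt_point ::
  "(real^'n) set \<Rightarrow> (real^'n \<Rightarrow> real^'p) \<Rightarrow> (real^'n \<Rightarrow> (real^'n) set) \<Rightarrow> (real^'n \<Rightarrow> (real^'p^'n) set)
    \<Rightarrow> real^'n \<Rightarrow> bool" where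
  "kkt_point X c D\<^sub>f D\<^sub>c x \<longleftrightarrow>
     x \<in> X \<and> c x = 0 \<and> 0 \<in> D\<^sub>f x + matrix_span (D\<^sub>c x) + normal_cone X x"

definition regu :: "'a::real_normed_vector \<Rightarrow> 'a" where
  "regu y = (if y = 0 then 0 else y /\<^sub>R norm y)"

definition T_regu :: "'a::real_normed_vector \<Rightarrow> 'a set" where
  "T_regu y = (if y = 0 then {u. norm u \<le> 1} else {y /\<^sub>R norm y})"

definition penalty ::
  "real \<Rightarrow> real \<Rightarrow> (real^'n \<Rightarrow> real) \<Rightarrow> (real^'n \<Rightarrow> real^'p) \<Rightarrow> real^'n \<Rightarrow> real" where
  "penalty \<beta> \<rho> f c x = f x + \<beta> * norm (c x) + \<rho> / 2 * (norm (c x))\<^sup>2"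

definition penalty_field ::
  "real \<Rightarrow> real \<Rightarrow> (real^'n \<Rightarrow> real^'p) \<Rightarrow> (real^'n \<Rightarrow> (real^'n) set) \<Rightarrow> (real^'n \<Rightarrow> (real^'p^'n) set)
    \<Rightarrow> real^'n \<Rightarrow> (real^'n) set" where
  "penalty_field \<beta> \<rho> c D\<^sub>f D\<^sub>c x =
     convex hull (D\<^sub>f x + {A *v (\<beta> *\<^sub>R u + \<rho> *\<^sub>R c x) | A u. A \<in> D\<^sub>c x \<and> u \<in> T_regu (c x)})"

subsection \<open>Ingredients of the method\<close>

definition prox_set :: "(real^'n) set \<Rightarrow> real^'n \<Rightarrow> real^'n \<Rightarrow> real^'n \<Rightarrow> (real^'n) set" where
  "prox_set X x y v =
     {z. is_arg_min (\<lambda>z. y \<bullet> (z - x) + 1 / 2 * ((v * (z - x)) \<bullet> (z - x))) (\<lambda>z. z \<in> X) z}"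

definition vec_sqrt :: "real^'n \<Rightarrow> real^'n" where
  "vec_sqrt v = (\<chi> i. sqrt (v $ i))"

definition time_index :: "(nat \<Rightarrow> real) \<Rightarrow> real \<Rightarrow> nat" where
  "time_index \<eta> t = Sup {k. (\<Sum>i<k. \<eta> i) \<le> t}"

definition cluster_point :: "(nat \<Rightarrow> 'a::topological_space) \<Rightarrow> 'a \<Rightarrow> bool" where
  "cluster_point x a \<longleftrightarrow> (\<exists>r. strict_mono r \<and> (x \<circ> r) \<longlonglongrightarrow> a)"

end

theory Submission
  imports Defs "HOL-Complex_Analysis.Great_Picard"
begin

text \<open>Write \<open>p\<^sub>k = (x\<^sub>k\<^sub>+\<^sub>1 - x\<^sub>k) / \<eta>\<^sub>k\<close> for the velocity of the iterates, \<open>V\<^sub>k = (1/\<alpha>) \<surd>(v\<^sub>k + \<epsilon>)\<close> for the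
  metric of the prox step, \<open>D\<close> for the penalty field of \<open>g\<close>, and \<open>e\<^sub>k = d\<^sub>k + J\<^sub>k (\<lambda>\<^sub>k + \<rho> w\<^sub>k)\<close> for the
  gradient estimate without its noise. The proof is a Lyapunov argument carried out on the iterates
  themselves; continuous time is used for one fact only.

  The Lyapunov function is \<open>g(x\<^sub>k)\<close> minus \<open>1/\<tau>\<^sub>1\<close> times the optimal value of the prox subproblem. Comparing
  consecutive subproblems (\<open>m_increment\<close>) shows that the second part grows by at most
  \<open>- \<eta>\<^sub>k \<langle>e\<^sub>k + \<xi>\<^sub>k\<^sub>+\<^sub>1, p\<^sub>k\<rangle> - \<kappa> \<eta>\<^sub>k |p\<^sub>k|\<^sup>2\<close> up to \<open>O(\<eta>\<^sup>2)\<close>: the momentum recursion produces the inner product, and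
  the change of the metric is paid for by optimality of the prox point because \<open>\<tau>\<^sub>2 \<le> 4 \<tau>\<^sub>1\<close> and the
  squares fed into \<open>v\<close> are nonnegative; \<open>\<kappa> > 0\<close> comes from \<open>\<epsilon>\<close>. The noise disappears by
  summation by parts, since \<open>p\<close> changes by \<open>O(\<eta>)\<close> per step. It remains to see that \<open>g(x\<^sub>k)\<close> grows by
  \<open>\<Sum> \<eta>\<^sub>k \<langle>e\<^sub>k, p\<^sub>k\<rangle>\<close>. This is \<open>chain_rule_along_iterates\<close>: over windows of bounded length positions and
  velocities subconverge to a curve and its derivative, and at almost every time all elements of \<open>D\<close>
  have the same product with that derivative, so the integrands converge pointwise although the \<open>e\<^sub>k\<close>
  do not. Together these give \<open>energy_descent\<close>: on windows of bounded length the energy drops by \<open>\<kappa>\<close>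
  times the spent amount \<open>\<Sum> \<eta>\<^sub>k |p\<^sub>k|\<^sup>2\<close>, up to a vanishing error.

  Where long windows spend almost nothing, \<open>x\<close> stands still, \<open>y\<close> averages estimates that lie near the convex
  set \<open>D(a)\<close>, and the averaged optimality conditions put minus that average almost into the normal cone;
  hence \<open>a\<close> is stationary (\<open>stationary_if_idle_nearby\<close>). Consequently near a level that is not a
  critical value of \<open>g\<close> the energy loses a fixed amount per window, and such a level is never
  crossed upwards late in the run. The Sard condition puts such levels between any two cluster values of the
  energy, so the energy converges; then every window is asymptotically idle, every cluster point is stationary, and the
  subproblem values tend to zero, so \<open>g(x\<^sub>k)\<close> converges as well (\<open>adam_iteration.convergence\<close>).

  The estimates \<open>e\<^sub>k\<close> approach \<open>D\<close> (\<open>gradient_estimates_limit\<close>) because the multiplier recursion is a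
  contraction towards \<open>\<beta> regu(w)\<close>: its forcing is asymptotically constant where \<open>c\<close> does not vanish, and
  its bound \<open>\<beta>\<close> suffices where it does. Finally, under the regularity condition a stationary point with \<open>c \<noteq> 0\<close>
  would force \<open>\<beta> \<le> M\<^sub>f/\<nu>\<close>, so stationary points are feasible, and feasible ones are KKT points.\<close>

section \<open>Integrating the derivative of a Lipschitz function\<close>

lemma lipschitz_integral_mean_value:
  fixes h :: "real \<Rightarrow> real"
  assumes lip: "L-lipschitz_on {0..} h" and "0 \<le> a" "0 < r"
  shows "\<bar>integral {a..a + r} h / r - h a\<bar> \<le> L * r"
proof -
  have cont: "continuous_on {a..a + r} h"
    using lipschitz_on_continuous_on[OF lip] by (rule continuous_on_subset) (use assms in auto)
  have "integral {a..a + r} h - r * h a = integral {a..a + r} (\<lambda>s. h s - h a)"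
    using \<open>0 < r\<close> by (subst integral_diff) (auto intro: integrable_continuous_real cont)
  also have "norm \<dots> \<le> (L * r) * (a + r - a)"
  proof (rule integral_bound)
    fix s assume "s \<in> {a..a + r}"
    then have "norm (h s - h a) \<le> L * \<bar>s - a\<bar>"
      using lipschitz_onD[OF lip, of s a] \<open>0 \<le> a\<close> by (auto simp: dist_norm)
    also have "\<dots> \<le> L * r"
      using \<open>s \<in> _\<close> lipschitz_on_nonneg[OF lip] by (intro mult_left_mono) auto
    finally show "norm (h s - h a) \<le> L * r" .
  qed (use \<open>0 < r\<close> in \<open>auto intro!: continuous_intros cont\<close>)
  finally have "\<bar>integral {a..a + r} h - r * h a\<bar> \<le> L * r * r" by simp
  moreover have "integral {a..a + r} h / r - h a = (integral {a..a + r} h - r * h a) / r"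
    using \<open>0 < r\<close> by (simp add: field_simps)
  ultimately show ?thesis
    using \<open>0 < r\<close> by (simp add: abs_divide pos_divide_le_eq)
qed

lemma integral_difference_quotient:
  fixes h :: "real \<Rightarrow> real"
  assumes cont: "continuous_on {0..} h" and "0 \<le> T" "0 < r"
  shows "((\<lambda>t. (h (t + r) - h t) / r) has_integral
           integral {T..T + r} h / r - integral {0..0 + r} h / r) {0..T}"
proof -
  have int: "h integrable_on {u..v}" if "0 \<le> u" for u v
    using that by (intro integrable_continuous_real continuous_on_subset[OF cont]) auto
  have "(\<lambda>t. h (t + r)) integrable_on {0..T}"
    using \<open>0 < r\<close>
    by (intro integrable_continuous_real continuous_on_compose2[OF cont]) (auto intro!: continuous_intros)
  moreover have "integral {0..T} (\<lambda>t. h (t + r)) = integral {r..T + r} h"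
    using integral_shift[of 0 r T h] \<open>0 < r\<close> continuous_on_subset[OF cont, of "{r..T + r}"]
    by (simp add: o_def)
  ultimately have "((\<lambda>t. h (t + r)) has_integral integral {r..T + r} h) {0..T}"
    by (simp add: has_integral_iff)
  from has_integral_diff[OF this integrable_integral[OF int[of 0 T]]]
  have *: "((\<lambda>t. h (t + r) - h t) has_integral integral {r..T + r} h - integral {0..T} h) {0..T}"
    by simp
  have "integral {0..T} h + integral {T..T + r} h = integral {0..T + r} h"
    using assms by (intro Henstock_Kurzweil_Integration.integral_combine int) auto
  moreover have "integral {0..r} h + integral {r..T + r} h = integral {0..T + r} h"
    using assms by (intro Henstock_Kurzweil_Integration.integral_combine int) auto
  ultimately have "integral {r..T + r} h - integral {0..T} h = integral {T..T + r} h - integral {0..r} h"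
    by simp
  with has_integral_divide[OF *, of r] show ?thesis
    by (simp add: diff_divide_distrib)
qed

text \<open>The difference quotients of \<open>h\<close> are bounded by the Lipschitz constant and converge almost
  everywhere, and their integrals telescope to means of \<open>h\<close> near the two endpoints; dominated convergence
  concludes. Differentiability almost everywhere is a hypothesis because conservativity supplies it.\<close>
lemma has_integral_AE_derivative_lipschitz:
  fixes h \<phi> :: "real \<Rightarrow> real"
  assumes lip: "L-lipschitz_on {0..} h"
    and der: "AE t in lebesgue. 0 \<le> t \<longrightarrow> (h has_vector_derivative \<phi> t) (at t)"
    and "0 \<le> T"
  shows "(\<phi> has_integral h T - h 0) {0..T}"
proof -
  obtain N where N: "negligible N" "\<And>t. 0 \<le> t \<Longrightarrow> t \<notin> N \<Longrightarrow> (h has_vector_derivative \<phi> t) (at t)"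
    using der unfolding eventually_ae_filter negligible_iff_null_sets by auto
  define r where "r n = inverse (real (Suc n))" for n
  have r: "r \<longlonglongrightarrow> 0" "\<And>n. 0 < r n"
    unfolding r_def using LIMSEQ_inverse_real_of_nat by auto
  define q where "q n t = (h (t + r n) - h t) / r n" for n t
  have cont: "continuous_on {0..} h"
    using lipschitz_on_continuous_on[OF lip] .
  have L: "L \<ge> 0" using lipschitz_on_nonneg[OF lip] .
  have q: "(q n has_integral integral {T..T + r n} h / r n - integral {0..0 + r n} h / r n) {0..T}" for n
    using integral_difference_quotient[OF cont \<open>0 \<le> T\<close> r(2)[of n]] unfolding q_def[abs_def] .
  define F where "F n t = (if t \<in> N then 0 else q n t)" for n t
  define G where "G t = (if t \<in> N then 0 else \<phi> t)" for t
  have F: "(F n has_integral integral {T..T + r n} h / r n - integral {0..0 + r n} h / r n) {0..T}" for n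
    by (rule has_integral_spike[OF N(1) _ q]) (auto simp: F_def)
  have bound: "norm (F n t) \<le> L" if "t \<in> {0..T}" for n t
  proof -
    have "\<bar>h (t + r n) - h t\<bar> \<le> L * \<bar>t + r n - t\<bar>"
      using lipschitz_onD[OF lip, of "t + r n" t] that less_imp_le[OF r(2)[of n]] by (auto simp: dist_norm)
    then show ?thesis
      using r(2)[of n] L by (auto simp: F_def q_def abs_divide pos_divide_le_eq)
  qed
  have conv: "(\<lambda>n. F n t) \<longlonglongrightarrow> G t" if "t \<in> {0..T}" for t
  proof (cases "t \<in> N")
    case False
    then have "((\<lambda>s. (h (t + s) - h t) / s) \<longlongrightarrow> \<phi> t) (at 0)"
      using N(2)[of t] that
      by (simp add: has_real_derivative_iff_has_vector_derivative[symmetric] DERIV_def)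
    moreover have "filterlim r (at 0) sequentially"
      using r by (intro filterlim_atI) (auto simp: less_imp_neq[symmetric] intro!: always_eventually)
    ultimately have "(\<lambda>n. (h (t + r n) - h t) / r n) \<longlonglongrightarrow> \<phi> t"
      by (rule filterlim_compose)
    then show ?thesis using False by (simp add: F_def G_def q_def)
  qed (simp add: F_def G_def)
  have mean: "(\<lambda>n. integral {a..a + r n} h / r n) \<longlonglongrightarrow> h a" if "0 \<le> a" for a
  proof -
    have "(\<lambda>n. L * r n) \<longlonglongrightarrow> 0" using tendsto_mult_left[OF r(1), of L] by simp
    then have "(\<lambda>n. integral {a..a + r n} h / r n - h a) \<longlonglongrightarrow> 0"
      by (rule Lim_null_comparison[rotated])
         (use lipschitz_integral_mean_value[OF lip that r(2)] in \<open>auto intro!: always_eventually\<close>)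
    then show ?thesis by (simp add: LIM_zero_iff)
  qed
  have dc: "G integrable_on {0..T}" "(\<lambda>n. integral {0..T} (F n)) \<longlonglongrightarrow> integral {0..T} G"
    using dominated_convergence[of F "{0..T}" "\<lambda>_. L" G, OF _ _ bound conv] F
    by (auto simp: has_integral_iff integrable_on_const)
  have "(\<lambda>n. integral {0..T} (F n)) \<longlonglongrightarrow> h T - h 0"
    using tendsto_diff[OF mean[OF \<open>0 \<le> T\<close>] mean[of 0]] F
    by (simp add: has_integral_iff)
  then have "integral {0..T} G = h T - h 0"
    using dc(2) LIMSEQ_unique by blast
  with dc(1) have "(G has_integral h T - h 0) {0..T}"
    by (simp add: has_integral_iff)
  then show ?thesis
    by (rule has_integral_spike[OF N(1), rotated]) (auto simp: G_def)
qed

section \<open>Limits of slowly varying step functions\<close>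

text \<open>A pointwise Arzela-Ascoli argument for functions that may jump, provided the jumps vanish in the
  limit. Pointwise limits are enough for dominated convergence, so the step functions need not be
  replaced by continuous interpolations.\<close>
lemma asymptotically_equilipschitz_convergent_subsequence:
  fixes F :: "nat \<Rightarrow> real \<Rightarrow> 'a::euclidean_space"
  assumes bound: "\<And>n t. 0 \<le> t \<Longrightarrow> norm (F n t) \<le> B"
    and lip: "\<And>e. e > 0 \<Longrightarrow> \<forall>\<^sub>F n in sequentially. \<forall>s t. 0 \<le> s \<and> s \<le> t \<longrightarrow> norm (F n t - F n s) \<le> L * (t - s) + e"
    and "0 \<le> L"
  obtains r G where "strict_mono (r :: nat \<Rightarrow> nat)" "\<And>t. 0 \<le> t \<Longrightarrow> (\<lambda>n. F (r n) t) \<longlonglongrightarrow> G t"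
    "L-lipschitz_on {0..} G"
proof -
  have "\<exists>r. strict_mono r \<and> (\<forall>t\<in>{t\<in>\<rat>. 0 \<le> t}. \<exists>l. (\<lambda>n. F (r n) t) \<longlonglongrightarrow> l)"
    by (rule function_convergent_subsequence[of "{t\<in>\<rat>. 0 \<le> t}" F B])
       (auto intro: bound countable_subset[OF _ countable_rat])
  then obtain r where r: "strict_mono (r::nat \<Rightarrow> nat)"
    and rat: "\<And>t. t \<in> \<rat> \<Longrightarrow> 0 \<le> t \<Longrightarrow> convergent (\<lambda>n. F (r n) t)"
    by (auto simp: convergent_def)
  have "convergent (\<lambda>n. F (r n) t)" if "0 \<le> t" for t
  proof (rule Cauchy_convergent, rule metric_CauchyI)
    fix e :: real assume "0 < e"
    define dd where "dd = e / (8 * (L + 1))"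
    have "dd > 0" using \<open>0 < e\<close> \<open>0 \<le> L\<close> by (simp add: dd_def)
    then obtain s where s: "s \<in> \<rat>" "t < s" "s < t + dd"
      using Rats_dense_in_real[of t "t + dd"] by auto
    have "L * (s - t) \<le> L * dd" using s \<open>0 \<le> L\<close> by (intro mult_left_mono) auto
    also have "\<dots> \<le> e / 8" using \<open>0 \<le> L\<close> \<open>0 < e\<close> by (simp add: dd_def field_simps)
    finally have Ls: "L * (s - t) \<le> e / 8" .
    have "\<forall>\<^sub>F n in sequentially. norm (F (r n) s - F (r n) t) \<le> L * (s - t) + e / 8"
      by (rule eventually_mono[OF eventually_subseq[OF r lip[of "e/8"]]])
         (use s that \<open>0 < e\<close> in auto)
    then obtain N1 where N1: "\<And>n. n \<ge> N1 \<Longrightarrow> norm (F (r n) s - F (r n) t) \<le> e / 4"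
      using Ls by (fastforce simp: eventually_sequentially)
    have "Cauchy (\<lambda>n. F (r n) s)" using rat[of s] s that convergent_Cauchy by fastforce
    then obtain N2 where N2: "\<And>m n. m \<ge> N2 \<Longrightarrow> n \<ge> N2 \<Longrightarrow> norm (F (r m) s - F (r n) s) < e / 4"
      using \<open>0 < e\<close> CauchyD[of "\<lambda>n. F (r n) s" "e/4"] by auto
    have "dist (F (r m) t) (F (r n) t) < e" if "m \<ge> max N1 N2" "n \<ge> max N1 N2" for m n
    proof -
      have "dist (F (r m) t) (F (r n) t) \<le> norm (F (r m) s - F (r m) t) + norm (F (r m) s - F (r n) s)
          + norm (F (r n) s - F (r n) t)"
        unfolding dist_norm by norm
      then show ?thesis using N1[of m] N1[of n] N2[of m n] that \<open>0 < e\<close> by auto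
    qed
    then show "\<exists>M. \<forall>m\<ge>M. \<forall>n\<ge>M. dist (F (r m) t) (F (r n) t) < e" by blast
  qed
  then have G: "(\<lambda>n. F (r n) t) \<longlonglongrightarrow> lim (\<lambda>n. F (r n) t)" if "0 \<le> t" for t
    using that by (simp add: convergent_LIMSEQ_iff)
  define G where "G t = lim (\<lambda>n. F (r n) t)" for t
  have mono: "norm (G t - G s) \<le> L * (t - s)" if "0 \<le> s" "s \<le> t" for s t
  proof (rule field_le_epsilon)
    fix e :: real assume "0 < e"
    show "norm (G t - G s) \<le> L * (t - s) + e"
    proof (rule tendsto_upperbound[OF tendsto_norm[OF tendsto_diff]])
      show "(\<lambda>n. F (r n) t) \<longlonglongrightarrow> G t" "(\<lambda>n. F (r n) s) \<longlonglongrightarrow> G s"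
        using G that by (auto simp: G_def)
      show "\<forall>\<^sub>F n in sequentially. norm (F (r n) t - F (r n) s) \<le> L * (t - s) + e"
        using eventually_subseq[OF r lip[OF \<open>0 < e\<close>]] that by (auto elim!: eventually_mono)
    qed simp
  qed
  have G_lip: "L-lipschitz_on {0..} G"
  proof (rule lipschitz_onI)
    fix s t :: real assume "s \<in> {0..}" "t \<in> {0..}"
    then show "dist (G s) (G t) \<le> L * dist s t"
      using mono[of s t] mono[of t s]
      by (cases "s \<le> t") (auto simp: dist_norm norm_minus_commute)
  qed (rule \<open>0 \<le> L\<close>)
  show ?thesis
    by (rule that[OF r _ G_lip]) (use G in \<open>simp add: G_def\<close>)
qed

section \<open>The chain rule along discrete iterates\<close>

lemma tendsto_if_subsequences_have_convergent_subsequence: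
  fixes f :: "nat \<Rightarrow> 'a::metric_space"
  assumes "\<And>r. strict_mono (r::nat \<Rightarrow> nat) \<Longrightarrow> \<exists>s. strict_mono (s::nat \<Rightarrow> nat) \<and> (\<lambda>n. f (r (s n))) \<longlonglongrightarrow> l"
  shows "f \<longlonglongrightarrow> l"
proof (rule ccontr)
  assume "\<not> f \<longlonglongrightarrow> l"
  then obtain e where e: "e > 0" "\<not> (\<forall>\<^sub>F n in sequentially. dist (f n) l < e)"
    by (auto simp: tendsto_iff)
  then have "\<exists>\<^sub>F n in sequentially. e \<le> dist (f n) l"
    by (simp add: frequently_def not_le)
  then have inf: "infinite {n. e \<le> dist (f n) l}"
    by (simp add: frequently_cofinite[symmetric] cofinite_eq_sequentially)
  define r where "r = enumerate {n. e \<le> dist (f n) l}"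
  have r: "strict_mono r" "\<And>n. e \<le> dist (f (r n)) l"
    using inf enumerate_in_set[OF inf] by (auto simp: r_def strict_mono_enumerate)
  obtain s where "(\<lambda>n. f (r (s n))) \<longlonglongrightarrow> l" using assms[OF r(1)] by blast
  then have "\<forall>\<^sub>F n in sequentially. dist (f (r (s n))) l < e" using e(1) by (simp add: tendsto_iff)
  then obtain n where "dist (f (r (s n))) l < e" by (auto simp: eventually_sequentially)
  with r(2)[of "s n"] show False by simp
qed

lemma lipschitz_on_imp_abs_cont_curve:
  assumes lip: "L-lipschitz_on {0..} \<gamma>"
  shows "abs_cont_curve \<gamma>"
  unfolding abs_cont_curve_def
proof (intro allI impI)
  fix b e :: real assume "0 < e"
  have L: "0 \<le> L" using lipschitz_on_nonneg[OF lip] .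
  show "\<exists>d>0. \<forall>I. finite I \<and> (\<forall>(s, t)\<in>I. 0 \<le> s \<and> s \<le> t \<and> t \<le> b) \<and>
             disjoint_family_on (\<lambda>(s, t). {s<..<t}) I \<and> (\<Sum>(s, t)\<in>I. t - s) < d \<longrightarrow>
             (\<Sum>(s, t)\<in>I. norm (\<gamma> t - \<gamma> s)) < e"
  proof (intro exI conjI allI impI)
    show "0 < e / (L + 1)" using \<open>0 < e\<close> L by simp
    fix I :: "(real \<times> real) set"
    assume I: "finite I \<and> (\<forall>(s, t)\<in>I. 0 \<le> s \<and> s \<le> t \<and> t \<le> b) \<and>
             disjoint_family_on (\<lambda>(s, t). {s<..<t}) I \<and> (\<Sum>(s, t)\<in>I. t - s) < e / (L + 1)"
    have "(\<Sum>(s, t)\<in>I. norm (\<gamma> t - \<gamma> s)) \<le> (\<Sum>(s, t)\<in>I. L * (t - s))"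
    proof (rule sum_mono, clarify)
      fix s t assume "(s, t) \<in> I"
      then have "0 \<le> s" "s \<le> t" using I by auto
      then show "norm (\<gamma> t - \<gamma> s) \<le> L * (t - s)"
        using lipschitz_onD[OF lip, of t s] by (auto simp: dist_norm)
    qed
    also have "\<dots> = L * (\<Sum>(s, t)\<in>I. t - s)" by (simp add: sum_distrib_left case_prod_unfold)
    also have "\<dots> \<le> L * (e / (L + 1))" using I L by (intro mult_left_mono) auto
    also have "\<dots> < e" using L \<open>0 < e\<close> by (simp add: field_simps)
    finally show "(\<Sum>(s, t)\<in>I. norm (\<gamma> t - \<gamma> s)) < e" .
  qed
qed

lemma locally_lipschitz_imp_continuous:
  assumes "locally_lipschitz H"
  shows "continuous_on UNIV H"
proof (rule continuous_at_imp_continuous_on, rule ballI)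
  fix x
  obtain r L where "r > 0" "L-lipschitz_on (ball x r) H"
    using assms unfolding locally_lipschitz_def by meson
  then show "isCont H x"
    using lipschitz_on_continuous_on continuous_on_eq_continuous_at[of "ball x r" H] by fastforce
qed

lemma locally_lipschitz_imp_lipschitz_on_compact:
  assumes H: "locally_lipschitz H" and "compact K"
  obtains L where "L-lipschitz_on K H"
proof -
  have "local_lipschitz {0::real} K (\<lambda>_. H)"
    unfolding local_lipschitz_def
  proof (intro ballI)
    fix t x assume "x \<in> K"
    obtain r L where rL: "r > 0" "L-lipschitz_on (ball x r) H"
      using H unfolding locally_lipschitz_def by meson
    then show "\<exists>u>0. \<exists>L. \<forall>s\<in>cball t u \<inter> {0}. L-lipschitz_on (cball x u \<inter> K) H"
      by (intro exI[of _ "r/2"] conjI exI[of _ L] ballI lipschitz_on_subset[OF rL(2)]) auto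
  qed
  from local_lipschitz_compact_implies_lipschitz[OF this \<open>compact K\<close>] that
  show ?thesis by auto
qed

text \<open>The part of conservativity that concerns curves. It passes to convex hulls, because the vectors with a
  prescribed product with the velocity form a hyperplane.\<close>
definition chain_rule_field :: "('a::euclidean_space \<Rightarrow> real) \<Rightarrow> ('a \<Rightarrow> 'a set) \<Rightarrow> bool" where
  "chain_rule_field g D \<longleftrightarrow>
     (\<forall>\<gamma>. abs_cont_curve \<gamma> \<longrightarrow>
        (AE t in lebesgue. 0 \<le> t \<longrightarrow>
           (\<exists>u. (\<gamma> has_vector_derivative u) (at t) \<and>
                (\<forall>d\<in>D (\<gamma> t). ((g \<circ> \<gamma>) has_vector_derivative d \<bullet> u) (at t)))))"

locale stepsizes =
  fixes \<eta> :: "nat \<Rightarrow> real"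
  assumes pos: "\<And>k. 0 < \<eta> k"
    and vanish: "\<eta> \<longlonglongrightarrow> 0"
    and diverge: "filterlim (\<lambda>N. \<Sum>k<N. \<eta> k) at_top sequentially"
begin

lemma nonneg: "0 \<le> \<eta> k" using pos[of k] by simp

lemma time_split: "i \<le> j \<Longrightarrow> j \<le> k \<Longrightarrow> sum \<eta> {i..<k} = sum \<eta> {i..<j} + sum \<eta> {j..<k}"
  by (simp add: sum.atLeastLessThan_concat)

lemma time_nonneg: "0 \<le> sum \<eta> {i..<j}" by (intro sum_nonneg nonneg)

lemma time_mono: "j \<le> k \<Longrightarrow> sum \<eta> {i..<j} \<le> sum \<eta> {i..<k}"
  by (intro sum_mono2) (auto intro: nonneg)

lemma time_unbounded: "\<exists>k\<ge>i. t < sum \<eta> {i..<k}"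
proof -
  have "\<forall>\<^sub>F N in sequentially. t + sum \<eta> {..<i} < (\<Sum>k<N. \<eta> k)"
    using diverge by (simp add: filterlim_at_top_dense)
  then obtain N0 where N0: "\<And>N. N \<ge> N0 \<Longrightarrow> t + sum \<eta> {..<i} < (\<Sum>k<N. \<eta> k)"
    by (auto simp: eventually_sequentially)
  have "sum \<eta> {..<max N0 i} = sum \<eta> {..<i} + sum \<eta> {i..<max N0 i}"
    by (simp add: lessThan_atLeast0 sum.atLeastLessThan_concat)
  then show ?thesis using N0[of "max N0 i"] by (intro exI[of _ "max N0 i"]) auto
qed

text \<open>The step that is active when time \<open>t\<close> has elapsed since step \<open>i\<close>; it turns a sequence indexed by
  steps into a step function of time.\<close>
definition idx :: "nat \<Rightarrow> real \<Rightarrow> nat" where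
  "idx i t = (LEAST k. i \<le> k \<and> t < sum \<eta> {i..<Suc k})"

lemma idx: "i \<le> idx i t" "t < sum \<eta> {i..<Suc (idx i t)}"
proof -
  obtain k where "k \<ge> i" "t < sum \<eta> {i..<k}" using time_unbounded by blast
  then have "i \<le> k \<and> t < sum \<eta> {i..<Suc k}" using time_mono[of k "Suc k" i] by auto
  then have "i \<le> idx i t \<and> t < sum \<eta> {i..<Suc (idx i t)}" unfolding idx_def by (rule LeastI)
  then show "i \<le> idx i t" "t < sum \<eta> {i..<Suc (idx i t)}" by auto
qed

lemma idx_le: "0 \<le> t \<Longrightarrow> sum \<eta> {i..<idx i t} \<le> t"
proof (cases "idx i t = i")
  case False
  then obtain k where k: "idx i t = Suc k" "i \<le> k" using idx(1)[of i t] by (cases "idx i t") auto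
  then have "k < idx i t" by simp
  from not_less_Least[OF this[unfolded idx_def]] show ?thesis using k by auto
qed simp

lemma idx_eq: "i \<le> k \<Longrightarrow> sum \<eta> {i..<k} \<le> t \<Longrightarrow> t < sum \<eta> {i..<Suc k} \<Longrightarrow> idx i t = k"
proof (rule ccontr)
  assume k: "i \<le> k" "sum \<eta> {i..<k} \<le> t" "t < sum \<eta> {i..<Suc k}" and "idx i t \<noteq> k"
  then consider "Suc (idx i t) \<le> k" | "Suc k \<le> idx i t" by linarith
  then show False
  proof cases
    case 1 then show ?thesis using time_mono[OF 1, of i] idx(2)[of t i] k by auto
  next
    case 2
    have "0 \<le> t" using k(2) time_nonneg[of i k] by linarith
    then show ?thesis using time_mono[OF 2, of i] idx_le[of t i] k by auto
  qed
qed

lemma idx_time: "i \<le> k \<Longrightarrow> idx i (sum \<eta> {i..<k}) = k"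
  by (rule idx_eq) (auto simp: pos)

lemma idx_0: "idx i 0 = i" using idx_time[of i i] by simp

lemma idx_mono: "0 \<le> s \<Longrightarrow> s \<le> t \<Longrightarrow> idx i s \<le> idx i t"
  by (rule ccontr) (use time_mono[of "Suc (idx i t)" "idx i s" i] idx_le[of s i] idx(2)[of t i] in auto)

lemma idx_elapsed:
  assumes "0 \<le> s" "s \<le> t"
  shows "sum \<eta> {idx i s..<idx i t} \<le> t - s + \<eta> (idx i s)"
    and "t - s - \<eta> (idx i t) \<le> sum \<eta> {idx i s..<idx i t}"
proof -
  have 1: "sum \<eta> {i..<idx i t} = sum \<eta> {i..<idx i s} + sum \<eta> {idx i s..<idx i t}"
    using assms by (intro time_split idx idx_mono)
  have 2: "sum \<eta> {i..<idx i r} + \<eta> (idx i r) > r" for r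
    using idx(1)[of i r] idx(2)[of r i] by simp
  show "sum \<eta> {idx i s..<idx i t} \<le> t - s + \<eta> (idx i s)"
    using 1 2[of s] idx_le[of t i] assms by simp
  show "t - s - \<eta> (idx i t) \<le> sum \<eta> {idx i s..<idx i t}"
    using 1 2[of t] idx_le[of s i] assms by simp
qed

lemma has_integral_step_function:
  fixes H :: "nat \<Rightarrow> real"
  assumes "i \<le> j"
  shows "((\<lambda>t. H (idx i t)) has_integral (\<Sum>k\<in>{i..<j}. \<eta> k * H k)) {0..sum \<eta> {i..<j}}"
  using assms
proof (induction j rule: dec_induct)
  case (step j)
  have "((\<lambda>t. H j) has_integral \<eta> j * H j) {sum \<eta> {i..<j}..sum \<eta> {i..<Suc j}}"
    using has_integral_const_real[of "H j" "sum \<eta> {i..<j}" "sum \<eta> {i..<Suc j}"] step.hyps nonneg[of j]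
    by simp
  then have "((\<lambda>t. H (idx i t)) has_integral \<eta> j * H j) {sum \<eta> {i..<j}..sum \<eta> {i..<Suc j}}"
    by (rule has_integral_spike_finite[of "{sum \<eta> {i..<Suc j}}", rotated 2])
       (use step.hyps idx_eq[of i j] in auto)
  from has_integral_combine[OF _ _ step.IH this] show ?case
    using time_nonneg[of i j] nonneg[of j] step.hyps by auto
qed (simp add: has_integral_refl)

lemma step_function_integrable:
  fixes H :: "nat \<Rightarrow> real"
  shows "(\<lambda>t. H (idx i t)) integrable_on {0..t}"
proof -
  obtain j where "j \<ge> i" "t < sum \<eta> {i..<j}" using time_unbounded by blast
  then show ?thesis
    using has_integral_step_function[of i j H]
    by (auto intro!: integrable_on_subinterval[OF has_integral_integrable])
qed


lemma time_shift: "i \<le> j \<Longrightarrow> (\<Sum>k\<in>{i..<j}. \<eta> (Suc k)) \<le> sum \<eta> {i..<j} + \<eta> j"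
  using sum_mono2[of "{i..<Suc j}" "{Suc i..<Suc j}" \<eta>] nonneg
  by (simp add: sum.shift_bounds_Suc_ivl del: sum.op_ivl_Suc) simp

lemma increment_bound:
  fixes x :: "nat \<Rightarrow> 'a::real_normed_vector"
  assumes "\<And>k. norm (x (Suc k) - x k) \<le> C * (\<eta> k + \<eta> (Suc k))" and "0 \<le> C" "i \<le> j"
  shows "norm (x j - x i) \<le> C * (2 * sum \<eta> {i..<j} + \<eta> j)"
proof -
  have "norm (x j - x i) = norm (\<Sum>k\<in>{i..<j}. x (Suc k) - x k)"
    using \<open>i \<le> j\<close> by (simp add: sum_Suc_diff')
  also have "\<dots> \<le> (\<Sum>k\<in>{i..<j}. C * (\<eta> k + \<eta> (Suc k)))"
    by (intro sum_norm_le assms)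
  also have "\<dots> = C * (sum \<eta> {i..<j} + (\<Sum>k\<in>{i..<j}. \<eta> (Suc k)))"
    by (simp add: sum_distrib_left[symmetric] sum.distrib)
  also have "\<dots> \<le> C * (2 * sum \<eta> {i..<j} + \<eta> j)"
    using time_shift[OF \<open>i \<le> j\<close>] \<open>0 \<le> C\<close> by (intro mult_left_mono) auto
  finally show ?thesis .
qed

lemma stepsize_eventually_small: "e > 0 \<Longrightarrow> \<forall>\<^sub>F n in sequentially. \<forall>k\<ge>n. \<eta> k < e"
  using vanish[unfolded lim_sequentially, rule_format, of e]
  by (auto simp: eventually_sequentially nonneg) (meson le_trans)

lemma first_order_increment:
  fixes x p :: "nat \<Rightarrow> 'a::real_normed_vector"
  assumes step: "\<And>k. x (Suc k) = x k + \<eta> k *\<^sub>R p k"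
    and p_lip: "\<And>k. norm (p (Suc k) - p k) \<le> L * (\<eta> k + \<eta> (Suc k))" and "0 \<le> L" "i \<le> j"
  shows "norm (x j - x i - sum \<eta> {i..<j} *\<^sub>R p i) \<le> 2 * L * (sum \<eta> {i..<j})\<^sup>2"
proof -
  have "x j - x i = (\<Sum>k\<in>{i..<j}. \<eta> k *\<^sub>R p k)"
    using sum_Suc_diff'[OF \<open>i \<le> j\<close>, of x] by (simp add: step)
  then have "norm (x j - x i - sum \<eta> {i..<j} *\<^sub>R p i) = norm (\<Sum>k\<in>{i..<j}. \<eta> k *\<^sub>R (p k - p i))"
    by (simp add: scaleR_sum_left sum_subtractf scaleR_diff_right)
  also have "\<dots> \<le> (\<Sum>k\<in>{i..<j}. \<eta> k * (2 * L * sum \<eta> {i..<j}))"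
  proof (rule sum_norm_le)
    fix k assume k: "k \<in> {i..<j}"
    have "norm (p k - p i) \<le> L * (2 * sum \<eta> {i..<k} + \<eta> k)"
      using increment_bound[of p L i k] p_lip \<open>0 \<le> L\<close> k by auto
    also have "\<dots> \<le> L * (2 * sum \<eta> {i..<Suc k})"
      using k \<open>0 \<le> L\<close> nonneg[of k] by (intro mult_left_mono) auto
    also have "\<dots> \<le> L * (2 * sum \<eta> {i..<j})"
      using time_mono[of "Suc k" j i] k \<open>0 \<le> L\<close> by (intro mult_left_mono) auto
    finally have "norm (p k - p i) \<le> L * (2 * sum \<eta> {i..<j})" .
    from mult_left_mono[OF this nonneg[of k]]
    show "norm (\<eta> k *\<^sub>R (p k - p i)) \<le> \<eta> k * (2 * L * sum \<eta> {i..<j})"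
      using nonneg[of k] by (simp add: mult_ac)
  qed
  also have "\<dots> = 2 * L * (sum \<eta> {i..<j})\<^sup>2"
    by (simp add: sum_distrib_right[symmetric] power2_eq_square)
  finally show ?thesis .
qed

lemma idx_elapsed_tendsto:
  assumes "filterlim i at_top sequentially" "0 \<le> s" "s \<le> t"
  shows "(\<lambda>n. sum \<eta> {idx (i n) s..<idx (i n) t}) \<longlonglongrightarrow> t - s"
proof -
  have small: "(\<lambda>n. \<eta> (idx (i n) r)) \<longlonglongrightarrow> 0" for r
    by (rule filterlim_compose[OF vanish], rule filterlim_at_top_mono[OF assms(1)]) (auto simp: idx(1))
  show ?thesis
  proof (rule tendsto_sandwich[of "\<lambda>n. t - s - \<eta> (idx (i n) t)" _ _ "\<lambda>n. t - s + \<eta> (idx (i n) s)"])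
    show "(\<lambda>n. t - s - \<eta> (idx (i n) t)) \<longlonglongrightarrow> t - s"
      using tendsto_diff[OF tendsto_const small] by fastforce
    show "(\<lambda>n. t - s + \<eta> (idx (i n) s)) \<longlonglongrightarrow> t - s"
      using tendsto_add[OF tendsto_const small] by fastforce
  qed (use idx_elapsed[OF assms(2,3)] in \<open>auto intro!: always_eventually\<close>)
qed

text \<open>Identifies the velocity of the limit curve wherever it is differentiable. Estimates forward in time
  suffice, which is all that the discrete first-order bound gives.\<close>
lemma right_quotient_limit_is_derivative:
  fixes X :: "real \<Rightarrow> 'a::real_normed_vector"
  assumes "(X has_vector_derivative u) (at t)"
    and "\<And>s. t \<le> s \<Longrightarrow> norm (X s - X t - (s - t) *\<^sub>R q) \<le> C * (s - t)\<^sup>2"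
  shows "u = q"
proof -
  have "(X has_vector_derivative u) (at t within {t..})"
    using assms(1) by (rule has_vector_derivative_at_within)
  moreover have "(X has_vector_derivative q) (at t within {t..})"
    unfolding has_vector_derivative_def has_derivative_within
  proof (intro conjI bounded_linear_scaleR_left)
    have "((\<lambda>s. C * \<bar>s - t\<bar>) \<longlongrightarrow> C * \<bar>t - t\<bar>) (at t within {t..})" by (intro tendsto_intros)
    then have "((\<lambda>s. C * \<bar>s - t\<bar>) \<longlongrightarrow> 0) (at t within {t..})" by simp
    then show "((\<lambda>s. (1 / norm (s - t)) *\<^sub>R (X s - (X t + (s - t) *\<^sub>R q))) \<longlongrightarrow> 0) (at t within {t..})"
    proof (rule Lim_null_comparison[rotated])
      show "\<forall>\<^sub>F s in at t within {t..}. norm ((1 / norm (s - t)) *\<^sub>R (X s - (X t + (s - t) *\<^sub>R q))) \<le> C * \<bar>s - t\<bar>"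
        unfolding eventually_at_filter
      proof (rule always_eventually, intro allI impI)
        fix s assume "s \<noteq> t" "s \<in> {t..}"
        then show "norm ((1 / norm (s - t)) *\<^sub>R (X s - (X t + (s - t) *\<^sub>R q))) \<le> C * \<bar>s - t\<bar>"
          using assms(2)[of s] by (auto simp: divide_simps power2_eq_square diff_diff_eq mult.assoc)
      qed
    qed
  qed
  moreover have "at t within {t..} \<noteq> bot"
    using at_within_Icc_at_right[of t "t+1"] trivial_limit_at_right_real[of t]
    by (metis at_within_Ici_at_right trivial_limit_def)
  ultimately show ?thesis
    using vector_derivative_unique_within by blast
qed


text \<open>The vectors \<open>d k\<close> need not converge in any sense. What converges is their product with the
  velocities: cluster points of \<open>d\<close> lie in the field at the limit point, and on the limit curve
  almost every velocity has the same product with every element of the field.\<close>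
theorem chain_rule_along_iterates:
  fixes x p d :: "nat \<Rightarrow> 'a::euclidean_space" and g :: "'a \<Rightarrow> real"
  assumes g: "locally_lipschitz g" "chain_rule_field g D"
    and step: "\<And>k. x (Suc k) = x k + \<eta> k *\<^sub>R p k"
    and x_bd: "\<And>k. norm (x k) \<le> B" and p_bd: "\<And>k. norm (p k) \<le> P" and d_bd: "\<And>k. norm (d k) \<le> M"
    and p_lip: "\<And>k. norm (p (Suc k) - p k) \<le> L * (\<eta> k + \<eta> (Suc k))"
    and osc: "\<And>r a b. filterlim r at_top sequentially \<Longrightarrow> (\<lambda>n. x (r n)) \<longlonglongrightarrow> a \<Longrightarrow> (\<lambda>n. d (r n)) \<longlonglongrightarrow> b \<Longrightarrow> b \<in> D a"
    and "0 < e"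
  shows "\<forall>\<^sub>F i in sequentially. \<forall>j\<ge>i. sum \<eta> {i..<j} \<le> T \<longrightarrow>
           \<bar>g (x j) - g (x i) - (\<Sum>k\<in>{i..<j}. \<eta> k * (d k \<bullet> p k))\<bar> \<le> e"
proof (rule ccontr)
  define R where "R i j = g (x j) - g (x i) - (\<Sum>k\<in>{i..<j}. \<eta> k * (d k \<bullet> p k))" for i j
  assume "\<not> ?thesis"
  then have "\<forall>n. \<exists>i j. n \<le> i \<and> i \<le> j \<and> sum \<eta> {i..<j} \<le> T \<and> e < \<bar>R i j\<bar>"
    by (auto simp: eventually_sequentially R_def not_le)
  then obtain i0 j0 where ij0: "\<And>n. n \<le> i0 n" "\<And>n. i0 n \<le> j0 n" "\<And>n. sum \<eta> {i0 n..<j0 n} \<le> T"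
      "\<And>n. e < \<bar>R (i0 n) (j0 n)\<bar>" by metis
  have P: "0 \<le> P" and M: "0 \<le> M" using order_trans[OF norm_ge_zero p_bd] order_trans[OF norm_ge_zero d_bd] by auto
  have "0 \<le> L * (\<eta> 0 + \<eta> 1)" using order_trans[OF norm_ge_zero p_lip[of 0]] by simp
  then have L: "0 \<le> L" using pos[of 0] pos[of 1] by (simp add: zero_le_mult_iff)
  \<comment> \<open>position and velocity together, as step functions of the elapsed time\<close>
  define F where "F i t = (x (idx i t), p (idx i t))" for i t
  define C where "C = P + 2 * L"
  have C: "0 \<le> C" using P L by (simp add: C_def)
  have F_lip: "\<forall>\<^sub>F i in sequentially. \<forall>s t. 0 \<le> s \<and> s \<le> t \<longrightarrow> norm (F i t - F i s) \<le> C * (t - s) + a"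
    if "a > 0" for a
  proof -
    define b where "b = a / (C + L + 1)"
    have b: "0 < b" "(C + L) * b \<le> a" using \<open>a > 0\<close> C L by (auto simp: b_def field_simps)
    show ?thesis using stepsize_eventually_small[OF b(1)]
    proof (rule eventually_mono, intro allI impI)
      fix i s t assume small: "\<forall>k\<ge>i. \<eta> k < b" and st: "0 \<le> s \<and> s \<le> (t::real)"
      let ?S = "sum \<eta> {idx i s..<idx i t}"
      have S: "?S \<le> t - s + b"
        using idx_elapsed(1)[of s t i] st small[rule_format, OF idx(1)[of i s]] by simp
      have le: "idx i s \<le> idx i t" using st by (simp add: idx_mono)
      have "norm (x (idx i t) - x (idx i s)) = norm (\<Sum>k\<in>{idx i s..<idx i t}. \<eta> k *\<^sub>R p k)"
        using sum_Suc_diff'[OF le, of x] by (simp add: step)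
      also have "\<dots> \<le> (\<Sum>k\<in>{idx i s..<idx i t}. \<eta> k * P)"
        by (intro sum_norm_le) (auto intro!: mult_left_mono p_bd simp: nonneg)
      finally have 1: "norm (x (idx i t) - x (idx i s)) \<le> P * ?S" by (simp add: sum_distrib_left mult.commute)
      have "norm (p (idx i t) - p (idx i s)) \<le> L * (2 * ?S + \<eta> (idx i t))"
        by (rule increment_bound[OF p_lip L le])
      also have "\<dots> \<le> L * (2 * ?S + b)"
        using small[rule_format, OF idx(1)[of i t]] L by (intro mult_left_mono) auto
      finally have "norm (F i t - F i s) \<le> P * ?S + L * (2 * ?S + b)"
        using 1 norm_Pair_le[of "x (idx i t) - x (idx i s)" "p (idx i t) - p (idx i s)"]
        by (simp add: F_def)
      also have "\<dots> = C * ?S + L * b" by (simp add: C_def algebra_simps)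
      also have "\<dots> \<le> C * (t - s + b) + L * b" using S C by (simp add: mult_left_mono)
      also have "\<dots> = C * (t - s) + (C + L) * b" by (simp add: algebra_simps)
      finally show "norm (F i t - F i s) \<le> C * (t - s) + a" using b(2) by linarith
    qed
  qed
  have F_bd: "norm (F i t) \<le> B + P" for i t
    using norm_Pair_le[of "x (idx i t)" "p (idx i t)"] x_bd[of "idx i t"] p_bd[of "idx i t"] by (simp add: F_def)
  \<comment> \<open>pass to a subsequence of windows along which the lengths and the step functions converge\<close>
  have "bounded (range (\<lambda>n. sum \<eta> {i0 n..<j0 n}))"
    using ij0(3) time_nonneg by (intro boundedI[of _ T]) auto
  then obtain \<tau> r0 where r0: "strict_mono r0" and \<tau>0: "((\<lambda>n. sum \<eta> {i0 n..<j0 n}) \<circ> r0) \<longlonglongrightarrow> \<tau>"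
    using bounded_imp_convergent_subsequence by blast
  have i0: "filterlim (i0 \<circ> r0) at_top sequentially"
    by (rule filterlim_at_top_mono[OF filterlim_ident])
       (use ij0(1) order_trans[OF seq_suble[OF r0]] in \<open>auto intro!: always_eventually\<close>)
  obtain r1 G where r1: "strict_mono r1" and G: "\<And>t. 0 \<le> t \<Longrightarrow> (\<lambda>n. F ((i0 \<circ> r0) (r1 n)) t) \<longlonglongrightarrow> G t"
    and G_lip: "C-lipschitz_on {0..} G"
    by (rule asymptotically_equilipschitz_convergent_subsequence[of "\<lambda>n. F ((i0 \<circ> r0) n)" "B + P" C])
       (use F_bd C eventually_compose_filterlim[OF F_lip i0] in auto)
  define i j where "i n = i0 (r0 (r1 n))" and "j n = j0 (r0 (r1 n))" for n
  have i: "filterlim i at_top sequentially"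
    using filterlim_compose[OF i0 filterlim_subseq[OF r1]] by (simp add: i_def[abs_def] o_def)
  have ij: "i n \<le> j n" "e < \<bar>R (i n) (j n)\<bar>" for n
    using ij0 by (auto simp: i_def j_def)
  define S where "S n = sum \<eta> {i n..<j n}" for n
  have S: "S \<longlonglongrightarrow> \<tau>" "\<And>n. 0 \<le> S n"
    using LIMSEQ_subseq_LIMSEQ[OF \<tau>0 r1] time_nonneg by (auto simp: S_def[abs_def] i_def j_def o_def)
  have \<tau>: "0 \<le> \<tau>" using LIMSEQ_le_const[OF S(1)] S(2) by blast
  define X Q where "X t = fst (G t)" and "Q t = snd (G t)" for t
  have X: "(\<lambda>n. x (idx (i n) t)) \<longlonglongrightarrow> X t" and Q: "(\<lambda>n. p (idx (i n) t)) \<longlonglongrightarrow> Q t" if "0 \<le> t" for t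
    using tendsto_fst[OF G[OF that]] tendsto_snd[OF G[OF that]] by (auto simp: X_def Q_def F_def i_def)
  have idx_top: "filterlim (\<lambda>n. idx (i n) t) at_top sequentially" for t
    by (rule filterlim_at_top_mono[OF i]) (auto simp: idx(1))
  have X_lip: "C-lipschitz_on {0..} X"
  proof (rule lipschitz_onI)
    fix s t :: real assume "s \<in> {0..}" "t \<in> {0..}"
    then show "dist (X s) (X t) \<le> C * dist s t"
      using lipschitz_onD[OF G_lip, of s t] dist_fst_le[of "G s" "G t"] by (simp add: X_def)
  qed (rule C)
  have X_bd: "norm (X t) \<le> B" if "0 \<le> t" for t
    by (rule LIMSEQ_le_const2[OF tendsto_norm[OF X[OF that]]]) (auto simp: x_bd)
  have X_der: "u = Q t" if u: "(X has_vector_derivative u) (at t)" and "0 \<le> t" for u t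
  proof (rule right_quotient_limit_is_derivative[OF u])
    fix s assume "t \<le> s"
    let ?E = "\<lambda>n. sum \<eta> {idx (i n) t..<idx (i n) s}"
    have E: "?E \<longlonglongrightarrow> s - t" by (rule idx_elapsed_tendsto[OF i \<open>0 \<le> t\<close> \<open>t \<le> s\<close>])
    show "norm (X s - X t - (s - t) *\<^sub>R Q t) \<le> (2 * L) * (s - t)\<^sup>2"
    proof (rule LIMSEQ_le)
      show "(\<lambda>n. norm (x (idx (i n) s) - x (idx (i n) t) - ?E n *\<^sub>R p (idx (i n) t)))
          \<longlonglongrightarrow> norm (X s - X t - (s - t) *\<^sub>R Q t)"
        using \<open>0 \<le> t\<close> \<open>t \<le> s\<close> by (intro tendsto_intros X Q E) auto
      show "(\<lambda>n. (2 * L) * (?E n)\<^sup>2) \<longlonglongrightarrow> (2 * L) * (s - t)\<^sup>2"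
        by (intro tendsto_intros E)
    qed (use first_order_increment[OF step p_lip L] idx_mono \<open>0 \<le> t\<close> \<open>t \<le> s\<close> in auto)
  qed
  obtain Lg where Lg: "Lg-lipschitz_on (cball 0 B) g"
    using locally_lipschitz_imp_lipschitz_on_compact[OF g(1) compact_cball] by blast
  have "(Lg * C)-lipschitz_on {0..} (g \<circ> X)"
    by (rule lipschitz_on_compose[OF X_lip lipschitz_on_subset[OF Lg]]) (auto simp: X_bd)
  \<comment> \<open>at almost every time the products with the velocities converge, whatever the fields do\<close>
  define \<phi> where "\<phi> t = vector_derivative (g \<circ> X) (at t)" for t
  have ae: "AE t in lebesgue. 0 \<le> t \<longrightarrow> ((g \<circ> X) has_vector_derivative \<phi> t) (at t) \<and>
              (\<lambda>n. d (idx (i n) t) \<bullet> p (idx (i n) t)) \<longlonglongrightarrow> \<phi> t"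
    using g(2)[unfolded chain_rule_field_def, rule_format, OF lipschitz_on_imp_abs_cont_curve[OF X_lip]]
  proof (rule AE_mp, intro AE_I2 impI)
    fix t :: real
    assume "0 \<le> t \<longrightarrow> (\<exists>u. (X has_vector_derivative u) (at t) \<and>
                (\<forall>d\<in>D (X t). ((g \<circ> X) has_vector_derivative d \<bullet> u) (at t)))" and t: "0 \<le> t"
    then have D: "((g \<circ> X) has_vector_derivative d \<bullet> Q t) (at t)" if "d \<in> D (X t)" for d
      using X_der that by metis
    have cluster: "\<exists>s b. strict_mono (s :: nat \<Rightarrow> nat) \<and> b \<in> D (X t) \<and> (\<lambda>n. d (idx (i (r (s n))) t)) \<longlonglongrightarrow> b"
      if "strict_mono r" for r :: "nat \<Rightarrow> nat"
    proof -
      have "bounded (range (\<lambda>n. d (idx (i (r n)) t)))" using d_bd by (intro boundedI) auto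
      then obtain b s where s: "strict_mono s" "((\<lambda>n. d (idx (i (r n)) t)) \<circ> s) \<longlonglongrightarrow> b"
        using bounded_imp_convergent_subsequence by blast
      have rs: "strict_mono (r \<circ> s)" using \<open>strict_mono r\<close> s(1) by (rule strict_mono_o)
      have "b \<in> D (X t)"
        by (rule osc[of "\<lambda>n. idx (i ((r \<circ> s) n)) t"])
           (use filterlim_compose[OF idx_top filterlim_subseq[OF rs]]
                filterlim_compose[OF X[OF t] filterlim_subseq[OF rs]] s(2) in \<open>auto simp: o_def\<close>)
      with s show ?thesis by (auto simp: o_def)
    qed
    have \<phi>: "d \<bullet> Q t = \<phi> t" if "d \<in> D (X t)" for d
      using vector_derivative_at[OF D[OF that]] by (simp add: \<phi>_def)
    obtain b where "b \<in> D (X t)" using cluster[OF strict_mono_id] by blast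
    then have "((g \<circ> X) has_vector_derivative \<phi> t) (at t)" using D \<phi> by metis
    moreover have "(\<lambda>n. d (idx (i n) t) \<bullet> p (idx (i n) t)) \<longlonglongrightarrow> \<phi> t"
    proof (rule tendsto_if_subsequences_have_convergent_subsequence)
      fix r :: "nat \<Rightarrow> nat" assume r: "strict_mono r"
      obtain s b where s: "strict_mono s" "b \<in> D (X t)" "(\<lambda>n. d (idx (i (r (s n))) t)) \<longlonglongrightarrow> b"
        using cluster[OF r] by blast
      have "(\<lambda>n. p (idx (i (r (s n))) t)) \<longlonglongrightarrow> Q t"
        using filterlim_compose[OF Q[OF t] filterlim_subseq[OF strict_mono_o[OF r s(1)]]] by (simp add: o_def)
      from tendsto_inner[OF s(3) this] \<phi>[OF s(2)] s(1)
      show "\<exists>s. strict_mono s \<and> (\<lambda>n. d (idx (i (r (s n))) t) \<bullet> p (idx (i (r (s n))) t)) \<longlonglongrightarrow> \<phi> t" by auto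
    qed
    ultimately show "((g \<circ> X) has_vector_derivative \<phi> t) (at t) \<and>
              (\<lambda>n. d (idx (i n) t) \<bullet> p (idx (i n) t)) \<longlonglongrightarrow> \<phi> t" ..
  qed
  define H where "H n t = d (idx (i n) t) \<bullet> p (idx (i n) t)" for n t
  have H_bd: "norm (H n t) \<le> M * P" for n t
    using Cauchy_Schwarz_ineq2 mult_mono[OF d_bd p_bd M norm_ge_zero] order_trans
    unfolding H_def real_norm_def by blast
  have H_int: "H n integrable_on {0..t}" for n t
    unfolding H_def[abs_def] by (rule step_function_integrable[of "\<lambda>k. d k \<bullet> p k"])
  have "AE t in lebesgue. 0 \<le> t \<longrightarrow> ((g \<circ> X) has_vector_derivative \<phi> t) (at t)"
    using ae by (rule eventually_mono) auto
  then have g_int: "(\<phi> has_integral g (X \<tau>) - g (X 0)) {0..\<tau>}"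
    using has_integral_AE_derivative_lipschitz[OF \<open>(Lg * C)-lipschitz_on {0..} (g \<circ> X)\<close> _ \<tau>, of \<phi>] by simp
  have H_lim: "(\<lambda>n. integral {0..\<tau>} (H n)) \<longlonglongrightarrow> g (X \<tau>) - g (X 0)"
  proof -
    have "AE t in lebesgue. 0 \<le> t \<longrightarrow> (\<lambda>n. H n t) \<longlonglongrightarrow> \<phi> t"
      using ae by (rule eventually_mono) (simp add: H_def)
    then obtain N where N: "negligible N" "\<And>t. 0 \<le> t \<Longrightarrow> t \<notin> N \<Longrightarrow> (\<lambda>n. H n t) \<longlonglongrightarrow> \<phi> t"
      unfolding eventually_ae_filter negligible_iff_null_sets by auto
    define H' \<phi>' where "H' n t = (if t \<in> N then 0 else H n t)" and "\<phi>' t = (if t \<in> N then 0 else \<phi> t)" for n t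
    have H': "H' n integrable_on {0..\<tau>}" "integral {0..\<tau>} (H' n) = integral {0..\<tau>} (H n)" for n
      by (auto intro!: integrable_spike[OF H_int N(1)] integral_spike[OF N(1)] simp: H'_def)
    have "integral {0..\<tau>} \<phi>' = g (X \<tau>) - g (X 0)"
      using integral_spike[OF N(1), of "{0..\<tau>}" \<phi>' \<phi>] g_int by (auto simp: \<phi>'_def has_integral_iff)
    moreover have "(\<lambda>n. integral {0..\<tau>} (H' n)) \<longlonglongrightarrow> integral {0..\<tau>} \<phi>'"
      by (rule dominated_convergence(2)[of H' _ "\<lambda>_. M * P"])
         (use H' H_bd N M P in \<open>auto simp: H'_def \<phi>'_def integrable_on_const\<close>)
    ultimately show ?thesis by (simp add: H')
  qed
  have sums: "(\<Sum>k\<in>{i n..<j n}. \<eta> k * (d k \<bullet> p k)) = integral {0..S n} (H n)" for n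
    using has_integral_step_function[OF ij(1)[of n], of "\<lambda>k. d k \<bullet> p k"]
    by (simp add: has_integral_iff H_def[abs_def] S_def)
  have "(\<lambda>n. integral {0..S n} (H n) - integral {0..\<tau>} (H n)) \<longlonglongrightarrow> 0"
  proof (rule Lim_null_comparison)
    show "(\<lambda>n. M * P * \<bar>S n - \<tau>\<bar>) \<longlonglongrightarrow> 0"
      using tendsto_mult_right_zero[OF tendsto_rabs_zero[OF LIM_zero[OF S(1)]]] .
    have *: "\<bar>integral {0..v} (H n) - integral {0..u} (H n)\<bar> \<le> M * P * (v - u)" if "0 \<le> u" "u \<le> v" for u v n
    proof -
      have "integral {0..u} (H n) + integral {u..v} (H n) = integral {0..v} (H n)"
        using that by (intro Henstock_Kurzweil_Integration.integral_combine H_int)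
      moreover have "norm (integral {u..v} (H n)) \<le> M * P * (v - u)"
      proof -
        have "H n integrable_on {u..v}"
          using that by (intro integrable_on_subinterval[OF H_int[of n v]]) auto
        then have "norm (integral {u..v} (H n)) \<le> M * P * measure lborel {u..v}"
          using H_bd M P by (intro has_integral_bound_real[of "M * P" "{}" "H n"] integrable_integral) auto
        then show ?thesis using that by simp
      qed
      ultimately show ?thesis by auto
    qed
    show "\<forall>\<^sub>F n in sequentially. norm (integral {0..S n} (H n) - integral {0..\<tau>} (H n)) \<le> M * P * \<bar>S n - \<tau>\<bar>"
    proof (rule always_eventually, rule allI)
      fix n show "norm (integral {0..S n} (H n) - integral {0..\<tau>} (H n)) \<le> M * P * \<bar>S n - \<tau>\<bar>"
        using *[of "S n" \<tau> n] *[of \<tau> "S n" n] S(2)[of n] \<tau>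
        by (cases "S n \<le> \<tau>") (auto simp: abs_minus_commute)
    qed
  qed
  from tendsto_add[OF this H_lim]
  have sum_lim: "(\<lambda>n. \<Sum>k\<in>{i n..<j n}. \<eta> k * (d k \<bullet> p k)) \<longlonglongrightarrow> g (X \<tau>) - g (X 0)" by (simp add: sums)
  have "(\<lambda>n. x (j n) - x (idx (i n) \<tau>)) \<longlonglongrightarrow> 0"
    unfolding tendsto_iff
  proof (intro allI impI)
    fix a :: real assume "0 < a"
    have "(\<lambda>n. C * \<bar>S n - \<tau>\<bar>) \<longlonglongrightarrow> 0"
      using tendsto_mult_right_zero[OF tendsto_rabs_zero[OF LIM_zero[OF S(1)]]] .
    then have "\<forall>\<^sub>F n in sequentially. C * \<bar>S n - \<tau>\<bar> < a / 2"
      using \<open>0 < a\<close> by (intro order_tendstoD(2)) auto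
    moreover have "\<forall>\<^sub>F n in sequentially. \<forall>s t. 0 \<le> s \<and> s \<le> t \<longrightarrow> norm (F (i n) t - F (i n) s) \<le> C * (t - s) + a / 2"
      using eventually_compose_filterlim[OF F_lip[of "a/2"] i] \<open>0 < a\<close> by simp
    ultimately show "\<forall>\<^sub>F n in sequentially. dist (x (j n) - x (idx (i n) \<tau>)) 0 < a"
    proof eventually_elim
      case (elim n)
      have "norm (F (i n) (S n) - F (i n) \<tau>) \<le> C * \<bar>S n - \<tau>\<bar> + a / 2"
        using elim(2)[rule_format, of "S n" \<tau>] elim(2)[rule_format, of \<tau> "S n"] S(2)[of n] \<tau>
        by (cases "S n \<le> \<tau>") (auto simp: norm_minus_commute)
      moreover have "norm (x (idx (i n) (S n)) - x (idx (i n) \<tau>)) \<le> norm (F (i n) (S n) - F (i n) \<tau>)"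
        unfolding F_def diff_Pair by (rule norm_fst_le)
      moreover have "idx (i n) (S n) = j n" using idx_time[OF ij(1)] by (simp add: S_def)
      ultimately show ?case using elim(1) by simp
    qed
  qed
  from tendsto_add[OF this X[OF \<tau>]] have "(\<lambda>n. x (j n)) \<longlonglongrightarrow> X \<tau>" by simp
  moreover have "(\<lambda>n. x (i n)) \<longlonglongrightarrow> X 0" using X[of 0] by (simp add: idx_0)
  moreover have "isCont g z" for z
    using locally_lipschitz_imp_continuous[OF g(1)] continuous_on_eq_continuous_at[OF open_UNIV] by blast
  ultimately have "(\<lambda>n. R (i n) (j n)) \<longlonglongrightarrow> g (X \<tau>) - g (X 0) - (g (X \<tau>) - g (X 0))"
    unfolding R_def by (intro tendsto_diff sum_lim isCont_tendsto_compose[of _ g])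
  then have "\<forall>\<^sub>F n in sequentially. \<bar>R (i n) (j n)\<bar> < e"
    using \<open>0 < e\<close> by (intro order_tendstoD(2)[OF tendsto_rabs_zero]) auto
  then obtain n where "\<bar>R (i n) (j n)\<bar> < e" by (auto simp: eventually_sequentially)
  with ij(2)[of n] show False by simp
qed

end

section \<open>Energy descent of the preconditioned momentum iteration\<close>

lemma norm_vec_mult_le: "norm (a * b) \<le> norm a * norm (b :: real^'n)"
proof -
  have "norm (a * b) \<le> norm (norm a *\<^sub>R b)"
    by (rule norm_le_componentwise_cart) (auto simp: abs_mult intro!: mult_right_mono component_le_norm_cart)
  then show ?thesis by simp
qed

lemma inner_vec_mult_commute: "(V * a) \<bullet> b = (V * b) \<bullet> (a :: real^'n)"
  by (simp add: inner_vec_def mult_ac)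

lemma inner_vec_mult_ge: 
  assumes "\<And>i. \<mu> \<le> V $ i"
  shows "\<mu> * (norm a)\<^sup>2 \<le> (V * a) \<bullet> (a :: real^'n)"
  unfolding power2_norm_eq_inner inner_vec_def sum_distrib_left
  using assms by (intro sum_mono) (auto simp: mult.assoc intro!: mult_right_mono)

lemma abs_inner_vec_mult_le: "\<bar>(V * a) \<bullet> b\<bar> \<le> norm V * norm a * norm (b :: real^'n)"
  using Cauchy_Schwarz_ineq2[of "V * a" b] mult_right_mono[OF norm_vec_mult_le[of V a] norm_ge_zero[of b]] by simp

lemma bilinear_vec_mult:
  fixes U V a b c :: "real^'n"
  shows "(V * (a + b)) \<bullet> c = (V * a) \<bullet> c + (V * b) \<bullet> c" "(V * (a - b)) \<bullet> c = (V * a) \<bullet> c - (V * b) \<bullet> c"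
    "(V * (r *\<^sub>R a)) \<bullet> c = r * ((V * a) \<bullet> c)"
    "((U - V) * a) \<bullet> c = (U * a) \<bullet> c - (V * a) \<bullet> c"
  by (simp_all add: inner_vec_def algebra_simps sum.distrib sum_subtractf sum_distrib_left)

lemma quadratic_form_vec_mult:
  fixes V a b :: "real^'n"
  shows "(V * (a + t *\<^sub>R b)) \<bullet> (a + t *\<^sub>R b) = (V * a) \<bullet> a + 2 * t * ((V * a) \<bullet> b) + t\<^sup>2 * ((V * b) \<bullet> b)"
  by (simp add: inner_vec_def algebra_simps sum.distrib sum_distrib_left power2_eq_square)

text \<open>Comparing the prox point with the current iterate bounds the step by the strong convexity modulus \<open>\<mu>\<close>
  of the subproblem.\<close>
lemma variational_velocity_bound:
  fixes y V p :: "real^'n"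
  assumes \<mu>: "0 < \<mu>" "\<And>i. \<mu> \<le> V $ i" and vi: "(y + V * p) \<bullet> p \<le> 0"
  shows "norm p \<le> norm y / \<mu>"
proof -
  have "\<mu> * (norm p)\<^sup>2 \<le> (V * p) \<bullet> p" by (rule inner_vec_mult_ge) (rule \<mu>(2))
  also have "\<dots> \<le> - (y \<bullet> p)" using vi by (simp add: inner_add_left)
  also have "\<dots> \<le> norm y * norm p" using Cauchy_Schwarz_ineq2[of y p] by simp
  finally have "(\<mu> * norm p) * norm p \<le> norm y * norm p" by (simp add: power2_eq_square mult.assoc)
  then have "\<mu> * norm p \<le> norm y \<or> norm p = 0" using mult_right_le_imp_le[of "\<mu> * norm p" "norm p" "norm y"] by force
  then show ?thesis using \<mu>(1) by (auto simp: field_simps)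
qed

text \<open>The iteration reduced to what the Lyapunov argument sees. The direction \<open>p k\<close> enters only through
  the variational inequality of the prox step, the metric \<open>V\<close> only through bounds on its size and growth,
  and \<open>d\<close> only through its limits. In \<open>V_step\<close> the term \<open>2 * \<tau> * V\<close> allows exactly the decay of the metric
  that optimality of the prox point compensates, and the positive \<open>\<kappa>\<close> is what remains as descent.\<close>
locale adam_iteration = stepsizes \<eta> for \<eta> :: "nat \<Rightarrow> real" +
  fixes X :: "(real^'n) set" and g :: "real^'n \<Rightarrow> real" and D :: "real^'n \<Rightarrow> (real^'n) set"
    and x y p V d \<xi> :: "nat \<Rightarrow> real^'n" and \<tau> B \<mu> \<kappa> C\<^sub>V :: real
  assumes X: "closed X"
    and g: "locally_lipschitz g" "chain_rule_field g D"
    and D: "\<And>a. convex (D a)" "\<And>a. compact (D a)"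
    and x_step: "\<And>k. x (Suc k) = x k + \<eta> k *\<^sub>R p k"
    and y_step: "\<And>k. y (Suc k) = y k - (\<tau> * \<eta> k) *\<^sub>R (y k - (d k + \<xi> k))"
    and in_X: "\<And>k. x k \<in> X" "\<And>k. x k + p k \<in> X"
    and vi: "\<And>k z. z \<in> X \<Longrightarrow> 0 \<le> (y (Suc k) + V (Suc k) * p k) \<bullet> (z - (x k + p k))"
    and bounds: "\<And>k. norm (x k) \<le> B" "\<And>k. norm (y k) \<le> B" "\<And>k. norm (V k) \<le> B" "\<And>k. norm (d k) \<le> B" "\<And>k. norm (\<xi> k) \<le> B"
    and V_ge: "\<And>k i. \<mu> \<le> V k $ i"
    and V_step: "\<And>k. norm (V (Suc k) - V k) \<le> C\<^sub>V * \<eta> k"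
      "\<And>k i. \<eta> k * (2 * \<tau> * \<kappa> - 2 * \<tau> * V (Suc k) $ i) - C\<^sub>V * (\<eta> k)\<^sup>2 \<le> V (Suc k) $ i - V k $ i"
    and positive: "0 < \<tau>" "0 < \<mu>" "0 < \<kappa>"
    and noise: "\<And>T e. 0 < e \<Longrightarrow> \<forall>\<^sub>F i in sequentially. \<forall>j\<ge>i. sum \<eta> {i..<j} \<le> T \<longrightarrow> norm (\<Sum>k\<in>{i..<j}. \<eta> k *\<^sub>R \<xi> k) \<le> e"
    and osc: "\<And>r a b. filterlim r at_top sequentially \<Longrightarrow> (\<lambda>n. x (r n)) \<longlonglongrightarrow> a \<Longrightarrow> (\<lambda>n. d (r n)) \<longlonglongrightarrow> b \<Longrightarrow> b \<in> D a"
begin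

text \<open>Bounds for the velocities and for their Lipschitz constant in time.\<close>
definition "P = B / \<mu>"
definition "L = (3 * \<tau> * B + C\<^sub>V * P + B * P) / \<mu> + P"

lemma B_nonneg: "0 \<le> B" using order_trans[OF norm_ge_zero bounds(1)] .
lemma P_nonneg: "0 \<le> P" using B_nonneg positive by (simp add: P_def)
lemma CV_nonneg: "0 \<le> C\<^sub>V"
  using order_trans[OF norm_ge_zero V_step(1)[of 0]] pos[of 0] by (simp add: zero_le_mult_iff)
lemma L_nonneg: "0 \<le> L" using B_nonneg P_nonneg CV_nonneg positive by (simp add: L_def)

lemma vi_at_iterate: "(y (Suc k) + V (Suc k) * p k) \<bullet> p k \<le> 0"
  using vi[OF in_X(1)[of k], of k] by (simp add: inner_diff_right inner_add_right)

lemma p_bound: "norm (p k) \<le> P"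
  using variational_velocity_bound[OF positive(2) V_ge vi_at_iterate] bounds(2)[of "Suc k"] positive(2)
  unfolding P_def by (meson divide_right_mono less_imp_le order_trans)

lemma y_increment: "norm (y (Suc k) - y k) \<le> 3 * \<tau> * B * \<eta> k"
proof -
  have "norm (y k - (d k + \<xi> k)) \<le> B + (B + B)"
    by (rule order_trans[OF norm_triangle_ineq4])
       (intro add_mono bounds order_trans[OF norm_triangle_ineq])
  from mult_left_mono[OF this, of "\<tau> * \<eta> k"] show ?thesis
    using positive nonneg[of k] by (simp add: y_step abs_mult mult_ac)
qed

text \<open>Solutions of strongly monotone variational inequalities depend Lipschitz continuously on their data:
  each of two consecutive prox points is tested against the other, and the two inequalities are added.\<close>
lemma p_increment: "norm (p (Suc k) - p k) \<le> L * (\<eta> k + \<eta> (Suc k))"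
proof -
  define y1 y2 V1 V2 where "y1 = y (Suc k)" and "y2 = y (Suc (Suc k))"
    and "V1 = V (Suc k)" and "V2 = V (Suc (Suc k))"
  define u where "u = \<eta> k *\<^sub>R p k + (p (Suc k) - p k)"
  define w where "w = (y1 - y2) + ((V1 - V2) * p k + \<eta> k *\<^sub>R (V2 * p k))"
  have "0 \<le> (y1 + V1 * p k) \<bullet> u"
    using vi[OF in_X(2)[of "Suc k"], of k] by (simp add: y1_def V1_def u_def x_step algebra_simps)
  moreover have "0 \<le> - ((y2 + V2 * p (Suc k)) \<bullet> u)"
    using vi[OF in_X(2)[of k], of "Suc k"]
    unfolding y2_def V2_def u_def x_step inner_minus_right[symmetric] by (simp add: algebra_simps)
  moreover have "V2 * p (Suc k) = V2 * u - \<eta> k *\<^sub>R (V2 * p k) + V2 * p k"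
    by (simp add: u_def vec_eq_iff algebra_simps)
  ultimately have "(V2 * u) \<bullet> u \<le> w \<bullet> u"
    by (simp add: w_def inner_add_left inner_diff_left bilinear_vec_mult)
  also have "\<dots> \<le> norm w * norm u" using Cauchy_Schwarz_ineq2[of w u] by simp
  finally have "(\<mu> * norm u) * norm u \<le> norm w * norm u"
    using inner_vec_mult_ge[of \<mu> V2 u] V_ge by (simp add: V2_def power2_eq_square mult.assoc)
  then have "\<mu> * norm u \<le> norm w \<or> norm u = 0"
    using mult_right_le_imp_le[of "\<mu> * norm u" "norm u" "norm w"] by force
  then have u: "\<mu> * norm u \<le> norm w" by auto
  have "norm w \<le> norm (y1 - y2) + (norm ((V1 - V2) * p k) + norm (\<eta> k *\<^sub>R (V2 * p k)))"
    unfolding w_def by (intro order_trans[OF norm_triangle_ineq] add_left_mono norm_triangle_ineq)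
  also have "\<dots> \<le> 3 * \<tau> * B * \<eta> (Suc k) + (C\<^sub>V * \<eta> (Suc k) * P + \<eta> k * (B * P))"
  proof (intro add_mono)
    show "norm (y1 - y2) \<le> 3 * \<tau> * B * \<eta> (Suc k)"
      using y_increment[of "Suc k"] by (simp add: y1_def y2_def norm_minus_commute)
    have "norm (V1 - V2) \<le> C\<^sub>V * \<eta> (Suc k)"
      using V_step(1)[of "Suc k"] by (simp add: V1_def V2_def norm_minus_commute)
    then show "norm ((V1 - V2) * p k) \<le> C\<^sub>V * \<eta> (Suc k) * P"
      by (intro order_trans[OF norm_vec_mult_le] mult_mono p_bound) (auto simp: CV_nonneg nonneg)
    show "norm (\<eta> k *\<^sub>R (V2 * p k)) \<le> \<eta> k * (B * P)"
      using order_trans[OF norm_vec_mult_le[of V2 "p k"] mult_mono[OF _ p_bound B_nonneg norm_ge_zero]] bounds(3)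
      by (simp add: V2_def nonneg mult_left_mono)
  qed
  also have "\<dots> \<le> (3 * \<tau> * B + C\<^sub>V * P + B * P) * (\<eta> k + \<eta> (Suc k))"
    using positive B_nonneg P_nonneg CV_nonneg nonneg[of k] nonneg[of "Suc k"] by (simp add: algebra_simps)
  finally have "\<mu> * norm u \<le> (3 * \<tau> * B + C\<^sub>V * P + B * P) * (\<eta> k + \<eta> (Suc k))" using u by linarith
  then have "norm u \<le> (3 * \<tau> * B + C\<^sub>V * P + B * P) / \<mu> * (\<eta> k + \<eta> (Suc k))"
    using positive by (simp add: field_simps)
  moreover have "norm (p (Suc k) - p k) \<le> norm u + norm (\<eta> k *\<^sub>R p k)"
    using norm_triangle_ineq4[of u "\<eta> k *\<^sub>R p k"] by (simp add: u_def)
  moreover have "norm (\<eta> k *\<^sub>R p k) \<le> P * (\<eta> k + \<eta> (Suc k))"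
    using mult_left_mono[OF p_bound[of k] nonneg[of k]] P_nonneg nonneg[of k] nonneg[of "Suc k"] by (simp add: algebra_simps add_increasing2)
  ultimately show ?thesis by (simp add: L_def algebra_simps)
qed

text \<open>The optimal value of the prox subproblem at step \<open>k\<close>.\<close>
definition m :: "nat \<Rightarrow> real" where
  "m k = y (Suc k) \<bullet> p k + 1 / 2 * ((V (Suc k) * p k) \<bullet> p k)"

text \<open>A lower bound, to first order, for the growth rate of \<open>m\<close>, divided by \<open>\<tau>\<close>.\<close>
definition drift :: "nat \<Rightarrow> real" where
  "drift k = (d k + \<xi> k) \<bullet> p k + \<kappa> * (norm (p k))\<^sup>2"

text \<open>Collects the constants of the second-order terms in \<open>m_increment\<close>.\<close>
definition "C = 3 * \<tau>\<^sup>2 * B * P + C\<^sub>V * P\<^sup>2 / 2 + B * L * P + B * P\<^sup>2 / 2"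

lemma C_nonneg: "0 \<le> C"
  using positive B_nonneg P_nonneg CV_nonneg L_nonneg by (simp add: C_def)

lemma half_metric_increment:
  "\<eta> k * (\<tau> * \<kappa> * (norm q)\<^sup>2 - \<tau> * ((V (Suc k) * q) \<bullet> q)) - C\<^sub>V * (\<eta> k)\<^sup>2 / 2 * (norm q)\<^sup>2
     \<le> 1 / 2 * (((V (Suc k) - V k) * q) \<bullet> q)"
proof -
  define W where "W = (\<chi> i. \<eta> k * (2 * \<tau> * \<kappa> - 2 * \<tau> * V (Suc k) $ i) - C\<^sub>V * (\<eta> k)\<^sup>2)"
  have "(W * q) \<bullet> q \<le> ((V (Suc k) - V k) * q) \<bullet> q"
    unfolding inner_vec_def
    using V_step(2)[of k] by (intro sum_mono) (auto simp: W_def mult.assoc intro!: mult_right_mono)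
  moreover have "(W * q) \<bullet> q = \<eta> k * (2 * \<tau> * \<kappa> * (norm q)\<^sup>2 - 2 * \<tau> * ((V (Suc k) * q) \<bullet> q)) - C\<^sub>V * (\<eta> k)\<^sup>2 * (norm q)\<^sup>2"
    unfolding power2_norm_eq_inner inner_vec_def W_def
    by (simp add: algebra_simps sum_distrib_left sum_subtractf sum.distrib)
  ultimately show ?thesis by (simp add: algebra_simps)
qed

text \<open>An envelope estimate. Minimality of the old value is used against the new prox point, so only the
  data of the subproblem change: the anchor \<open>x\<close> (whose contribution has a sign by optimality), the
  momentum \<open>y\<close> (which yields the inner product in \<open>drift\<close>) and the metric \<open>V\<close>. The remaining terms
  \<open>- \<langle>y + V p, p\<rangle>\<close> are nonnegative by \<open>vi_at_iterate\<close>; everything else is of second order in the steps.\<close>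
lemma m_increment: "\<tau> * \<eta> (Suc k) * drift (Suc k) - C * (\<eta> k + \<eta> (Suc k))\<^sup>2 \<le> m (Suc k) - m k"
proof -
  define a b where "a = \<eta> k" and "b = \<eta> (Suc k)"
  have ab: "0 \<le> a" "0 \<le> b" by (auto simp: a_def b_def nonneg)
  define y1 y2 V1 V2 where "y1 = y (Suc k)" and "y2 = y (Suc (Suc k))"
    and "V1 = V (Suc k)" and "V2 = V (Suc (Suc k))"
  define q q' where "q = p k" and "q' = p (Suc k)"
  define l where "l = d (Suc k) + \<xi> (Suc k)"
  define s where "s = q' + a *\<^sub>R q"
  have m: "m k = y1 \<bullet> q + 1 / 2 * ((V1 * q) \<bullet> q)" "m (Suc k) = y2 \<bullet> q' + 1 / 2 * ((V2 * q') \<bullet> q')"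
    by (simp_all add: m_def y1_def y2_def V1_def V2_def q_def q'_def)
  \<comment> \<open>the next prox point competes in the current subproblem\<close>
  have "m k \<le> y1 \<bullet> s + 1 / 2 * ((V1 * s) \<bullet> s)"
  proof -
    have "0 \<le> (y1 + V1 * q) \<bullet> (s - q)"
      using vi[OF in_X(2)[of "Suc k"], of k]
      by (simp add: y1_def V1_def q_def q'_def s_def a_def x_step algebra_simps)
    moreover have "0 \<le> (V1 * (s - q)) \<bullet> (s - q)"
      using inner_vec_mult_ge[of \<mu> V1 "s - q"] V_ge positive mult_nonneg_nonneg[of \<mu> "(norm (s - q))\<^sup>2"]
      by (auto simp: V1_def intro: order_trans[rotated])
    ultimately show ?thesis
      using inner_vec_mult_commute[of V1 s q]
      by (simp add: m inner_add_left inner_diff_right bilinear_vec_mult)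
  qed
  also have "y1 \<bullet> s + 1 / 2 * ((V1 * s) \<bullet> s) = y1 \<bullet> q' + 1 / 2 * ((V1 * q') \<bullet> q') + a * ((V1 * (q' - q)) \<bullet> q)
      + a\<^sup>2 / 2 * ((V1 * q) \<bullet> q) + a * ((y1 + V1 * q) \<bullet> q)"
    using inner_vec_mult_commute[of V1 q q']
    by (simp add: s_def inner_add_left inner_add_right inner_diff_left bilinear_vec_mult algebra_simps power2_eq_square)
  finally have 1: "m (Suc k) - m k \<ge> (y2 - y1) \<bullet> q' + 1 / 2 * (((V2 - V1) * q') \<bullet> q')
      - a * ((V1 * (q' - q)) \<bullet> q) - a\<^sup>2 / 2 * ((V1 * q) \<bullet> q) - a * ((y1 + V1 * q) \<bullet> q)"
    by (simp add: m inner_diff_left bilinear_vec_mult algebra_simps)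
  have 2: "a * ((y1 + V1 * q) \<bullet> q) \<le> 0"
    using vi_at_iterate[of k] ab by (simp add: y1_def V1_def q_def mult_nonneg_nonpos)
  have Q: "norm q \<le> P" "norm q' \<le> P" by (simp_all add: q_def q'_def p_bound)
  have 3: "a * ((V1 * (q' - q)) \<bullet> q) \<le> B * L * P * (a * (a + b))"
  proof -
    have "(V1 * (q' - q)) \<bullet> q \<le> norm V1 * norm (q' - q) * norm q"
      using abs_inner_vec_mult_le[of V1 "q' - q" q] by simp
    also have "\<dots> \<le> B * (L * (a + b)) * P"
      using p_increment[of k] B_nonneg L_nonneg ab bounds(3)
      by (intro mult_mono Q) (auto simp: V1_def q_def q'_def a_def b_def)
    finally show ?thesis using mult_left_mono[OF _ ab(1)] by (fastforce simp: mult_ac)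
  qed
  have 4: "a\<^sup>2 / 2 * ((V1 * q) \<bullet> q) \<le> a\<^sup>2 / 2 * (B * P\<^sup>2)"
  proof (rule mult_left_mono)
    have "(V1 * q) \<bullet> q \<le> norm V1 * norm q * norm q" using abs_inner_vec_mult_le[of V1 q q] by simp
    also have "\<dots> \<le> B * P * P" using B_nonneg P_nonneg bounds(3) by (intro mult_mono Q) (auto simp: V1_def)
    finally show "(V1 * q) \<bullet> q \<le> B * P\<^sup>2" by (simp add: power2_eq_square mult.assoc)
  qed simp
  have y21: "y2 - y1 = - (\<tau> * b) *\<^sub>R (y1 - l)" by (simp add: y1_def y2_def b_def l_def y_step[of "Suc k"])
  have "(y2 - y1) \<bullet> q' = - (\<tau> * b) * (y1 \<bullet> q' - l \<bullet> q')"
    unfolding y21 by (simp add: inner_diff_left algebra_simps)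
  then have 5: "(y2 - y1) \<bullet> q' = \<tau> * b * (l \<bullet> q') - \<tau> * b * (y2 \<bullet> q') + \<tau> * b * ((y2 - y1) \<bullet> q')"
    unfolding inner_diff_left by algebra
  have 6: "\<tau> * b * ((y2 - y1) \<bullet> q') \<ge> - (3 * \<tau>\<^sup>2 * B * P * b\<^sup>2)"
  proof -
    have "\<bar>(y2 - y1) \<bullet> q'\<bar> \<le> (3 * \<tau> * B * b) * P"
      using y_increment[of "Suc k"] positive ab B_nonneg
      by (intro order_trans[OF Cauchy_Schwarz_ineq2] mult_mono Q) (auto simp: y1_def y2_def b_def)
    then have "\<tau> * b * (- ((3 * \<tau> * B * b) * P)) \<le> \<tau> * b * ((y2 - y1) \<bullet> q')"
      using positive ab by (intro mult_left_mono) auto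
    then show ?thesis by (simp add: power2_eq_square algebra_simps)
  qed
  have 7: "b * (\<tau> * \<kappa> * (norm q')\<^sup>2 - \<tau> * ((V2 * q') \<bullet> q')) - C\<^sub>V * b\<^sup>2 / 2 * P\<^sup>2 \<le> 1 / 2 * (((V2 - V1) * q') \<bullet> q')"
  proof -
    have "C\<^sub>V * b\<^sup>2 / 2 * (norm q')\<^sup>2 \<le> C\<^sub>V * b\<^sup>2 / 2 * P\<^sup>2"
      using Q CV_nonneg by (intro mult_left_mono power_mono) auto
    then show ?thesis using half_metric_increment[of "Suc k" q'] by (simp add: V1_def V2_def b_def)
  qed
  have 8: "\<tau> * b * ((y2 + V2 * q') \<bullet> q') \<le> 0"
    using vi_at_iterate[of "Suc k"] ab positive by (simp add: y2_def V2_def q'_def mult_nonneg_nonpos)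
  have "m (Suc k) - m k \<ge> \<tau> * b * (l \<bullet> q' + \<kappa> * (norm q')\<^sup>2)
      - (3 * \<tau>\<^sup>2 * B * P * b\<^sup>2 + C\<^sub>V * b\<^sup>2 / 2 * P\<^sup>2 + B * L * P * (a * (a + b)) + a\<^sup>2 / 2 * (B * P\<^sup>2))"
    using 1 2 3 4 5 6 7 8 by (simp add: inner_add_left algebra_simps)
  moreover have "3 * \<tau>\<^sup>2 * B * P * b\<^sup>2 + C\<^sub>V * b\<^sup>2 / 2 * P\<^sup>2 + B * L * P * (a * (a + b)) + a\<^sup>2 / 2 * (B * P\<^sup>2) \<le> C * (a + b)\<^sup>2"
  proof -
    have sq: "b\<^sup>2 \<le> (a + b)\<^sup>2" "a\<^sup>2 \<le> (a + b)\<^sup>2" "a * (a + b) \<le> (a + b)\<^sup>2"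
      using ab by (auto simp: power2_eq_square algebra_simps)
    have "(3 * \<tau>\<^sup>2 * B * P) * b\<^sup>2 \<le> (3 * \<tau>\<^sup>2 * B * P) * (a + b)\<^sup>2"
      "(C\<^sub>V * P\<^sup>2 / 2) * b\<^sup>2 \<le> (C\<^sub>V * P\<^sup>2 / 2) * (a + b)\<^sup>2"
      "(B * L * P) * (a * (a + b)) \<le> (B * L * P) * (a + b)\<^sup>2"
      "(B * P\<^sup>2 / 2) * a\<^sup>2 \<le> (B * P\<^sup>2 / 2) * (a + b)\<^sup>2"
      using B_nonneg P_nonneg L_nonneg CV_nonneg by (auto intro!: mult_left_mono sq)
    moreover have "C\<^sub>V * b\<^sup>2 / 2 * P\<^sup>2 = (C\<^sub>V * P\<^sup>2 / 2) * b\<^sup>2" "a\<^sup>2 / 2 * (B * P\<^sup>2) = (B * P\<^sup>2 / 2) * a\<^sup>2"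
      by simp_all
    ultimately show ?thesis unfolding C_def distrib_right by linarith
  qed
  ultimately show ?thesis by (simp add: drift_def a_def b_def l_def q'_def)
qed


text \<open>The estimate \<open>m_increment\<close> involves the rate at the later step. Subtracting \<open>\<tau> * \<eta> k * drift k\<close> shifts
  it to the earlier one, so that the increments of \<open>\<psi>\<close> are indexed like those of \<open>g\<close>.\<close>
definition \<psi> :: "nat \<Rightarrow> real" where "\<psi> k = m k - \<tau> * \<eta> k * drift k"

definition energy :: "nat \<Rightarrow> real" where "energy k = g (x k) - \<psi> k / \<tau>"

text \<open>Up to the factor \<open>\<kappa>\<close>, the energy lost between the steps \<open>i\<close> and \<open>j\<close>.\<close>
definition spent :: "nat \<Rightarrow> nat \<Rightarrow> real" where "spent i j = (\<Sum>k\<in>{i..<j}. \<eta> k * (norm (p k))\<^sup>2)"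

lemma \<psi>_growth:
  assumes "i \<le> j" and small: "\<And>k. i \<le> k \<Longrightarrow> \<eta> k \<le> a"
  shows "\<tau> * (\<Sum>k\<in>{i..<j}. \<eta> k * drift k) - C * (2 * a * (2 * sum \<eta> {i..<j} + a)) \<le> \<psi> j - \<psi> i"
proof -
  have a: "0 \<le> a" using order_trans[OF nonneg small[of i]] by simp
  have "(\<Sum>k\<in>{i..<j}. \<tau> * (\<eta> k * drift k) - C * (2 * a * (\<eta> k + \<eta> (Suc k)))) \<le> (\<Sum>k\<in>{i..<j}. \<psi> (Suc k) - \<psi> k)"
  proof (rule sum_mono)
    fix k assume "k \<in> {i..<j}"
    then have "\<eta> k + \<eta> (Suc k) \<le> 2 * a" using small[of k] small[of "Suc k"] by simp
    then have "C * (\<eta> k + \<eta> (Suc k))\<^sup>2 \<le> C * (2 * a * (\<eta> k + \<eta> (Suc k)))"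
      unfolding power2_eq_square using nonneg[of k] nonneg[of "Suc k"]
      by (intro mult_left_mono mult_right_mono C_nonneg) auto
    then show "\<tau> * (\<eta> k * drift k) - C * (2 * a * (\<eta> k + \<eta> (Suc k))) \<le> \<psi> (Suc k) - \<psi> k"
      using m_increment[of k] by (simp add: \<psi>_def algebra_simps)
  qed
  also have "\<dots> = \<psi> j - \<psi> i" by (rule sum_Suc_diff'[OF \<open>i \<le> j\<close>])
  finally have 1: "\<tau> * (\<Sum>k\<in>{i..<j}. \<eta> k * drift k) - C * (2 * a * (\<Sum>k\<in>{i..<j}. \<eta> k + \<eta> (Suc k))) \<le> \<psi> j - \<psi> i"
    by (simp add: sum_subtractf sum_distrib_left)
  have "(\<Sum>k\<in>{i..<j}. \<eta> k + \<eta> (Suc k)) \<le> 2 * sum \<eta> {i..<j} + a"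
    using time_shift[OF \<open>i \<le> j\<close>] small[OF \<open>i \<le> j\<close>] by (simp add: sum.distrib)
  then have "C * (2 * a * (\<Sum>k\<in>{i..<j}. \<eta> k + \<eta> (Suc k))) \<le> C * (2 * a * (2 * sum \<eta> {i..<j} + a))"
    using a by (intro mult_left_mono C_nonneg) auto
  with 1 show ?thesis by linarith
qed

text \<open>The noise is controlled only in sums over windows, hence summation by parts: the partial sums are
  small and the total variation of \<open>p\<close> over a window is bounded.\<close>
lemma noise_against_slow_directions:
  assumes "0 < e"
  shows "\<forall>\<^sub>F i in sequentially. \<forall>j\<ge>i. sum \<eta> {i..<j} \<le> T \<longrightarrow> \<bar>\<Sum>k\<in>{i..<j}. \<eta> k * (\<xi> k \<bullet> p k)\<bar> \<le> e"
proof -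
  define b where "b = e / (P + L * (2 * \<bar>T\<bar> + 1) + 1)"
  have pos': "0 < P + L * (2 * \<bar>T\<bar> + 1) + 1" using P_nonneg L_nonneg by (simp add: add_nonneg_pos)
  then have b: "0 < b" "b * (P + L * (2 * \<bar>T\<bar> + 1)) \<le> e"
    using \<open>0 < e\<close> by (auto simp: b_def field_simps)
  show ?thesis
    using noise[OF b(1), of T] stepsize_eventually_small[OF zero_less_one]
  proof eventually_elim
    case (elim i)
    define S where "S j = (\<Sum>k\<in>{i..<j}. \<eta> k *\<^sub>R \<xi> k)" for j
    show ?case
    proof (intro allI impI)
      fix j assume j: "i \<le> j" "sum \<eta> {i..<j} \<le> T"
      have S: "norm (S k) \<le> b" if "k \<in> {i..j}" for k
        using elim(1)[rule_format, of k] that time_mono[of k j i] j by (auto simp: S_def)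
      \<comment> \<open>summation by parts\<close>
      have "(\<Sum>k\<in>{i..<j}. \<eta> k * (\<xi> k \<bullet> p k)) = S j \<bullet> p j - (\<Sum>k\<in>{i..<j}. S (Suc k) \<bullet> (p (Suc k) - p k))"
        using j(1) by (induction j rule: dec_induct) (auto simp: S_def inner_add_left inner_diff_right)
      moreover have "\<bar>S j \<bullet> p j\<bar> \<le> b * P"
        using S[of j] j b by (intro order_trans[OF Cauchy_Schwarz_ineq2] mult_mono p_bound) auto
      moreover have "\<bar>\<Sum>k\<in>{i..<j}. S (Suc k) \<bullet> (p (Suc k) - p k)\<bar> \<le> (\<Sum>k\<in>{i..<j}. b * (L * (\<eta> k + \<eta> (Suc k))))"
      proof (rule order_trans[OF sum_abs], rule sum_mono)
        fix k assume "k \<in> {i..<j}"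
        then show "\<bar>S (Suc k) \<bullet> (p (Suc k) - p k)\<bar> \<le> b * (L * (\<eta> k + \<eta> (Suc k)))"
          using S[of "Suc k"] b by (intro order_trans[OF Cauchy_Schwarz_ineq2] mult_mono p_increment) auto
      qed
      moreover have "(\<Sum>k\<in>{i..<j}. b * (L * (\<eta> k + \<eta> (Suc k)))) \<le> b * (L * (2 * \<bar>T\<bar> + 1))"
      proof -
        have "(\<Sum>k\<in>{i..<j}. \<eta> k + \<eta> (Suc k)) \<le> 2 * \<bar>T\<bar> + 1"
          using time_shift[OF j(1)] j elim(2)[rule_format, OF j(1)] by (simp add: sum.distrib)
        then have "b * (L * (\<Sum>k\<in>{i..<j}. \<eta> k + \<eta> (Suc k))) \<le> b * (L * (2 * \<bar>T\<bar> + 1))"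
          using b by (intro mult_left_mono L_nonneg) auto
        then show ?thesis by (simp add: sum_distrib_left)
      qed
      ultimately show "\<bar>\<Sum>k\<in>{i..<j}. \<eta> k * (\<xi> k \<bullet> p k)\<bar> \<le> e"
        using b(2) by (simp add: algebra_simps)
    qed
  qed
qed

text \<open>In the sum of the chain rule for \<open>g\<close> and the growth of \<open>\<psi>\<close> the products of gradient estimates
  and velocities cancel.\<close>
theorem energy_descent:
  assumes "0 < e"
  shows "\<forall>\<^sub>F i in sequentially. \<forall>j\<ge>i. sum \<eta> {i..<j} \<le> T \<longrightarrow> energy j \<le> energy i - \<kappa> * spent i j + e"
proof -
  define a where "a = min 1 (e / 3 * \<tau> / (C * (2 * (2 * \<bar>T\<bar> + 1)) + 1))"
  have pos': "0 < C * (2 * (2 * \<bar>T\<bar> + 1)) + 1" using C_nonneg by (simp add: add_nonneg_pos)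
  then have a: "0 < a" "a \<le> 1" "a \<le> e / 3 * \<tau> / (C * (2 * (2 * \<bar>T\<bar> + 1)) + 1)"
    using \<open>0 < e\<close> positive by (auto simp: a_def)
  then have "a * (C * (2 * (2 * \<bar>T\<bar> + 1)) + 1) \<le> e / 3 * \<tau>"
    unfolding pos_le_divide_eq[OF pos', symmetric] by blast
  then have a3: "C * (2 * a * (2 * \<bar>T\<bar> + 1)) \<le> e / 3 * \<tau>" using a(1) by (simp add: algebra_simps)
  have e3: "0 < e / 3" using assms by simp
  have chain: "\<forall>\<^sub>F i in sequentially. \<forall>j\<ge>i. sum \<eta> {i..<j} \<le> T \<longrightarrow>
           \<bar>g (x j) - g (x i) - (\<Sum>k\<in>{i..<j}. \<eta> k * (d k \<bullet> p k))\<bar> \<le> e / 3"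
    by (rule chain_rule_along_iterates[OF g x_step bounds(1) p_bound bounds(4) p_increment osc e3])
  show ?thesis
    using chain noise_against_slow_directions[OF e3, of T] stepsize_eventually_small[OF a(1)]
  proof eventually_elim
    case (elim i)
    show ?case
    proof (intro allI impI)
      fix j assume j: "i \<le> j" "sum \<eta> {i..<j} \<le> T"
      have "2 * a * (2 * sum \<eta> {i..<j} + a) \<le> 2 * a * (2 * \<bar>T\<bar> + 1)"
        using j a by (intro mult_left_mono) auto
      then have "C * (2 * a * (2 * sum \<eta> {i..<j} + a)) \<le> C * (2 * a * (2 * \<bar>T\<bar> + 1))"
        by (rule mult_left_mono[OF _ C_nonneg])
      also note a3
      finally have "\<tau> * (\<Sum>k\<in>{i..<j}. \<eta> k * drift k) - e / 3 * \<tau> \<le> \<psi> j - \<psi> i"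
        using \<psi>_growth[OF j(1), of a] elim(3) less_imp_le by fastforce
      then have "(\<Sum>k\<in>{i..<j}. \<eta> k * drift k) - e / 3 \<le> (\<psi> j - \<psi> i) / \<tau>"
        using positive(1) by (simp add: field_simps)
      moreover have "(\<Sum>k\<in>{i..<j}. \<eta> k * drift k) = (\<Sum>k\<in>{i..<j}. \<eta> k * (d k \<bullet> p k))
          + (\<Sum>k\<in>{i..<j}. \<eta> k * (\<xi> k \<bullet> p k)) + \<kappa> * spent i j"
        by (simp add: drift_def spent_def inner_add_left distrib_left sum.distrib sum_distrib_left mult_ac)
      moreover have "\<bar>g (x j) - g (x i) - (\<Sum>k\<in>{i..<j}. \<eta> k * (d k \<bullet> p k))\<bar> \<le> e / 3"
        "\<bar>\<Sum>k\<in>{i..<j}. \<eta> k * (\<xi> k \<bullet> p k)\<bar> \<le> e / 3"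
        using elim(1,2) j by auto
      ultimately show "energy j \<le> energy i - \<kappa> * spent i j + e"
        unfolding energy_def diff_divide_distrib by linarith
    qed
  qed
qed

end

section \<open>Idle windows, regular levels and convergence\<close>

lemma weighted_mean_near_convex:
  fixes u :: "nat \<Rightarrow> 'a::real_normed_vector"
  assumes "convex C" "finite I" "\<And>k. k \<in> I \<Longrightarrow> 0 \<le> w k" "sum w I = 1"
    and near: "\<And>k. k \<in> I \<Longrightarrow> \<exists>c\<in>C. norm (u k - c) \<le> \<epsilon>"
  shows "\<exists>c\<in>C. norm ((\<Sum>k\<in>I. w k *\<^sub>R u k) - c) \<le> \<epsilon>"
proof -
  obtain c where c: "\<And>k. k \<in> I \<Longrightarrow> c k \<in> C" "\<And>k. k \<in> I \<Longrightarrow> norm (u k - c k) \<le> \<epsilon>"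
    using near by metis
  show ?thesis
  proof
    show "(\<Sum>k\<in>I. w k *\<^sub>R c k) \<in> C" using assms c by (intro convex_sum) auto
    have "norm (\<Sum>k\<in>I. w k *\<^sub>R (u k - c k)) \<le> (\<Sum>k\<in>I. w k * \<epsilon>)"
      using assms c by (intro sum_norm_le) (auto intro!: mult_left_mono)
    then show "norm ((\<Sum>k\<in>I. w k *\<^sub>R u k) - (\<Sum>k\<in>I. w k *\<^sub>R c k)) \<le> \<epsilon>"
      using assms(4) by (simp add: scaleR_diff_right sum_subtractf sum_distrib_right[symmetric])
  qed
qed

context adam_iteration begin

definition window_end :: "nat \<Rightarrow> real \<Rightarrow> nat" where "window_end i T = Suc (idx i T)"

lemma window_end: "i < window_end i T" "T < sum \<eta> {i..<window_end i T}"
  "0 \<le> T \<Longrightarrow> sum \<eta> {i..<window_end i T} \<le> T + \<eta> (idx i T)"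
  using idx(1)[of i T] idx(2)[of T i] idx_le[of T i] by (auto simp: window_end_def)

lemma window_end_mono: "0 \<le> S \<Longrightarrow> S \<le> T \<Longrightarrow> window_end i S \<le> window_end i T"
  by (simp add: window_end_def idx_mono)

lemma spent_mono: "j \<le> k \<Longrightarrow> spent i j \<le> spent i k"
  unfolding spent_def by (intro sum_mono2) (auto simp: nonneg)

text \<open>Outer semicontinuity of the field along the iterates, in the form in which it is averaged over a
  window.\<close>
lemma field_near_limit:
  assumes "0 < \<epsilon>"
  shows "\<exists>\<rho>>0. \<forall>\<^sub>F k in sequentially. norm (x k - a) < \<rho> \<longrightarrow> (\<exists>c\<in>D a. norm (d k - c) \<le> \<epsilon>)"
proof (rule ccontr)
  assume "\<not> ?thesis"
  then have "\<exists>k\<ge>n. norm (x k - a) < inverse (real (Suc n)) \<and> (\<forall>c\<in>D a. \<epsilon> < norm (d k - c))" for n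
    unfolding eventually_sequentially by (metis inverse_positive_iff_positive not_le of_nat_0_less_iff zero_less_Suc)
  then obtain r where r: "\<And>n. n \<le> r n" "\<And>n. norm (x (r n) - a) < inverse (real (Suc n))"
      "\<And>n c. c \<in> D a \<Longrightarrow> \<epsilon> < norm (d (r n) - c)" by metis
  have r_top: "filterlim r at_top sequentially"
    by (rule filterlim_at_top_mono[OF filterlim_ident]) (use r(1) in auto)
  have "(\<lambda>n. x (r n) - a) \<longlonglongrightarrow> 0"
    by (rule Lim_null_comparison[OF _ LIMSEQ_inverse_real_of_nat]) (use r(2) less_imp_le in \<open>auto intro!: always_eventually\<close>)
  then have xr: "(\<lambda>n. x (r n)) \<longlonglongrightarrow> a" by (rule LIM_zero_cancel)
  have "bounded (range (\<lambda>n. d (r n)))" using bounds(4) by (intro boundedI) auto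
  then obtain b s where s: "strict_mono s" "((\<lambda>n. d (r n)) \<circ> s) \<longlonglongrightarrow> b"
    using bounded_imp_convergent_subsequence by blast
  have "b \<in> D a"
    by (rule osc[of "\<lambda>n. r (s n)"])
       (use filterlim_compose[OF r_top filterlim_subseq[OF s(1)]] LIMSEQ_subseq_LIMSEQ[OF xr s(1)] s(2)
         in \<open>auto simp: o_def\<close>)
  from LIM_zero[OF s(2)] have "(\<lambda>n. norm (d (r (s n)) - b)) \<longlonglongrightarrow> 0"
    by (simp add: o_def tendsto_norm_zero)
  then have "\<forall>\<^sub>F n in sequentially. norm (d (r (s n)) - b) < \<epsilon>"
    using assms by (intro order_tendstoD(2)) auto
  then obtain n where "norm (d (r (s n)) - b) < \<epsilon>" by (auto simp: eventually_sequentially)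
  with r(3)[OF \<open>b \<in> D a\<close>, of "s n"] show False by simp
qed

text \<open>The Cauchy-Schwarz inequality in time, in the form \<open>|p| \<le> s / 2 + |p|\<^sup>2 / (2 s)\<close> with the optimal \<open>s\<close>.\<close>
lemma travel_le_spent:
  assumes "0 < q" "0 \<le> T" "sum \<eta> {i..<j} \<le> T + 1" "spent i j \<le> q\<^sup>2 / (T + 1)"
  shows "(\<Sum>k\<in>{i..<j}. \<eta> k * norm (p k)) \<le> q"
proof -
  define s where "s = q / (T + 1)"
  have s: "0 < s" using assms by (simp add: s_def)
  have "(\<Sum>k\<in>{i..<j}. \<eta> k * norm (p k)) \<le> (\<Sum>k\<in>{i..<j}. s / 2 * \<eta> k + (\<eta> k * (norm (p k))\<^sup>2) / (2 * s))"
  proof (rule sum_mono)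
    fix k
    have "2 * s * norm (p k) \<le> s\<^sup>2 + (norm (p k))\<^sup>2" using sum_squares_bound[of s "norm (p k)"] by simp
    then have "norm (p k) \<le> s / 2 + (norm (p k))\<^sup>2 / (2 * s)"
      using s by (simp add: field_simps power2_eq_square)
    from mult_left_mono[OF this nonneg[of k]]
    show "\<eta> k * norm (p k) \<le> s / 2 * \<eta> k + (\<eta> k * (norm (p k))\<^sup>2) / (2 * s)"
      by (simp add: distrib_left mult_ac)
  qed
  also have "\<dots> = s / 2 * sum \<eta> {i..<j} + spent i j / (2 * s)"
    by (simp add: sum.distrib sum_distrib_left sum_divide_distrib spent_def)
  also have "\<dots> \<le> s / 2 * (T + 1) + (q\<^sup>2 / (T + 1)) / (2 * s)"
    using assms s by (intro add_mono mult_left_mono divide_right_mono) auto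
  also have "q\<^sup>2 / (T + 1) = q * s" by (simp add: s_def power2_eq_square)
  also have "s / 2 * (T + 1) + q * s / (2 * s) = (s * (T + 1)) / 2 + q / 2" using s by simp
  also have "s * (T + 1) = q" using assms by (simp add: s_def)
  also have "q / 2 + q / 2 = q" by simp
  finally show ?thesis .
qed

text \<open>Over an idle window of length \<open>T\<close> the time average of \<open>y\<close> differs from the average of the gradient
  estimates by \<open>O(1/T)\<close>, because the sum of the increments of \<open>y\<close> is bounded. The latter average is
  close to the convex set \<open>D a\<close>. Averaging the variational inequalities of the prox steps, in which \<open>x\<close> and
  the prox point may be replaced by \<open>a\<close> and \<open>V p\<close> by \<open>0\<close> at small cost, shows that its negative is almost
  normal to \<open>X\<close> at \<open>a\<close>. The bound is uniform in \<open>z\<close> up to the factor \<open>1 + norm (z - a)\<close>, which makes the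
  passage \<open>T \<rightarrow> \<infinity>\<close> possible with a single limit in \<open>D a\<close>.\<close>
lemma approximately_stationary:
  defines "A \<equiv> 3 * \<tau> * B + B * (7 + P) + 2 * B / \<tau> + 2"
  assumes T: "1 \<le> T"
    and idle: "\<And>K e. 0 < e \<Longrightarrow> \<exists>i\<ge>K. norm (x i - a) < e \<and> spent i (window_end i T) < e"
  shows "\<exists>c\<in>D a. \<forall>z\<in>X. - (A / T * (1 + norm (z - a))) \<le> c \<bullet> (z - a)"
proof -
  define \<epsilon> where "\<epsilon> = 1 / T"
  have \<epsilon>: "0 < \<epsilon>" "\<epsilon> \<le> 1" using T by (auto simp: \<epsilon>_def)
  obtain \<rho> where \<rho>: "0 < \<rho>" "\<forall>\<^sub>F k in sequentially. norm (x k - a) < \<rho> \<longrightarrow> (\<exists>c\<in>D a. norm (d k - c) \<le> \<epsilon>)"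
    using field_near_limit[OF \<epsilon>(1)] by blast
  define q where "q = min (\<rho> / 2) \<epsilon>"
  have q: "0 < q" "2 * q \<le> \<rho>" "q \<le> \<epsilon>" using \<rho>(1) \<epsilon> by (auto simp: q_def)
  have "\<forall>\<^sub>F k in sequentially. (norm (x k - a) < \<rho> \<longrightarrow> (\<exists>c\<in>D a. norm (d k - c) \<le> \<epsilon>)) \<and>
      (\<forall>j\<ge>k. sum \<eta> {k..<j} \<le> T + 1 \<longrightarrow> norm (\<Sum>l\<in>{k..<j}. \<eta> l *\<^sub>R \<xi> l) \<le> 1) \<and> (\<forall>l\<ge>k. \<eta> l < \<epsilon>)"
    by (intro eventually_conj \<rho>(2) noise stepsize_eventually_small \<epsilon>) simp
  then obtain K where K: "\<And>k. K \<le> k \<Longrightarrow> norm (x k - a) < \<rho> \<Longrightarrow> \<exists>c\<in>D a. norm (d k - c) \<le> \<epsilon>"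
      "\<And>k j. K \<le> k \<Longrightarrow> k \<le> j \<Longrightarrow> sum \<eta> {k..<j} \<le> T + 1 \<Longrightarrow> norm (\<Sum>l\<in>{k..<j}. \<eta> l *\<^sub>R \<xi> l) \<le> 1"
      "\<And>k. K \<le> k \<Longrightarrow> \<eta> k < \<epsilon>"
    unfolding eventually_sequentially by (metis order_refl)
  have "0 < min q (q\<^sup>2 / (T + 1))" using q T by simp
  from idle[OF this, of K] obtain i where i: "K \<le> i" "norm (x i - a) < q"
      "spent i (window_end i T) < q\<^sup>2 / (T + 1)" by auto
  define j I S where "j = window_end i T" and "I = {i..<j}" and "S = sum \<eta> I"
  have fin: "finite I" by (simp add: I_def)
  have ij: "i \<le> j" and S: "T \<le> S" "S \<le> T + 1"
    using window_end(1)[of i T] window_end(2,3)[of T i] T K(3)[OF order_trans[OF i(1) idx(1)[of i T]]] \<epsilon> by (auto simp: j_def I_def S_def)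
  have S0: "0 < S" using S T by linarith
  have travel: "(\<Sum>k\<in>I. \<eta> k * norm (p k)) \<le> q"
    unfolding I_def using travel_le_spent[OF q(1), of T i j] S T i(3) by (simp add: I_def S_def j_def)
  have xk: "norm (x k - a) < 2 * q" if k: "k \<in> I" for k
  proof -
    have "x k - x i = (\<Sum>l\<in>{i..<k}. \<eta> l *\<^sub>R p l)"
      using sum_Suc_diff'[of i k x] k by (simp add: x_step I_def)
    then have "norm (x k - x i) \<le> (\<Sum>l\<in>{i..<k}. \<eta> l * norm (p l))"
      by (auto intro!: sum_norm_le simp: nonneg)
    also have "\<dots> \<le> (\<Sum>l\<in>I. \<eta> l * norm (p l))"
      using k by (intro sum_mono2) (auto simp: I_def nonneg)
    finally have "norm (x k - x i) \<le> q" using travel by linarith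
    then show ?thesis using i(2) norm_triangle_ineq[of "x k - x i" "x i - a"] by simp
  qed
  define mean where "mean u = (\<Sum>k\<in>I. (\<eta> k / S) *\<^sub>R u k)" for u :: "nat \<Rightarrow> real^'n"
  have "\<exists>c\<in>D a. norm (mean d - c) \<le> \<epsilon>"
    unfolding mean_def
  proof (rule weighted_mean_near_convex[OF D(1) fin])
    show "(\<Sum>k\<in>I. \<eta> k / S) = 1" using S0 by (simp add: sum_divide_distrib[symmetric] S_def)
    show "\<exists>c\<in>D a. norm (d k - c) \<le> \<epsilon>" if "k \<in> I" for k
      using K(1)[of k] xk[OF that] q(2) i(1) that by (auto simp: I_def)
  qed (use S0 nonneg in auto)
  then obtain c where c: "c \<in> D a" "norm (mean d - c) \<le> \<epsilon>" by blast
  have mean_scale: "S *\<^sub>R mean u = (\<Sum>k\<in>I. \<eta> k *\<^sub>R u k)" for u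
    using S0 by (simp add: mean_def scaleR_sum_right)
  \<comment> \<open>y averages the gradients, up to a boundary term\<close>
  have "S * norm (mean y - mean d) \<le> 2 * B / \<tau> + 1"
  proof -
    have "y j - y i = (\<Sum>k\<in>I. y (Suc k) - y k)" using sum_Suc_diff'[OF ij, of y] by (simp add: I_def)
    also have "\<dots> = - \<tau> *\<^sub>R (S *\<^sub>R mean y - S *\<^sub>R mean d - (\<Sum>k\<in>I. \<eta> k *\<^sub>R \<xi> k))"
      unfolding mean_scale
      by (simp add: y_step scaleR_sum_right sum_subtractf[symmetric] sum_negf[symmetric] algebra_simps)
    finally have yj: "y j - y i = - \<tau> *\<^sub>R (S *\<^sub>R (mean y - mean d) - (\<Sum>k\<in>I. \<eta> k *\<^sub>R \<xi> k))"
      by (simp add: scaleR_diff_right)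
    then have "S *\<^sub>R (mean y - mean d) = (\<Sum>k\<in>I. \<eta> k *\<^sub>R \<xi> k) - (1 / \<tau>) *\<^sub>R (y j - y i)"
      using positive(1) by simp
    then have "S * norm (mean y - mean d) = norm ((\<Sum>k\<in>I. \<eta> k *\<^sub>R \<xi> k) - (1 / \<tau>) *\<^sub>R (y j - y i))"
      using S0 by (metis abs_of_pos norm_scaleR)
    also have "\<dots> \<le> norm (\<Sum>k\<in>I. \<eta> k *\<^sub>R \<xi> k) + norm ((1 / \<tau>) *\<^sub>R (y j - y i))"
      by (rule norm_triangle_ineq4)
    also have "\<dots> \<le> 1 + (B + B) / \<tau>"
    proof (rule add_mono)
      show "norm (\<Sum>k\<in>I. \<eta> k *\<^sub>R \<xi> k) \<le> 1" using K(2)[OF i(1) ij] S by (simp add: I_def S_def)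
      have "norm (y j - y i) \<le> B + B" by (rule order_trans[OF norm_triangle_ineq4 add_mono[OF bounds(2) bounds(2)]])
      then show "norm ((1 / \<tau>) *\<^sub>R (y j - y i)) \<le> (B + B) / \<tau>" using positive(1) by (simp add: divide_right_mono)
    qed
    finally show ?thesis by simp
  qed
  then have yd: "norm (mean y - mean d) \<le> (2 * B / \<tau> + 1) * \<epsilon>"
  proof -
    assume *: "S * norm (mean y - mean d) \<le> 2 * B / \<tau> + 1"
    have "T * norm (mean y - mean d) \<le> S * norm (mean y - mean d)" using S by (intro mult_right_mono) auto
    then show ?thesis using * T by (simp add: \<epsilon>_def field_simps)
  qed
  show ?thesis
  proof (intro bexI ballI)
    show "c \<in> D a" by (rule c(1))
    fix z assume z: "z \<in> X"
    define R where "R = norm (z - a)"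
    have R: "0 \<le> R" by (simp add: R_def)
    define E where "E = 3 * \<tau> * B * \<epsilon> * R + 2 * B * \<epsilon>"
    have "0 \<le> (\<Sum>k\<in>I. \<eta> k * (y k \<bullet> (z - a) + E + (B * (R + 3 + P)) * norm (p k)))"
    proof (intro sum_nonneg mult_nonneg_nonneg nonneg)
      fix k assume k: "k \<in> I"
      have near: "norm (a - x k) \<le> 2 * \<epsilon>" using xk[OF k] q(3) by (simp add: norm_minus_commute)
      have t1: "(y (Suc k) - y k) \<bullet> (z - a) \<le> 3 * \<tau> * B * \<epsilon> * R"
      proof -
        have "(y (Suc k) - y k) \<bullet> (z - a) \<le> norm (y (Suc k) - y k) * R"
          using Cauchy_Schwarz_ineq2[of "y (Suc k) - y k" "z - a"] by (simp add: R_def)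
        also have "\<dots> \<le> (3 * \<tau> * B * \<eta> k) * R" by (intro mult_right_mono y_increment R)
        also have "\<dots> \<le> (3 * \<tau> * B * \<epsilon>) * R"
          using K(3)[of k] i(1) k positive B_nonneg R by (intro mult_right_mono mult_left_mono) (auto simp: I_def)
        finally show ?thesis .
      qed
      have t2: "y (Suc k) \<bullet> (a - x k - p k) \<le> 2 * B * \<epsilon> + B * norm (p k)"
      proof -
        have "y (Suc k) \<bullet> (a - x k - p k) \<le> norm (y (Suc k)) * norm (a - x k - p k)"
          using Cauchy_Schwarz_ineq2[of "y (Suc k)" "a - x k - p k"] by simp
        also have "\<dots> \<le> B * (2 * \<epsilon> + norm (p k))"
          using norm_triangle_ineq4[of "a - x k" "p k"] near B_nonneg by (intro mult_mono bounds) auto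
        finally show ?thesis by (simp add: algebra_simps)
      qed
      have t3: "(V (Suc k) * p k) \<bullet> (z - (x k + p k)) \<le> B * norm (p k) * (R + 2 + P)"
      proof -
        have "(V (Suc k) * p k) \<bullet> (z - (x k + p k)) \<le> norm (V (Suc k)) * norm (p k) * norm (z - (x k + p k))"
          using abs_inner_vec_mult_le[of "V (Suc k)" "p k" "z - (x k + p k)"] by simp
        also have "\<dots> \<le> B * norm (p k) * (R + 2 + P)"
        proof (intro mult_mono bounds)
          have "norm (z - (x k + p k)) \<le> norm (z - a) + norm (a - x k) + norm (p k)" by norm
          then show "norm (z - (x k + p k)) \<le> R + 2 + P" using near p_bound[of k] \<epsilon> by (simp add: R_def)
        qed (use B_nonneg in auto)
        finally show ?thesis .
      qed
      have "(y (Suc k) + V (Suc k) * p k) \<bullet> (z - (x k + p k)) = y k \<bullet> (z - a) + (y (Suc k) - y k) \<bullet> (z - a)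
          + y (Suc k) \<bullet> (a - x k - p k) + (V (Suc k) * p k) \<bullet> (z - (x k + p k))"
        by (simp add: inner_add_left inner_diff_left inner_diff_right inner_add_right)
      with vi[OF z, of k] t1 t2 t3
      show "0 \<le> y k \<bullet> (z - a) + E + (B * (R + 3 + P)) * norm (p k)"
        by (simp add: E_def algebra_simps)
    qed
    also have "\<dots> = S * (mean y \<bullet> (z - a)) + S * E + (B * (R + 3 + P)) * (\<Sum>k\<in>I. \<eta> k * norm (p k))"
    proof -
      have "S * (mean y \<bullet> (z - a)) = (\<Sum>k\<in>I. \<eta> k * (y k \<bullet> (z - a)))"
        unfolding inner_scaleR_left[symmetric] mean_scale by (simp add: inner_sum_left)
      then show ?thesis
        by (simp add: distrib_left sum.distrib sum_distrib_left sum_distrib_right[symmetric] S_def mult_ac)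
    qed
    also have "(B * (R + 3 + P)) * (\<Sum>k\<in>I. \<eta> k * norm (p k)) \<le> (B * (R + 3 + P)) * (S * \<epsilon>)"
    proof (rule mult_left_mono)
      have "1 * \<epsilon> \<le> S * \<epsilon>" using S T \<epsilon> by (intro mult_right_mono) auto
      then show "(\<Sum>k\<in>I. \<eta> k * norm (p k)) \<le> S * \<epsilon>" using travel q(3) by simp
    qed (use B_nonneg P_nonneg R in auto)
    finally have "0 \<le> S * (mean y \<bullet> (z - a) + E + B * (R + 3 + P) * \<epsilon>)" by (simp add: algebra_simps)
    then have 1: "0 \<le> mean y \<bullet> (z - a) + E + B * (R + 3 + P) * \<epsilon>"
      using S0 by (simp add: zero_le_mult_iff)
    have 2: "mean y \<bullet> (z - a) \<le> mean d \<bullet> (z - a) + (2 * B / \<tau> + 1) * \<epsilon> * R"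
      using order_trans[OF Cauchy_Schwarz_ineq2[of "mean y - mean d" "z - a"] mult_right_mono[OF yd norm_ge_zero]]
      by (simp add: inner_diff_left R_def)
    have 3: "mean d \<bullet> (z - a) \<le> c \<bullet> (z - a) + \<epsilon> * R"
      using order_trans[OF Cauchy_Schwarz_ineq2[of "mean d - c" "z - a"] mult_right_mono[OF c(2) norm_ge_zero]]
      by (simp add: inner_diff_left R_def)
    have "E + B * (R + 3 + P) * \<epsilon> + (2 * B / \<tau> + 1) * \<epsilon> * R + \<epsilon> * R
        = \<epsilon> * (3 * \<tau> * B * R + 2 * B + B * (R + 3 + P) + (2 * B / \<tau> + 2) * R)"
      by (simp add: E_def algebra_simps)
    also have "\<dots> \<le> \<epsilon> * (A * (1 + R))"
    proof (rule mult_left_mono)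
      define b where "b = 2 * B / \<tau>"
      have "A * (1 + R) = 3 * \<tau> * B * R + 2 * B + B * (R + 3 + P) + (b + 2) * R
          + (3 * \<tau> * B + 2 * B + b + 2 + B * (6 + P) * R)"
        unfolding A_def b_def[symmetric] by (simp add: algebra_simps)
      moreover have "0 \<le> 3 * \<tau> * B + 2 * B + b + 2 + B * (6 + P) * R"
        using positive B_nonneg P_nonneg R by (simp add: b_def)
      ultimately show "3 * \<tau> * B * R + 2 * B + B * (R + 3 + P) + (2 * B / \<tau> + 2) * R \<le> A * (1 + R)"
        by (simp add: b_def)
    qed (use \<epsilon>(1) in simp)
    finally show "- (A / T * (1 + norm (z - a))) \<le> c \<bullet> (z - a)"
      using 1 2 3 by (simp add: \<epsilon>_def R_def)
  qed
qed

end

text \<open>Convergence in the form in which upcrossings are excluded.\<close>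
lemma bounded_sequence_convergent_if_no_two_limits:
  fixes f :: "nat \<Rightarrow> real"
  assumes bd: "bounded (range f)"
    and no: "\<And>a b. a < b \<Longrightarrow> \<exists>\<^sub>F n in sequentially. f n < a \<Longrightarrow> \<exists>\<^sub>F n in sequentially. b < f n \<Longrightarrow> False"
  shows "convergent f"
proof -
  obtain l r where r: "strict_mono r" "(f \<circ> r) \<longlonglongrightarrow> l" using bounded_imp_convergent_subsequence[OF bd] by blast
  have near: "\<exists>\<^sub>F n in sequentially. \<bar>f n - l\<bar> < e" if "0 < e" for e
  proof -
    have "\<forall>\<^sub>F n in sequentially. \<bar>f (r n) - l\<bar> < e" using r(2) that by (auto simp: tendsto_iff dist_norm)
    then obtain N where N: "\<And>n. n \<ge> N \<Longrightarrow> \<bar>f (r n) - l\<bar> < e" by (auto simp: eventually_sequentially)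
    show ?thesis
      unfolding frequently_sequentially
    proof
      fix M show "\<exists>n\<ge>M. \<bar>f n - l\<bar> < e"
        using N[of "max M N"] seq_suble[OF r(1), of "max M N"] by (intro exI[of _ "r (max M N)"]) auto
    qed
  qed
  have "f \<longlonglongrightarrow> l"
    unfolding tendsto_iff dist_norm real_norm_def
  proof (intro allI impI, rule ccontr)
    fix e :: real assume e: "0 < e" "\<not> (\<forall>\<^sub>F n in sequentially. \<bar>f n - l\<bar> < e)"
    then have *: "\<exists>\<^sub>F n in sequentially. f n \<le> l - e \<or> l + e \<le> f n"
      unfolding not_eventually by (auto elim!: frequently_elim1)
    have near4: "\<exists>\<^sub>F n in sequentially. \<bar>f n - l\<bar> < e / 4" using near[of "e / 4"] e(1) by simp
    from * consider "\<exists>\<^sub>F n in sequentially. f n \<le> l - e" | "\<exists>\<^sub>F n in sequentially. l + e \<le> f n"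
      by (auto simp: frequently_disj_iff)
    then show False
    proof cases
      case 1
      show ?thesis
      proof (rule no[of "l - e / 2" "l - e / 4"])
        show "\<exists>\<^sub>F n in sequentially. f n < l - e / 2" using 1 e(1) by (auto elim!: frequently_elim1)
        show "\<exists>\<^sub>F n in sequentially. l - e / 4 < f n" using near4 by (rule frequently_elim1) linarith
      qed (use e(1) in simp)
    next
      case 2
      show ?thesis
      proof (rule no[of "l + e / 4" "l + e / 2"])
        show "\<exists>\<^sub>F n in sequentially. l + e / 2 < f n" using 2 e(1) by (auto elim!: frequently_elim1)
        show "\<exists>\<^sub>F n in sequentially. f n < l + e / 4" using near4 by (rule frequently_elim1) linarith
      qed (use e(1) in simp)
    qed
  qed
  then show ?thesis by (auto simp: convergent_def)
qed

context adam_iteration begin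

text \<open>The approximate multipliers obtained for windows of length \<open>1, 2, \<dots>\<close> accumulate in the compact set
  \<open>D a\<close>.\<close>
lemma stationary_if_idle_nearby:
  assumes idle: "\<And>T e K. 1 \<le> T \<Longrightarrow> 0 < e \<Longrightarrow> \<exists>i\<ge>K. norm (x i - a) < e \<and> spent i (window_end i T) < e"
  shows "a \<in> stationary X D"
proof -
  have "a \<in> closure X"
    unfolding closure_approachable using idle[OF order_refl] in_X(1) by (metis dist_norm)
  then have "a \<in> X" using X by simp
  obtain A where A: "\<And>T. 1 \<le> T \<Longrightarrow> \<exists>c\<in>D a. \<forall>z\<in>X. - (A / T * (1 + norm (z - a))) \<le> c \<bullet> (z - a)"
    using approximately_stationary[OF _ idle] by metis
  have "\<exists>c\<in>D a. \<forall>z\<in>X. - (A / real (Suc n) * (1 + norm (z - a))) \<le> c \<bullet> (z - a)" for n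
    by (rule A) simp
  then obtain c where c: "\<And>n. c n \<in> D a" "\<And>n z. z \<in> X \<Longrightarrow> - (A / real (Suc n) * (1 + norm (z - a))) \<le> c n \<bullet> (z - a)"
    by metis
  obtain b r where b: "b \<in> D a" "strict_mono r" "(c \<circ> r) \<longlonglongrightarrow> b"
    using D(2)[of a] c(1) unfolding compact_def by metis
  have "0 \<le> b \<bullet> (z - a)" if z: "z \<in> X" for z
  proof (rule LIMSEQ_le)
    have "(\<lambda>n. A * (1 + norm (z - a)) * inverse (real (Suc n))) \<longlonglongrightarrow> A * (1 + norm (z - a)) * 0"
      by (intro tendsto_mult_left LIMSEQ_inverse_real_of_nat)
    then have "(\<lambda>n. - (A / real (Suc n) * (1 + norm (z - a)))) \<longlonglongrightarrow> 0"
      by (auto simp: field_simps dest: tendsto_minus)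
    then show "(\<lambda>n. - (A / real (Suc (r n)) * (1 + norm (z - a)))) \<longlonglongrightarrow> 0"
      using LIMSEQ_subseq_LIMSEQ[OF _ b(2)] by (fastforce simp: o_def)
    show "(\<lambda>n. c (r n) \<bullet> (z - a)) \<longlonglongrightarrow> b \<bullet> (z - a)"
      using b(3) by (intro tendsto_intros) (simp add: o_def)
  qed (use c(2)[OF z] in auto)
  then have "- b \<in> normal_cone X a" by (simp add: normal_cone_def)
  then have "0 \<in> D a + normal_cone X a" using b(1) by (force simp: set_plus_def)
  with \<open>a \<in> X\<close> show ?thesis by (simp add: stationary_def)
qed

text \<open>A velocity of size \<open>r\<close> persists for a time of order \<open>r / L\<close>, which would cost a fixed amount.\<close>
lemma idle_imp_small_velocity:
  assumes "0 < r"
  shows "\<exists>e>0. \<forall>\<^sub>F i in sequentially. spent i (window_end i 1) < e \<longrightarrow> norm (p i) < r"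
proof -
  define s where "s = min 1 (r / (8 * (L + 1)))"
  have s: "0 < s" "s \<le> 1" "L * (2 * s) \<le> r / 4"
  proof -
    show "0 < s" "s \<le> 1" using assms L_nonneg by (auto simp: s_def)
    have "L * (2 * s) \<le> (L + 1) * (2 * (r / (8 * (L + 1))))"
      using \<open>0 < s\<close> L_nonneg by (intro mult_mono) (auto simp: s_def)
    also have "\<dots> = r / 4" using L_nonneg by (simp add: field_simps)
    finally show "L * (2 * s) \<le> r / 4" .
  qed
  have "0 < r / (4 * (L + 1))" using assms L_nonneg by simp
  from stepsize_eventually_small[OF this]
  have ev: "\<forall>\<^sub>F i in sequentially. \<forall>k\<ge>i. \<eta> k < r / (4 * (L + 1))" .
  show ?thesis
  proof (intro exI conjI)
    show "0 < (r / 2)\<^sup>2 * s" using assms s by simp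
    show "\<forall>\<^sub>F i in sequentially. spent i (window_end i 1) < (r / 2)\<^sup>2 * s \<longrightarrow> norm (p i) < r"
      using ev
    proof (rule eventually_mono, intro impI)
      fix i assume small: "\<forall>k\<ge>i. \<eta> k < r / (4 * (L + 1))" and spent: "spent i (window_end i 1) < (r / 2)\<^sup>2 * s"
      show "norm (p i) < r"
      proof (rule ccontr)
        assume "\<not> norm (p i) < r"
        then have big: "r \<le> norm (p i)" by simp
        have pk: "r / 2 \<le> norm (p k)" if k: "k \<in> {i..<window_end i s}" for k
        proof -
          have "k \<le> idx i s" using k by (simp add: window_end_def)
          then have "sum \<eta> {i..<k} \<le> s" using time_mono[of k "idx i s" i] idx_le[of s i] s by simp
          then have "L * (2 * sum \<eta> {i..<k}) \<le> L * (2 * s)" by (intro mult_left_mono L_nonneg) auto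
          moreover have "L * \<eta> k \<le> r / 4"
          proof -
            have "L * \<eta> k \<le> (L + 1) * (r / (4 * (L + 1)))"
              using small k nonneg[of k] L_nonneg by (intro mult_mono) (auto intro: less_imp_le)
            also have "\<dots> = r / 4" using L_nonneg by (simp add: field_simps)
            finally show ?thesis .
          qed
          moreover have "norm (p k - p i) \<le> L * (2 * sum \<eta> {i..<k} + \<eta> k)"
            using k by (intro increment_bound p_increment L_nonneg) auto
          moreover have "norm (p i) \<le> norm (p k) + norm (p k - p i)"
            using norm_triangle_ineq2[of "p i" "p k"] by (simp add: norm_minus_commute)
          ultimately show ?thesis using big s(3) unfolding distrib_left by linarith
        qed
        have "(r / 2)\<^sup>2 * s \<le> (r / 2)\<^sup>2 * sum \<eta> {i..<window_end i s}"
          using window_end(2)[of s i] by (intro mult_left_mono) auto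
        also have "\<dots> \<le> spent i (window_end i s)"
          unfolding spent_def sum_distrib_left
        proof (rule sum_mono)
          fix k assume "k \<in> {i..<window_end i s}"
          then have "(r / 2)\<^sup>2 \<le> (norm (p k))\<^sup>2" using pk[of k] assms by (intro power_mono) auto
          then show "(r / 2)\<^sup>2 * \<eta> k \<le> \<eta> k * (norm (p k))\<^sup>2"
            using nonneg[of k] by (subst mult.commute) (rule mult_left_mono)
        qed
        also have "\<dots> \<le> spent i (window_end i 1)" using s by (intro spent_mono window_end_mono) auto
        finally show False using spent by simp
      qed
    qed
  qed
qed

lemma \<psi>_bound: "\<bar>\<psi> k\<bar> \<le> (B + B * P) * norm (p k) + \<tau> * \<eta> k * (2 * B * P + \<kappa> * P\<^sup>2)"
proof -
  have "\<bar>y (Suc k) \<bullet> p k\<bar> \<le> B * norm (p k)"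
    by (intro order_trans[OF Cauchy_Schwarz_ineq2] mult_right_mono bounds) simp
  moreover have "\<bar>(V (Suc k) * p k) \<bullet> p k\<bar> \<le> (B * P) * norm (p k)"
    by (intro order_trans[OF abs_inner_vec_mult_le] mult_right_mono mult_mono bounds p_bound B_nonneg) auto
  ultimately have "\<bar>m k\<bar> \<le> (B + B * P) * norm (p k)"
    using B_nonneg P_nonneg by (auto simp: m_def distrib_right abs_le_iff)
  moreover have "\<bar>drift k\<bar> \<le> 2 * B * P + \<kappa> * P\<^sup>2"
  proof -
    have "\<bar>(d k + \<xi> k) \<bullet> p k\<bar> \<le> (B + B) * P"
      using B_nonneg by (intro order_trans[OF Cauchy_Schwarz_ineq2] mult_mono p_bound order_trans[OF norm_triangle_ineq] add_mono bounds) auto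
    moreover have "\<kappa> * (norm (p k))\<^sup>2 \<le> \<kappa> * P\<^sup>2" "0 \<le> \<kappa> * (norm (p k))\<^sup>2"
      using positive by (auto intro!: mult_left_mono power_mono p_bound)
    ultimately show ?thesis by (auto simp: drift_def)
  qed
  then have "\<bar>\<tau> * \<eta> k * drift k\<bar> \<le> \<tau> * \<eta> k * (2 * B * P + \<kappa> * P\<^sup>2)"
    using positive nonneg[of k] by (simp add: abs_mult mult_left_mono)
  ultimately show ?thesis unfolding \<psi>_def by linarith
qed

lemma \<psi>_tendsto_0:
  assumes r: "filterlim r at_top sequentially" and idle: "(\<lambda>n. spent (r n) (window_end (r n) 1)) \<longlonglongrightarrow> 0"
  shows "(\<lambda>n. \<psi> (r n)) \<longlonglongrightarrow> 0"
proof -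
  have "(\<lambda>n. norm (p (r n))) \<longlonglongrightarrow> 0"
    unfolding tendsto_iff
  proof (intro allI impI)
    fix q :: real assume "0 < q"
    then obtain e where e: "0 < e" "\<forall>\<^sub>F i in sequentially. spent i (window_end i 1) < e \<longrightarrow> norm (p i) < q"
      using idle_imp_small_velocity by blast
    show "\<forall>\<^sub>F n in sequentially. dist (norm (p (r n))) 0 < q"
      using order_tendstoD(2)[OF idle e(1)] eventually_compose_filterlim[OF e(2) r] by eventually_elim simp
  qed
  moreover have "(\<lambda>n. \<eta> (r n)) \<longlonglongrightarrow> 0" by (rule filterlim_compose[OF vanish r])
  ultimately have "(\<lambda>n. (B + B * P) * norm (p (r n)) + \<tau> * \<eta> (r n) * (2 * B * P + \<kappa> * P\<^sup>2)) \<longlonglongrightarrow>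
      (B + B * P) * 0 + \<tau> * 0 * (2 * B * P + \<kappa> * P\<^sup>2)" by (intro tendsto_intros)
  then have "(\<lambda>n. (B + B * P) * norm (p (r n)) + \<tau> * \<eta> (r n) * (2 * B * P + \<kappa> * P\<^sup>2)) \<longlonglongrightarrow> 0" by simp
  then show ?thesis by (rule Lim_null_comparison[rotated]) (use \<psi>_bound in auto)
qed

lemma g_continuous: "isCont g z"
  using locally_lipschitz_imp_continuous[OF g(1)] continuous_on_eq_continuous_at[OF open_UNIV] by blast

text \<open>Otherwise there would be longer and longer windows that spend less and less and start at energies
  tending to \<open>l\<close>. A cluster point \<open>a\<close> of their starting points is stationary, and there \<open>\<psi>\<close> vanishes in the
  limit, so \<open>l = g a\<close> would be a critical value.\<close>
lemma regular_level_not_idle: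
  assumes "l \<notin> g ` stationary X D"
  shows "\<exists>T\<ge>1. \<exists>\<mu>>0. \<forall>\<^sub>F i in sequentially. \<bar>energy i - l\<bar> \<le> \<mu> \<longrightarrow> \<mu> \<le> spent i (window_end i T)"
proof (rule ccontr)
  assume neg: "\<not> ?thesis"
  define q where "q n = inverse (real (Suc n))" for n
  have q: "\<And>n. 0 < q n" "q \<longlonglongrightarrow> 0" unfolding q_def using LIMSEQ_inverse_real_of_nat by auto
  have "\<exists>i\<ge>n. \<bar>energy i - l\<bar> \<le> q n \<and> spent i (window_end i (real (Suc n))) < q n" for n
  proof -
    have "1 \<le> real (Suc n)" by simp
    with neg q(1)[of n] have "\<not> (\<forall>\<^sub>F i in sequentially. \<bar>energy i - l\<bar> \<le> q n \<longrightarrow>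
        q n \<le> spent i (window_end i (real (Suc n))))" by blast
    then show ?thesis unfolding eventually_sequentially by (meson not_le)
  qed
  then obtain r where r: "\<And>n. n \<le> r n" "\<And>n. \<bar>energy (r n) - l\<bar> \<le> q n"
      "\<And>n. spent (r n) (window_end (r n) (real (Suc n))) < q n" by metis
  have r_top: "filterlim r at_top sequentially"
    by (rule filterlim_at_top_mono[OF filterlim_ident]) (use r(1) in auto)
  have spent_le: "spent (r n) (window_end (r n) T) < q n" if "0 \<le> T" "T \<le> real (Suc n)" for T n
    using r(3)[of n] spent_mono[OF window_end_mono[OF that], of "r n" "r n"] by simp
  have "bounded (range (\<lambda>n. x (r n)))" using bounds(1) by (intro boundedI) auto
  then obtain a s where s: "strict_mono s" "((\<lambda>n. x (r n)) \<circ> s) \<longlonglongrightarrow> a"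
    using bounded_imp_convergent_subsequence by blast
  have "a \<in> stationary X D"
  proof (rule stationary_if_idle_nearby)
    fix T e :: real and K assume T: "1 \<le> T" and "0 < e"
    have "\<forall>\<^sub>F n in sequentially. norm (x (r (s n)) - a) < e"
      using s(2) \<open>0 < e\<close> by (auto simp: tendsto_iff dist_norm o_def)
    moreover have "\<forall>\<^sub>F n in sequentially. q n < e" using q(2) \<open>0 < e\<close> by (rule order_tendstoD(2))
    then have "\<forall>\<^sub>F n in sequentially. q (s n) < e" by (rule eventually_subseq[OF s(1)])
    moreover have "\<forall>\<^sub>F n in sequentially. nat \<lceil>T\<rceil> + K \<le> n" by (rule eventually_ge_at_top)
    ultimately have "\<forall>\<^sub>F n in sequentially. K \<le> r (s n) \<and> norm (x (r (s n)) - a) < e \<and> spent (r (s n)) (window_end (r (s n)) T) < e"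
    proof eventually_elim
      case (elim n)
      have n: "n \<le> s n" by (rule seq_suble[OF s(1)])
      have "T \<le> real (Suc (s n))" using elim(3) n real_nat_ceiling_ge[of T] by linarith
      then have "spent (r (s n)) (window_end (r (s n)) T) < e" using spent_le[of T "s n"] elim(2) T by simp
      then show ?case using elim(1,3) n r(1)[of "s n"] by simp
    qed
    then show "\<exists>i\<ge>K. norm (x i - a) < e \<and> spent i (window_end i T) < e"
      by (auto simp: eventually_sequentially)
  qed
  have "(\<lambda>n. energy (r (s n)) - l) \<longlonglongrightarrow> 0"
    by (rule Lim_null_comparison[OF _ LIMSEQ_subseq_LIMSEQ[OF q(2) s(1)]]) (use r(2) in auto)
  then have e: "(\<lambda>n. energy (r (s n))) \<longlonglongrightarrow> l" by (rule LIM_zero_cancel)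
  have "(\<lambda>n. spent (r n) (window_end (r n) 1)) \<longlonglongrightarrow> 0"
  proof (rule Lim_null_comparison[OF _ q(2)], rule always_eventually, rule allI)
    fix n show "norm (spent (r n) (window_end (r n) 1)) \<le> q n"
      using spent_le[of 1 n] spent_mono[of "r n" "window_end (r n) 1" "r n"] window_end(1)[of "r n" 1]
      by (simp add: spent_def sum_nonneg nonneg)
  qed
  then have "(\<lambda>n. \<psi> (r (s n))) \<longlonglongrightarrow> 0"
    using LIMSEQ_subseq_LIMSEQ[OF \<psi>_tendsto_0[OF r_top] s(1)] by (simp add: o_def)
  moreover have "(\<lambda>n. g (x (r (s n)))) \<longlonglongrightarrow> g a"
    using s(2) by (intro isCont_tendsto_compose[OF g_continuous]) (simp add: o_def)
  ultimately have "(\<lambda>n. energy (r (s n))) \<longlonglongrightarrow> g a - 0 / \<tau>"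
    unfolding energy_def using positive(1) by (intro tendsto_intros) auto
  then have "l = g a" using LIMSEQ_unique[OF e] by simp
  with assms \<open>a \<in> stationary X D\<close> show False by blast
qed

text \<open>From an energy at most \<open>l\<close> one proceeds in blocks that end at most at \<open>l\<close> again: a single step if the energy
  is safely below \<open>l\<close>, and a full window, which loses more than the error, if it is close to \<open>l\<close>. Within
  a block the energy exceeds \<open>l\<close> by no more than the error.\<close>
lemma regular_level_not_recrossed:
  assumes l: "l \<notin> g ` stationary X D" and "0 < e"
  shows "\<forall>\<^sub>F i in sequentially. energy i \<le> l \<longrightarrow> (\<forall>k\<ge>i. energy k \<le> l + e)"
proof -
  obtain T \<mu> where T: "1 \<le> T" and \<mu>: "0 < \<mu>"
      "\<forall>\<^sub>F i in sequentially. \<bar>energy i - l\<bar> \<le> \<mu> \<longrightarrow> \<mu> \<le> spent i (window_end i T)"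
    using regular_level_not_idle[OF l] by blast
  define e' where "e' = min e (min \<mu> (\<kappa> * \<mu>))"
  have e': "0 < e'" "e' \<le> e" "e' \<le> \<mu>" "e' \<le> \<kappa> * \<mu>" using \<mu>(1) \<open>0 < e\<close> positive by (auto simp: e'_def)
  have "\<forall>\<^sub>F i in sequentially. (\<bar>energy i - l\<bar> \<le> \<mu> \<longrightarrow> \<mu> \<le> spent i (window_end i T)) \<and>
     (\<forall>j\<ge>i. sum \<eta> {i..<j} \<le> T + 1 \<longrightarrow> energy j \<le> energy i - \<kappa> * spent i j + e') \<and> (\<forall>k\<ge>i. \<eta> k < 1)"
    by (intro eventually_conj \<mu>(2) energy_descent stepsize_eventually_small e') simp
  then obtain N where N: "\<And>i. N \<le> i \<Longrightarrow> \<bar>energy i - l\<bar> \<le> \<mu> \<Longrightarrow> \<mu> \<le> spent i (window_end i T)"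
     "\<And>i j. N \<le> i \<Longrightarrow> i \<le> j \<Longrightarrow> sum \<eta> {i..<j} \<le> T + 1 \<Longrightarrow> energy j \<le> energy i - \<kappa> * spent i j + e'"
     "\<And>i. N \<le> i \<Longrightarrow> \<eta> i < 1"
    unfolding eventually_sequentially by (metis order_refl)
  have spent0: "0 \<le> \<kappa> * spent i j" for i j
    using positive by (simp add: spent_def sum_nonneg nonneg)
  have "energy k \<le> l + e" if "N \<le> i" "energy i \<le> l" "i \<le> k" for i k
    using that
  proof (induction "k - i" arbitrary: i rule: less_induct)
    case less
    define j where "j = (if energy i < l - \<mu> then Suc i else window_end i T)"
    have ij: "i < j" using window_end(1)[of i T] by (simp add: j_def)
    have time: "sum \<eta> {i..<j} \<le> T + 1"
      using window_end(3)[of T i] N(3)[of i] N(3)[of "idx i T"] idx(1)[of i T] less.prems(1) T by (auto simp: j_def)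
    have ej: "energy j \<le> l"
    proof (cases "energy i < l - \<mu>")
      case True
      then show ?thesis using N(2)[OF less.prems(1) less_imp_le[OF ij] time] spent0[of i j] e' by simp
    next
      case False
      then have "\<mu> \<le> spent i j" using N(1)[OF less.prems(1)] less.prems(2) by (simp add: j_def)
      then have "\<kappa> * \<mu> \<le> \<kappa> * spent i j" using positive by simp
      then show ?thesis using N(2)[OF less.prems(1) less_imp_le[OF ij] time] e' less.prems(2) by simp
    qed
    show ?case
    proof (cases "k < j")
      case True
      then have "sum \<eta> {i..<k} \<le> T + 1" using time time_mono[of k j i] by simp
      then show ?thesis using N(2)[of i k] less.prems spent0[of i k] e' by simp
    next
      case False
      then show ?thesis using less.hyps[of j] less.prems ij ej by simp
    qed
  qed
  then show ?thesis unfolding eventually_sequentially by blast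
qed

text \<open>Once the energy converges, no window can spend a fixed amount infinitely often. Hence all late windows
  are idle, and stationarity of the cluster points and convergence of \<open>g\<close> follow.\<close>
theorem convergence:
  assumes sard: "interior (g ` stationary X D) = {}"
  shows "convergent (\<lambda>k. g (x k))"
    and "\<And>a. (\<And>e K. 0 < e \<Longrightarrow> \<exists>i\<ge>K. norm (x i - a) < e) \<Longrightarrow> a \<in> stationary X D"
proof -
  have "bounded (range energy)"
  proof -
    have "compact (g ` cball 0 B)"
      using locally_lipschitz_imp_continuous[OF g(1)] continuous_on_subset
      by (intro compact_continuous_image) auto
    then obtain G where "\<forall>v\<in>g ` cball 0 B. norm v \<le> G"
      unfolding bounded_iff[symmetric] by (meson bounded_iff compact_imp_bounded)
    then have G: "\<And>z. norm z \<le> B \<Longrightarrow> \<bar>g z\<bar> \<le> G" by auto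
    obtain E where E: "\<And>k. \<eta> k \<le> E"
      using Bseq_bdd_above[OF convergent_imp_Bseq] vanish by (auto simp: convergent_def bdd_above_def)
    have "\<bar>energy k\<bar> \<le> G + ((B + B * P) * P + \<tau> * E * (2 * B * P + \<kappa> * P\<^sup>2)) / \<tau>" for k
    proof -
      have "(B + B * P) * norm (p k) \<le> (B + B * P) * P"
        using B_nonneg P_nonneg by (intro mult_left_mono p_bound) auto
      moreover have "\<tau> * \<eta> k * (2 * B * P + \<kappa> * P\<^sup>2) \<le> \<tau> * E * (2 * B * P + \<kappa> * P\<^sup>2)"
        using B_nonneg P_nonneg positive by (intro mult_right_mono mult_left_mono E) auto
      ultimately have "\<bar>\<psi> k\<bar> \<le> (B + B * P) * P + \<tau> * E * (2 * B * P + \<kappa> * P\<^sup>2)"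
        using \<psi>_bound[of k] by linarith
      then have "\<bar>\<psi> k / \<tau>\<bar> \<le> ((B + B * P) * P + \<tau> * E * (2 * B * P + \<kappa> * P\<^sup>2)) / \<tau>"
        using positive(1) by (simp add: divide_right_mono)
      then show ?thesis using G[OF bounds(1)[of k]] unfolding energy_def by linarith
    qed
    then show ?thesis by (auto simp: bounded_iff)
  qed
  then have "convergent energy"
  proof (rule bounded_sequence_convergent_if_no_two_limits)
    fix a b :: real
    assume "a < b" and a: "\<exists>\<^sub>F n in sequentially. energy n < a" and b: "\<exists>\<^sub>F n in sequentially. b < energy n"
    have "\<not> {a<..<b} \<subseteq> g ` stationary X D"
      using sard \<open>a < b\<close> interior_maximal[of "{a<..<b}" "g ` stationary X D"] by auto
    then obtain l where l: "a < l" "l < b" "l \<notin> g ` stationary X D"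
      by (meson greaterThanLessThan_iff subsetI)
    have "\<forall>\<^sub>F i in sequentially. energy i \<le> l \<longrightarrow> (\<forall>k\<ge>i. energy k \<le> l + (b - l))"
      by (rule regular_level_not_recrossed[OF l(3)]) (use l in simp)
    from frequently_eventually_frequently[OF a this]
    obtain i where i: "energy i < a" "energy i \<le> l \<longrightarrow> (\<forall>k\<ge>i. energy k \<le> b)"
      by (auto simp: frequently_sequentially)
    from b obtain k where "i \<le> k" "b < energy k" by (auto simp: frequently_sequentially)
    with i l(1) show False by fastforce
  qed
  have idle: "(\<lambda>i. spent i (window_end i T)) \<longlonglongrightarrow> 0" if T: "1 \<le> T" for T
    unfolding tendsto_iff
  proof (intro allI impI)
    fix e :: real assume "0 < e"
    then have e: "0 < \<kappa> * e / 4" using positive by simp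
    obtain N where N: "\<And>i j. N \<le> i \<Longrightarrow> N \<le> j \<Longrightarrow> \<bar>energy i - energy j\<bar> < \<kappa> * e / 4"
      using CauchyD[OF convergent_Cauchy[OF \<open>convergent energy\<close>] e] by auto
    show "\<forall>\<^sub>F i in sequentially. dist (spent i (window_end i T)) 0 < e"
      using energy_descent[OF e, of "T + 1"] stepsize_eventually_small[OF zero_less_one] eventually_ge_at_top[of N]
    proof eventually_elim
      case (elim i)
      have "sum \<eta> {i..<window_end i T} \<le> T + 1"
        using window_end(3)[of T i] elim(2)[rule_format, OF idx(1)[of i T]] T by simp
      then have "energy (window_end i T) \<le> energy i - \<kappa> * spent i (window_end i T) + \<kappa> * e / 4"
        using elim(1) window_end(1)[of i T] by (simp add: less_imp_le)
      moreover have "\<bar>energy i - energy (window_end i T)\<bar> < \<kappa> * e / 4"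
        using elim(3) window_end(1)[of i T] by (intro N) auto
      ultimately have "\<kappa> * spent i (window_end i T) < \<kappa> * e" using \<open>0 < e\<close> e by linarith
      then have "spent i (window_end i T) < e" using positive by simp
      moreover have "0 \<le> spent i (window_end i T)" by (simp add: spent_def sum_nonneg nonneg)
      ultimately show ?case by simp
    qed
  qed
  have "(\<lambda>k. \<psi> k) \<longlonglongrightarrow> 0" by (rule \<psi>_tendsto_0[OF filterlim_ident idle[OF order_refl]])
  then have "(\<lambda>k. \<psi> k / \<tau>) \<longlonglongrightarrow> 0 / \<tau>" using positive(1) by (intro tendsto_intros) auto
  moreover obtain E where "energy \<longlonglongrightarrow> E" using \<open>convergent energy\<close> by (auto simp: convergent_def)
  ultimately have "(\<lambda>k. energy k + \<psi> k / \<tau>) \<longlonglongrightarrow> E + 0 / \<tau>" by (intro tendsto_add)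
  then have "convergent (\<lambda>k. energy k + \<psi> k / \<tau>)" by (auto simp: convergent_def)
  then show "convergent (\<lambda>k. g (x k))" by (simp add: energy_def)
  fix a assume near: "\<And>e K. 0 < e \<Longrightarrow> \<exists>i\<ge>K. norm (x i - a) < e"
  show "a \<in> stationary X D"
  proof (rule stationary_if_idle_nearby)
    fix T e :: real and K assume T: "1 \<le> T" and "0 < e"
    have "\<forall>\<^sub>F i in sequentially. spent i (window_end i T) < e" using idle[OF T] \<open>0 < e\<close> by (rule order_tendstoD(2))
    then obtain N where N: "\<And>i. N \<le> i \<Longrightarrow> spent i (window_end i T) < e" by (auto simp: eventually_sequentially)
    obtain i where "max K N \<le> i" "norm (x i - a) < e" using near[OF \<open>0 < e\<close>] by blast
    then show "\<exists>i\<ge>K. norm (x i - a) < e \<and> spent i (window_end i T) < e" using N[of i] by auto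
  qed
qed

end

section \<open>Calculus of the exact penalty function\<close>

lemma countable_isolated_subset:
  fixes S :: "real set"
  assumes "\<And>t. t \<in> S \<Longrightarrow> \<exists>e>0. \<forall>s\<in>S. \<bar>s - t\<bar> < e \<longrightarrow> s = t"
  shows "countable S"
proof -
  obtain e where e: "\<And>t. t \<in> S \<Longrightarrow> 0 < e t" "\<And>s t. t \<in> S \<Longrightarrow> s \<in> S \<Longrightarrow> \<bar>s - t\<bar> < e t \<Longrightarrow> s = t"
    using assms by metis
  have "\<exists>q. q \<in> \<rat> \<and> \<bar>q - t\<bar> < e t / 2" if "t \<in> S" for t
    using Rats_dense_in_real[of t "t + e t / 2"] e(1)[OF that] by force
  then obtain q where q: "\<And>t. t \<in> S \<Longrightarrow> q t \<in> \<rat>" "\<And>t. t \<in> S \<Longrightarrow> \<bar>q t - t\<bar> < e t / 2" by metis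
  have "inj_on q S"
  proof (rule inj_onI)
    fix s t assume st: "s \<in> S" "t \<in> S" "q s = q t"
    have "\<bar>s - t\<bar> < max (e s) (e t)" using q(2)[OF st(1)] q(2)[OF st(2)] st(3) by linarith
    then show "s = t" using e(2)[of s t] e(2)[of t s] st by (auto simp: max_def abs_minus_commute split: if_splits)
  qed
  then show ?thesis
    using countable_image_inj_on countable_subset[OF _ countable_rat] q(1) by (metis image_subsetI)
qed

text \<open>Each such zero is isolated. This handles the times at which a curve meets the set \<open>c = 0\<close>, where the
  norm of \<open>c\<close> is not differentiable: up to a null set the velocity of \<open>c\<close> vanishes there.\<close>
lemma countable_transversal_zeros:
  fixes h :: "real \<Rightarrow> 'a::real_normed_vector"
  shows "countable {t. h t = 0 \<and> (\<exists>u. u \<noteq> 0 \<and> (h has_vector_derivative u) (at t))}" (is "countable ?S")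
proof (rule countable_isolated_subset)
  fix t assume "t \<in> ?S"
  then obtain u where u: "h t = 0" "u \<noteq> 0" "(h has_vector_derivative u) (at t)" by blast
  have "((\<lambda>s. (1 / norm (s - t)) *\<^sub>R (h s - (h t + (s - t) *\<^sub>R u))) \<longlongrightarrow> 0) (at t)"
    using u(3) by (simp add: has_vector_derivative_def has_derivative_within)
  then have "\<forall>\<^sub>F s in at t. norm ((1 / norm (s - t)) *\<^sub>R (h s - (h t + (s - t) *\<^sub>R u))) < norm u"
    using u(2) by (auto simp: tendsto_iff)
  then obtain e where e: "0 < e" "\<And>s. s \<noteq> t \<Longrightarrow> \<bar>s - t\<bar> < e \<Longrightarrow>
      norm ((1 / norm (s - t)) *\<^sub>R (h s - (h t + (s - t) *\<^sub>R u))) < norm u"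
    by (auto simp: eventually_at dist_norm)
  show "\<exists>e>0. \<forall>s\<in>?S. \<bar>s - t\<bar> < e \<longrightarrow> s = t"
  proof (intro exI conjI ballI impI, rule e(1), rule ccontr)
    fix s assume s: "s \<in> ?S" "\<bar>s - t\<bar> < e" "s \<noteq> t"
    then show False using e(2)[of s] u(1) by auto
  qed
qed

lemma norm_has_derivative_at_zero:
  fixes h :: "real \<Rightarrow> 'a::real_normed_vector"
  assumes "h t = 0" "(h has_vector_derivative 0) (at t)"
  shows "((\<lambda>s. norm (h s)) has_real_derivative 0) (at t)"
proof -
  have "((\<lambda>s. (1 / norm (s - t)) *\<^sub>R (h s - (h t + (s - t) *\<^sub>R 0))) \<longlongrightarrow> 0) (at t)"
    using assms(2) by (simp add: has_vector_derivative_def has_derivative_within)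
  from tendsto_norm_zero[OF this] have "((\<lambda>s. norm (h s) / \<bar>s - t\<bar>) \<longlongrightarrow> 0) (at t)"
    by (simp add: assms(1))
  then have "((\<lambda>s. norm (h s) / (s - t)) \<longlongrightarrow> 0) (at t)"
    by (rule Lim_null_comparison[rotated]) (auto simp: eventually_at_filter abs_divide)
  then show ?thesis using assms(1) by (simp add: has_field_derivative_iff)
qed

text \<open>Where \<open>c\<close> does not vanish the penalty is a smooth function of \<open>f\<close> and \<open>c\<close>. At almost every time with
  \<open>c = 0\<close> the derivative of \<open>c\<close> along the curve is zero, so every choice of the subgradient of the norm
  contributes zero. The generators of the field therefore all have the same product with the velocity; they
  lie in a hyperplane, and so does their convex hull.\<close>
theorem penalty_field_chain_rule:
  fixes c :: "real^'n \<Rightarrow> real^'p"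
  assumes f: "conservative_field f Df" and c: "conservative_jacobian c Dc"
  shows "chain_rule_field (penalty \<beta> \<rho> f c) (penalty_field \<beta> \<rho> c Df Dc)"
  unfolding chain_rule_field_def
proof (intro allI impI)
  fix \<gamma> :: "real \<Rightarrow> real^'n" assume \<gamma>: "abs_cont_curve \<gamma>"
  let ?h = "c \<circ> \<gamma>"
  have "AE t in lebesgue. 0 \<le> t \<longrightarrow> (\<exists>u. (\<gamma> has_vector_derivative u) (at t) \<and>
          (\<forall>J\<in>Df (\<gamma> t). ((f \<circ> \<gamma>) has_vector_derivative J \<bullet> u) (at t)))"
    using f \<gamma> by (simp add: conservative_field_def conservative_wrt_def)
  moreover have "AE t in lebesgue. 0 \<le> t \<longrightarrow> (\<exists>u. (\<gamma> has_vector_derivative u) (at t) \<and>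
          (\<forall>J\<in>Dc (\<gamma> t). (?h has_vector_derivative transpose J *v u) (at t)))"
    using c \<gamma> by (simp add: conservative_jacobian_def conservative_wrt_def)
  moreover have "AE t in lebesgue. t \<notin> {t. ?h t = 0 \<and> (\<exists>u. u \<noteq> 0 \<and> (?h has_vector_derivative u) (at t))}"
    using countable_imp_null_set_lborel[OF countable_transversal_zeros[of ?h]]
    by (intro AE_not_in) (simp add: null_sets_completionI)
  ultimately show "AE t in lebesgue. 0 \<le> t \<longrightarrow> (\<exists>u. (\<gamma> has_vector_derivative u) (at t) \<and>
          (\<forall>d\<in>penalty_field \<beta> \<rho> c Df Dc (\<gamma> t). ((penalty \<beta> \<rho> f c \<circ> \<gamma>) has_vector_derivative d \<bullet> u) (at t)))"
  proof eventually_elim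
    case (elim t)
    show ?case
    proof
      assume "0 \<le> t"
      with elim(1) obtain u where u: "(\<gamma> has_vector_derivative u) (at t)"
        and fu: "\<And>J. J \<in> Df (\<gamma> t) \<Longrightarrow> ((f \<circ> \<gamma>) has_vector_derivative J \<bullet> u) (at t)" by blast
      from elim(2) \<open>0 \<le> t\<close> obtain u' where u': "(\<gamma> has_vector_derivative u') (at t)"
        and cu': "\<And>J. J \<in> Dc (\<gamma> t) \<Longrightarrow> (?h has_vector_derivative transpose J *v u') (at t)" by blast
      have "u' = u" using u u' by (rule vector_derivative_unique_at[rotated])
      note cu = cu'[unfolded this]
      define z where "z = \<gamma> t"
      obtain J0 where J0: "J0 \<in> Dc z"
        using c unfolding conservative_jacobian_def conservative_wrt_def by blast
      define h' where "h' = transpose J0 *v u"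
      have h': "(?h has_vector_derivative h') (at t)" using cu J0 by (simp add: h'_def z_def)
      have J: "transpose J *v u = h'" if "J \<in> Dc z" for J
        using vector_derivative_unique_at[OF cu[of J] h'] that by (simp add: z_def)
      obtain d0 where d0: "d0 \<in> Df z"
        using f unfolding conservative_field_def conservative_wrt_def by blast
      define f' where "f' = d0 \<bullet> u"
      have f': "((f \<circ> \<gamma>) has_real_derivative f') (at t)"
        using fu[of d0] d0 by (simp add: f'_def z_def has_real_derivative_iff_has_vector_derivative)
      have d: "d \<bullet> u = f'" if "d \<in> Df z" for d
        using vector_derivative_unique_at[OF fu[of d]] fu[of d0] that d0 by (auto simp: z_def f'_def)
      have zero: "h' = 0" if "c z = 0" using elim(3) h' that by (auto simp: z_def)
      define r where "r = regu (c z) \<bullet> h'"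
      have r: "w \<bullet> h' = r" if "w \<in> T_regu (c z)" for w
        using that zero by (auto simp: r_def T_regu_def regu_def split: if_splits)
      have norm': "((\<lambda>s. norm (?h s)) has_real_derivative r) (at t)"
      proof (cases "c z = 0")
        case True
        then show ?thesis using norm_has_derivative_at_zero[of ?h t] h' zero by (simp add: r_def z_def)
      next
        case False
        have "((\<lambda>s. norm (?h s)) has_derivative (\<lambda>s. (s *\<^sub>R h') \<bullet> sgn (?h t))) (at t)"
          using has_derivative_compose[OF h'[unfolded has_vector_derivative_def] has_derivative_norm[of "?h t"]] False
          by (simp add: z_def)
        then have "((\<lambda>s. norm (?h s)) has_real_derivative h' \<bullet> sgn (?h t)) (at t)"
          by (rule has_derivative_imp_has_field_derivative) simp
        then show ?thesis using False by (simp add: r_def regu_def z_def sgn_div_norm inner_commute)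
      qed
      have sq: "((\<lambda>s. (norm (?h s))\<^sup>2) has_real_derivative 2 * (c z \<bullet> h')) (at t)"
      proof -
        have "((\<lambda>s. ?h s \<bullet> ?h s) has_vector_derivative ?h t \<bullet> h' + h' \<bullet> ?h t) (at t)"
          by (rule bounded_bilinear.has_vector_derivative[OF bounded_bilinear_inner h' h'])
        then show ?thesis
          by (simp add: has_real_derivative_iff_has_vector_derivative power2_norm_eq_inner z_def inner_commute)
      qed
      have pen: "(penalty \<beta> \<rho> f c \<circ> \<gamma>) = (\<lambda>s. (f \<circ> \<gamma>) s + \<beta> * norm (?h s) + \<rho> / 2 * (norm (?h s))\<^sup>2)"
        by (simp add: fun_eq_iff penalty_def)
      define g' where "g' = f' + \<beta> * r + \<rho> * (c z \<bullet> h')"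
      have "((penalty \<beta> \<rho> f c \<circ> \<gamma>) has_real_derivative g') (at t)"
        using DERIV_add[OF DERIV_add[OF f' DERIV_cmult[OF norm', of \<beta>]] DERIV_cmult[OF sq, of "\<rho> / 2"]]
        unfolding pen g'_def by simp
      moreover have "d \<bullet> u = g'" if "d \<in> penalty_field \<beta> \<rho> c Df Dc z" for d
      proof -
        have "Df z + {A *v (\<beta> *\<^sub>R w + \<rho> *\<^sub>R c z) | A w. A \<in> Dc z \<and> w \<in> T_regu (c z)} \<subseteq> {d. u \<bullet> d = g'}"
        proof
          fix e assume "e \<in> Df z + {A *v (\<beta> *\<^sub>R w + \<rho> *\<^sub>R c z) | A w. A \<in> Dc z \<and> w \<in> T_regu (c z)}"
          then obtain e1 A w where e: "e = e1 + A *v (\<beta> *\<^sub>R w + \<rho> *\<^sub>R c z)" "e1 \<in> Df z" "A \<in> Dc z" "w \<in> T_regu (c z)"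
            by (auto simp: set_plus_def)
          have "(A *v (\<beta> *\<^sub>R w + \<rho> *\<^sub>R c z)) \<bullet> u = (\<beta> *\<^sub>R w + \<rho> *\<^sub>R c z) \<bullet> (transpose A *v u)"
            by (simp add: dot_lmul_matrix[symmetric] inner_commute[of _ u] vector_transpose_matrix inner_commute)
          then show "e \<in> {d. u \<bullet> d = g'}"
            using e J[of A] d[of e1] r[of w]
            by (simp add: g'_def inner_add_left inner_commute[of u])
        qed
        then have "penalty_field \<beta> \<rho> c Df Dc z \<subseteq> {d. u \<bullet> d = g'}"
          unfolding penalty_field_def by (rule hull_minimal) (rule convex_hyperplane)
        then show ?thesis using that by (auto simp: inner_commute)
      qed
      ultimately show "\<exists>u. (\<gamma> has_vector_derivative u) (at t) \<and> (\<forall>d\<in>penalty_field \<beta> \<rho> c Df Dc (\<gamma> t).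
          ((penalty \<beta> \<rho> f c \<circ> \<gamma>) has_vector_derivative d \<bullet> u) (at t))"
        using u by (auto simp: has_real_derivative_iff_has_vector_derivative z_def)
    qed
  qed
qed

lemma locally_lipschitz_penalty:
  fixes c :: "real^'n \<Rightarrow> real^'p"
  assumes f: "locally_lipschitz f" and c: "locally_lipschitz c"
  shows "locally_lipschitz (penalty \<beta> \<rho> f c)"
  unfolding locally_lipschitz_def
proof
  fix x
  obtain r1 L1 where 1: "0 < r1" "L1-lipschitz_on (ball x r1) f" using f unfolding locally_lipschitz_def by meson
  obtain r2 L2 where 2: "0 < r2" "L2-lipschitz_on (ball x r2) c" using c unfolding locally_lipschitz_def by meson
  define r where "r = min r1 r2"
  have r: "0 < r" "L1-lipschitz_on (ball x r) f" "L2-lipschitz_on (ball x r) c"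
    using 1 2 by (auto simp: r_def intro: lipschitz_on_subset)
  have n: "L2-lipschitz_on (ball x r) (\<lambda>z. norm (c z))"
    using r(3) unfolding lipschitz_on_def
    by (auto simp: dist_norm intro: order_trans[OF norm_triangle_ineq3])
  define M where "M = norm (c x) + L2 * r"
  have M: "norm (c z) \<le> M" if "z \<in> ball x r" for z
  proof -
    have "\<bar>norm (c z) - norm (c x)\<bar> \<le> L2 * dist z x" using lipschitz_onD[OF n that, of x] r(1) by (simp add: dist_norm)
    also have "\<dots> \<le> L2 * r"
      using that lipschitz_on_nonneg[OF n] by (intro mult_left_mono) (auto simp: dist_commute)
    finally show ?thesis by (simp add: M_def)
  qed
  have M0: "0 \<le> M" using M[of x] r(1) norm_ge_zero[of "c x"] by (metis centre_in_ball order_trans)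
  have "(2 * M * L2)-lipschitz_on (ball x r) (\<lambda>z. (norm (c z))\<^sup>2)"
  proof (rule lipschitz_onI)
    fix z z' assume z: "z \<in> ball x r" "z' \<in> ball x r"
    have "\<bar>(norm (c z))\<^sup>2 - (norm (c z'))\<^sup>2\<bar> = (norm (c z) + norm (c z')) * \<bar>norm (c z) - norm (c z')\<bar>"
      by (simp add: power2_eq_square square_diff_square_factored abs_mult)
    also have "\<dots> \<le> (2 * M) * (L2 * dist z z')"
      using M[OF z(1)] M[OF z(2)] M0 lipschitz_onD[OF n z] by (intro mult_mono) (auto simp: dist_norm)
    finally show "dist ((norm (c z))\<^sup>2) ((norm (c z'))\<^sup>2) \<le> 2 * M * L2 * dist z z'" by (simp add: dist_norm mult.assoc)
  qed (use M0 lipschitz_on_nonneg[OF n] in auto)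
  from lipschitz_on_add[OF lipschitz_on_add[OF r(2) lipschitz_on_cmult_real[OF n, of \<beta>]] lipschitz_on_cmult_real[OF this, of "\<rho>/2"]]
  show "\<exists>r>0. \<exists>L. L-lipschitz_on (ball x r) (penalty \<beta> \<rho> f c)"
    using r(1) unfolding penalty_def[abs_def] by blast
qed

lemma conservative_wrt_compact:
  fixes D :: "'a::euclidean_space \<Rightarrow> 'd::euclidean_space set"
  assumes "conservative_wrt act H D"
  shows "compact (D x)"
  unfolding compact_eq_bounded_closed
proof
  obtain r where r: "0 < r" "bounded (\<Union>z\<in>ball x r. D z)" using assms unfolding conservative_wrt_def by blast
  show "bounded (D x)" by (rule bounded_subset[OF r(2)]) (use r(1) in \<open>auto intro!: bexI[of _ x]\<close>)
  have "closed ((\<lambda>J. (x, J)) -` {(x, J). J \<in> D x})"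
    using assms unfolding conservative_wrt_def by (intro closed_vimage) (auto intro!: continuous_intros)
  then show "closed (D x)" by (simp add: vimage_def)
qed

lemma conservative_wrt_bounded_on_compact:
  fixes D :: "'a::euclidean_space \<Rightarrow> 'd::euclidean_space set"
  assumes "conservative_wrt act H D" "compact K"
  obtains M where "\<And>z J. z \<in> K \<Longrightarrow> J \<in> D z \<Longrightarrow> norm J \<le> M"
proof -
  obtain r where r: "\<And>x. 0 < r x" "\<And>x. bounded (\<Union>z\<in>ball x (r x). D z)"
    using assms(1) unfolding conservative_wrt_def by metis
  obtain F where F: "F \<subseteq> K" "finite F" "K \<subseteq> (\<Union>x\<in>F. ball x (r x))"
    by (rule compactE_image[OF assms(2), of K "\<lambda>x. ball x (r x)"]) (use r(1) in auto)
  have "bounded (\<Union>x\<in>F. \<Union>z\<in>ball x (r x). D z)" using F(2) r(2) by (intro bounded_UN) auto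
  then obtain M where "\<And>J. J \<in> (\<Union>x\<in>F. \<Union>z\<in>ball x (r x). D z) \<Longrightarrow> norm J \<le> M" by (auto simp: bounded_iff)
  then show ?thesis using F(3) by (intro that[of M]) blast
qed

lemma expansionE:
  fixes D :: "'a::euclidean_space \<Rightarrow> 'd::euclidean_space set"
  assumes "conservative_wrt act H D" "w \<in> expansion \<delta> D x"
  obtains z J where "dist z x \<le> \<delta>" "J \<in> D z" "dist w J \<le> \<delta>"
proof -
  obtain z where z: "dist z x \<le> \<delta>" "infdist w (D z) \<le> \<delta>" using assms(2) by (auto simp: expansion_def)
  have "D z \<noteq> {}" using assms(1) unfolding conservative_wrt_def by blast
  then obtain J where "J \<in> D z" "infdist w (D z) = dist w J"
    using infdist_attains_inf[of "D z" w] compact_imp_closed[OF conservative_wrt_compact[OF assms(1)]] by blast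
  with z that show ?thesis by simp
qed

text \<open>The approximate evaluations inherit the closed graph of \<open>D\<close> when the accuracies tend to zero.\<close>
lemma expansion_limit:
  fixes D :: "'a::euclidean_space \<Rightarrow> 'd::euclidean_space set" and w :: "nat \<Rightarrow> 'd"
  assumes D: "conservative_wrt act H D" and w: "\<And>n. w n \<in> expansion (\<delta> n) D (x n)"
    and lim: "\<delta> \<longlonglongrightarrow> 0" "x \<longlonglongrightarrow> a" "w \<longlonglongrightarrow> b"
  shows "b \<in> D a"
proof -
  have "\<exists>z J. dist z (x n) \<le> \<delta> n \<and> J \<in> D z \<and> dist (w n) J \<le> \<delta> n" for n
    using expansionE[OF D w[of n]] by blast
  then obtain z J where zJ: "\<And>n. dist (z n) (x n) \<le> \<delta> n" "\<And>n. J n \<in> D (z n)" "\<And>n. dist (w n) (J n) \<le> \<delta> n" by metis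
  have "(\<lambda>n. z n - x n) \<longlonglongrightarrow> 0" "(\<lambda>n. J n - w n) \<longlonglongrightarrow> 0"
    by (rule Lim_null_comparison[OF _ lim(1)]; use zJ in \<open>auto simp: dist_norm norm_minus_commute\<close>)+
  from tendsto_add[OF this(1) lim(2)] tendsto_add[OF this(2) lim(3)]
  have "(\<lambda>n. (z n, J n)) \<longlonglongrightarrow> (a, b)" by (simp add: tendsto_Pair)
  moreover have "closed {(x, J). J \<in> D x}" using D by (simp add: conservative_wrt_def)
  ultimately have "(a, b) \<in> {(x, J). J \<in> D x}"
    by (rule closed_sequentially[rotated 2]) (use zJ(2) in auto)
  then show ?thesis by simp
qed

lemma expansion_bounded:
  fixes D :: "'a::euclidean_space \<Rightarrow> 'd::euclidean_space set" and w :: "nat \<Rightarrow> 'd"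
  assumes D: "conservative_wrt act H D" and w: "\<And>n. w n \<in> expansion (\<delta> n) D (x n)"
    and "\<delta> \<longlonglongrightarrow> 0" "bounded (range x)"
  shows "bounded (range w)"
proof -
  obtain E where "\<forall>v\<in>range \<delta>. norm v \<le> E"
    using convergent_imp_bounded[OF \<open>\<delta> \<longlonglongrightarrow> 0\<close>] unfolding bounded_iff by blast
  then have E: "\<delta> n \<le> E" for n by (metis abs_ge_self order_trans rangeI real_norm_def)
  obtain B where "\<forall>v\<in>range x. norm v \<le> B" using assms(4) unfolding bounded_iff by blast
  then have B: "norm (x n) \<le> B" for n by simp
  obtain M where M: "\<And>z J. z \<in> cball 0 (B + E) \<Longrightarrow> J \<in> D z \<Longrightarrow> norm J \<le> M"
    using conservative_wrt_bounded_on_compact[OF D compact_cball] by blast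
  have "norm (w n) \<le> M + E" for n
  proof -
    obtain z J where zJ: "dist z (x n) \<le> \<delta> n" "J \<in> D z" "dist (w n) J \<le> \<delta> n" using expansionE[OF D w[of n]] by blast
    have "norm z \<le> B + E" using norm_triangle_ineq2[of z "x n"] zJ(1) B[of n] E[of n] by (simp add: dist_norm)
    then have "norm J \<le> M" using M zJ(2) by simp
    then show ?thesis using norm_triangle_ineq2[of "w n" J] zJ(3) E[of n] by (simp add: dist_norm)
  qed
  then show ?thesis by (auto simp: bounded_iff)
qed

lemma continuous_on_matrix_vector_mult:
  fixes A :: "'a::topological_space \<Rightarrow> real^'p^'n"
  assumes "continuous_on S A" "continuous_on S u"
  shows "continuous_on S (\<lambda>z. A z *v u z)"
  unfolding matrix_vector_mult_def
  by (intro continuous_on_vec_lambda continuous_on_sum continuous_on_mult continuous_on_component assms)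

lemma penalty_field_compact:
  assumes f: "conservative_field f Df" and c: "conservative_jacobian c Dc"
  shows "compact (penalty_field \<beta> \<rho> c Df Dc z)"
proof -
  have "{u. norm u \<le> 1} = cball (0 :: real^'b) 1" by auto
  then have T: "compact (T_regu (c z))" by (simp add: T_regu_def)
  define W where "W = {A *v (\<beta> *\<^sub>R u + \<rho> *\<^sub>R c z) | A u. A \<in> Dc z \<and> u \<in> T_regu (c z)}"
  have "compact ((\<lambda>Au. fst Au *v (\<beta> *\<^sub>R snd Au + \<rho> *\<^sub>R c z)) ` (Dc z \<times> T_regu (c z)))"
    using conservative_wrt_compact[OF c[unfolded conservative_jacobian_def]] T
    by (intro compact_continuous_image compact_Times continuous_on_matrix_vector_mult continuous_intros)
  moreover have "(\<lambda>Au. fst Au *v (\<beta> *\<^sub>R snd Au + \<rho> *\<^sub>R c z)) ` (Dc z \<times> T_regu (c z)) = W"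
    by (force simp: W_def)
  ultimately have "compact {a + b | a b. a \<in> Df z \<and> b \<in> W}"
    using conservative_wrt_compact[OF f[unfolded conservative_field_def]] by (intro compact_sums) auto
  moreover have "{a + b | a b. a \<in> Df z \<and> b \<in> W} = Df z + W" by (auto simp: set_plus_def)
  ultimately show ?thesis unfolding penalty_field_def W_def[symmetric] by (metis compact_convex_hull)
qed

section \<open>Multiplier estimates\<close>

lemma tendsto_matrix_vector_mult:
  fixes A :: "'a \<Rightarrow> real^'p^'n"
  assumes "(A \<longlongrightarrow> A0) F" "(u \<longlongrightarrow> u0) F"
  shows "((\<lambda>z. A z *v u z) \<longlongrightarrow> A0 *v u0) F"
  using assms by (intro vec_tendstoI) (auto simp: matrix_vector_mult_def intro!: tendsto_intros)

lemma bounded_matrix_vector_mult: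
  fixes A :: "'a \<Rightarrow> real^'p^'n"
  assumes "bounded (range A)" "bounded (range u)"
  shows "bounded (range (\<lambda>k. A k *v u k))"
proof -
  have "compact ((\<lambda>Au. fst Au *v snd Au) ` (closure (range A) \<times> closure (range u)))"
    using assms by (intro compact_continuous_image compact_Times continuous_on_matrix_vector_mult continuous_intros)
      (auto simp: compact_eq_bounded_closed)
  from compact_imp_bounded[OF this] show ?thesis
  proof (rule bounded_subset, intro image_subsetI)
    fix k show "A k *v u k \<in> (\<lambda>Au. fst Au *v snd Au) ` (closure (range A) \<times> closure (range u))"
      by (rule image_eqI[of _ _ "(A k, u k)"]) (auto intro: subsetD[OF closure_subset])
  qed
qed

lemma contraction_unroll:
  fixes a e :: "nat \<Rightarrow> real"
  assumes step: "\<And>k. a (Suc k) \<le> q * a k + s * e (Suc k)" and "0 \<le> q" "q \<le> 1" "0 \<le> s" "\<And>k. 0 \<le> e k"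
  shows "a (k + m) \<le> q ^ m * a k + s * (\<Sum>i<m. e (k + m - i))"
proof (induction m)
  case (Suc m)
  have "a (k + Suc m) \<le> q * a (k + m) + s * e (k + Suc m)" using step[of "k + m"] by simp
  also have "\<dots> \<le> q * (q ^ m * a k + s * (\<Sum>i<m. e (k + m - i))) + s * e (k + Suc m)"
    using Suc.IH \<open>0 \<le> q\<close> by (simp add: mult_left_mono)
  also have "\<dots> = q ^ Suc m * a k + q * (s * (\<Sum>i<m. e (k + m - i))) + s * e (k + Suc m)"
    by (simp add: algebra_simps)
  also have "\<dots> \<le> q ^ Suc m * a k + s * (\<Sum>i<m. e (k + m - i)) + s * e (k + Suc m)"
    using assms by (intro add_mono order_refl mult_left_le_one_le) (auto intro!: mult_nonneg_nonneg sum_nonneg)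
  also have "\<dots> = q ^ Suc m * a k + s * (\<Sum>i<Suc m. e (k + Suc m - i))"
    unfolding sum.lessThan_Suc_shift by (simp add: distrib_left)
  finally show ?case .
qed simp

lemma norm_regu_le: "norm (regu z) \<le> 1"
  by (simp add: regu_def)

lemma multiplier_bound:
  assumes lam: "\<And>k. lam (Suc k) = lam k + \<theta> k *\<^sub>R (regu (w (Suc k)) - (1 / \<beta>) *\<^sub>R lam k)"
    and \<theta>: "\<And>k. \<theta>min \<le> \<theta> k \<and> \<theta> k \<le> \<theta>max" "0 < \<theta>min" "\<theta>max < \<beta>"
  shows "norm (lam k) \<le> \<beta> + (1 - \<theta>min / \<beta>) ^ k * norm (lam 0)"
proof (induction k)
  case 0 then show ?case using \<theta>(1)[of 0] \<theta>(2,3) by simp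
next
  case (Suc k)
  have \<beta>: "0 < \<beta>" "0 < \<theta> k" "\<theta> k < \<beta>" using \<theta>(1)[of k] \<theta>(2,3) by linarith+
  have q: "0 \<le> 1 - \<theta> k / \<beta>" "1 - \<theta> k / \<beta> \<le> 1 - \<theta>min / \<beta>"
    using \<beta> \<theta>(1)[of k] by (auto simp: divide_right_mono)
  have "lam (Suc k) = (1 - \<theta> k / \<beta>) *\<^sub>R lam k + \<theta> k *\<^sub>R regu (w (Suc k))"
    by (simp add: lam algebra_simps)
  then have "norm (lam (Suc k)) \<le> norm ((1 - \<theta> k / \<beta>) *\<^sub>R lam k) + norm (\<theta> k *\<^sub>R regu (w (Suc k)))"
    by (simp only: norm_triangle_ineq)
  also have "\<dots> \<le> (1 - \<theta> k / \<beta>) * norm (lam k) + \<theta> k * 1"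
    using q \<beta> norm_regu_le[of "w (Suc k)"] by (auto intro!: mult_left_mono)
  also have "\<dots> \<le> (1 - \<theta> k / \<beta>) * (\<beta> + (1 - \<theta>min / \<beta>) ^ k * norm (lam 0)) + \<theta> k * 1"
    using q Suc.IH by (intro add_right_mono mult_left_mono) auto
  also have "\<dots> = \<beta> + (1 - \<theta> k / \<beta>) * ((1 - \<theta>min / \<beta>) ^ k * norm (lam 0))"
    using \<beta>(1) by (simp add: algebra_simps)
  also have "\<dots> \<le> \<beta> + (1 - \<theta>min / \<beta>) * ((1 - \<theta>min / \<beta>) ^ k * norm (lam 0))"
    using q by (intro add_left_mono mult_right_mono) (auto intro!: mult_nonneg_nonneg)
  finally show ?case by (simp add: mult.assoc)
qed

text \<open>The multiplier forgets its past geometrically, so up to a small error only boundedly many recent values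
  of \<open>w\<close> matter. If they tend to \<open>z \<noteq> 0\<close> then the limit is \<open>\<beta> regu z\<close>; for \<open>z = 0\<close> any vector of norm at
  most \<open>\<beta>\<close> is admissible, and that bound holds asymptotically.\<close>
lemma multiplier_limit:
  fixes lam w :: "nat \<Rightarrow> real^'p"
  assumes lam: "\<And>k. lam (Suc k) = lam k + \<theta> k *\<^sub>R (regu (w (Suc k)) - (1 / \<beta>) *\<^sub>R lam k)"
    and \<theta>: "\<And>k. \<theta>min \<le> \<theta> k \<and> \<theta> k \<le> \<theta>max" "0 < \<theta>min" "\<theta>max < \<beta>"
    and r: "filterlim r at_top sequentially"
    and w: "\<And>m. (\<lambda>n. w (r n - m)) \<longlonglongrightarrow> z"
    and b: "(\<lambda>n. lam (r n)) \<longlonglongrightarrow> b"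
  shows "\<exists>u\<in>T_regu z. b = \<beta> *\<^sub>R u"
proof -
  have "\<theta>min \<le> \<theta>max" using \<theta>(1)[of 0] by linarith
  then have \<beta>: "0 < \<beta>" using \<theta>(2,3) by linarith
  define q where "q = 1 - \<theta>min / \<beta>"
  have q: "0 \<le> q" "q < 1" using \<beta> \<theta>(2,3) \<open>\<theta>min \<le> \<theta>max\<close> by (auto simp: q_def)
  have qlim: "(\<lambda>m. q ^ m) \<longlonglongrightarrow> 0" using q by (intro LIMSEQ_power_zero) auto
  have bd: "norm (lam k) \<le> \<beta> + q ^ k * norm (lam 0)" for k
    unfolding q_def by (rule multiplier_bound[where lam = lam and w = w and \<theta> = \<theta> and \<beta> = \<beta> and \<theta>min = \<theta>min and \<theta>max = \<theta>max, 
        OF lam \<theta>])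
  show ?thesis
  proof (cases "z = 0")
    case True
    have "(\<lambda>n. \<beta> + q ^ r n * norm (lam 0)) \<longlonglongrightarrow> \<beta> + 0 * norm (lam 0)"
      by (intro tendsto_intros filterlim_compose[OF qlim r])
    then have "norm b \<le> \<beta> + 0 * norm (lam 0)"
      by (rule LIMSEQ_le[OF tendsto_norm[OF b]]) (use bd in auto)
    then have "(1 / \<beta>) *\<^sub>R b \<in> T_regu z" using \<beta> True by (simp add: T_regu_def)
    then show ?thesis using \<beta> by (intro bexI[of _ "(1 / \<beta>) *\<^sub>R b"]) auto
  next
    case False
    define u where "u = z /\<^sub>R norm z"
    have u1: "norm u = 1" using False by (simp add: u_def)
    define a e where "a k = norm (lam k - \<beta> *\<^sub>R u)" and "e k = norm (regu (w k) - u)" for k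
    have a_bd: "a k \<le> 2 * \<beta> + norm (lam 0)" for k
    proof -
      have "q ^ k * norm (lam 0) \<le> 1 * norm (lam 0)" using q by (intro mult_right_mono power_le_one) auto
      then show ?thesis
        using norm_triangle_ineq4[of "lam k" "\<beta> *\<^sub>R u"] bd[of k] u1 \<beta> by (simp add: a_def)
    qed
    have step: "a (Suc k) \<le> q * a k + \<beta> * e (Suc k)" for k
    proof -
      have k: "0 < \<theta> k" "\<theta> k < \<beta>" using \<theta>(1)[of k] \<theta>(2,3) by linarith+
      have "lam (Suc k) - \<beta> *\<^sub>R u = (1 - \<theta> k / \<beta>) *\<^sub>R (lam k - \<beta> *\<^sub>R u) + \<theta> k *\<^sub>R (regu (w (Suc k)) - u)"
        using \<beta> by (simp add: lam algebra_simps)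
      then have "a (Suc k) \<le> norm ((1 - \<theta> k / \<beta>) *\<^sub>R (lam k - \<beta> *\<^sub>R u)) + norm (\<theta> k *\<^sub>R (regu (w (Suc k)) - u))"
        unfolding a_def by (simp only: norm_triangle_ineq)
      also have "\<dots> = (1 - \<theta> k / \<beta>) * a k + \<theta> k * e (Suc k)"
        using k by (simp add: a_def e_def)
      also have "\<dots> \<le> q * a k + \<beta> * e (Suc k)"
        using k \<theta>(1)[of k] \<beta> by (intro add_mono mult_right_mono) (auto simp: a_def e_def q_def divide_right_mono)
      finally show ?thesis .
    qed
    have e_lim: "(\<lambda>n. e (r n - m)) \<longlonglongrightarrow> 0" for m
    proof -
      have "(\<lambda>n. w (r n - m) /\<^sub>R norm (w (r n - m)) - u) \<longlonglongrightarrow> z /\<^sub>R norm z - u"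
        using False by (intro tendsto_intros w) auto
      then have "(\<lambda>n. norm (w (r n - m) /\<^sub>R norm (w (r n - m)) - u)) \<longlonglongrightarrow> 0"
        by (simp add: u_def tendsto_norm_zero)
      moreover have "\<forall>\<^sub>F n in sequentially. norm (w (r n - m) /\<^sub>R norm (w (r n - m)) - u) = e (r n - m)"
        using tendsto_imp_eventually_ne[OF w[of m] False] by eventually_elim (simp add: e_def regu_def)
      ultimately show ?thesis by (rule Lim_transform_eventually)
    qed
    have "norm (b - \<beta> *\<^sub>R u) \<le> q ^ m * (2 * \<beta> + norm (lam 0))" for m
    proof (rule LIMSEQ_le)
      show "(\<lambda>n. a (r n)) \<longlonglongrightarrow> norm (b - \<beta> *\<^sub>R u)" unfolding a_def by (intro tendsto_intros b)
      have "(\<lambda>n. q ^ m * (2 * \<beta> + norm (lam 0)) + \<beta> * (\<Sum>i<m. e (r n - i)))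
          \<longlonglongrightarrow> q ^ m * (2 * \<beta> + norm (lam 0)) + \<beta> * (\<Sum>i<m. 0)"
        by (intro tendsto_intros e_lim)
      then show "(\<lambda>n. q ^ m * (2 * \<beta> + norm (lam 0)) + \<beta> * (\<Sum>i<m. e (r n - i)))
          \<longlonglongrightarrow> q ^ m * (2 * \<beta> + norm (lam 0))" by simp
      have "\<forall>\<^sub>F n in sequentially. m \<le> r n" using r by (simp add: filterlim_at_top)
      then have "\<forall>\<^sub>F n in sequentially. a (r n) \<le> q ^ m * (2 * \<beta> + norm (lam 0)) + \<beta> * (\<Sum>i<m. e (r n - i))"
      proof eventually_elim
        case (elim n)
        have "a (r n - m + m) \<le> q ^ m * a (r n - m) + \<beta> * (\<Sum>i<m. e (r n - m + m - i))"
          by (rule contraction_unroll[where a = a and e = e and q = q and s = \<beta>, OF step]) (use q \<beta> in \<open>auto simp: e_def\<close>)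
        moreover have "q ^ m * a (r n - m) \<le> q ^ m * (2 * \<beta> + norm (lam 0))"
          using q by (intro mult_left_mono a_bd) auto
        ultimately show ?case using elim by simp
      qed
      then show "\<exists>N. \<forall>n\<ge>N. a (r n) \<le> q ^ m * (2 * \<beta> + norm (lam 0)) + \<beta> * (\<Sum>i<m. e (r n - i))"
        by (simp add: eventually_sequentially)
    qed
    then have "norm (b - \<beta> *\<^sub>R u) \<le> 0 * (2 * \<beta> + norm (lam 0))"
      by (intro LIMSEQ_le_const[OF tendsto_mult_right[OF qlim]]) auto
    then show ?thesis using False by (auto simp: T_regu_def u_def)
  qed
qed

text \<open>Supplies the recent values of \<open>w\<close> needed for \<open>multiplier_limit\<close>.\<close>
lemma slow_sequence_shift:
  fixes x :: "nat \<Rightarrow> 'a::real_normed_vector"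
  assumes slow: "(\<lambda>k. x (Suc k) - x k) \<longlonglongrightarrow> 0" and r: "filterlim r at_top sequentially"
    and "(\<lambda>n. x (r n)) \<longlonglongrightarrow> a"
  shows "(\<lambda>n. x (r n - m)) \<longlonglongrightarrow> a"
proof (induction m)
  case (Suc m)
  have top: "filterlim (\<lambda>n. r n - Suc m) at_top sequentially"
    by (rule filterlim_compose[OF filterlim_minus_const_nat_at_top r])
  have "(\<lambda>n. x (r n - m) - (x (Suc (r n - Suc m)) - x (r n - Suc m))) \<longlonglongrightarrow> a - 0"
    by (intro tendsto_diff Suc.IH filterlim_compose[OF slow top])
  moreover have "\<forall>\<^sub>F n in sequentially. Suc m \<le> r n" using r by (simp add: filterlim_at_top)
  then have "\<forall>\<^sub>F n in sequentially. x (r n - m) - (x (Suc (r n - Suc m)) - x (r n - Suc m)) = x (r n - Suc m)"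
    by eventually_elim (simp add: Suc_diff_Suc)
  ultimately have "(\<lambda>n. x (r n - Suc m)) \<longlonglongrightarrow> a - 0" by (rule Lim_transform_eventually)
  then show ?case by simp
qed (use assms in simp)

text \<open>On a subsequence the three ingredients of the estimates converge separately, and their limits combine
  to an element of the set whose convex hull is the penalty field at \<open>a\<close>.\<close>
lemma gradient_estimates_limit:
  fixes x d :: "nat \<Rightarrow> real^'n" and lam w :: "nat \<Rightarrow> real^'p" and J :: "nat \<Rightarrow> real^'p^'n"
  assumes f: "conservative_field f Df" and c: "conservative_jacobian c Dc"
    and lam: "\<And>k. lam (Suc k) = lam k + \<theta> k *\<^sub>R (regu (w (Suc k)) - (1 / \<beta>) *\<^sub>R lam k)"
    and \<theta>: "\<And>k. \<theta>min \<le> \<theta> k \<and> \<theta> k \<le> \<theta>max" "0 < \<theta>min" "\<theta>max < \<beta>"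
    and \<delta>: "\<delta> \<longlonglongrightarrow> 0"
    and d: "\<And>k. d k \<in> expansion (\<delta> k) Df (x k)" and J: "\<And>k. J k \<in> expansion (\<delta> k) Dc (x k)"
    and w: "\<And>k. norm (w k - c (x k)) \<le> \<delta> k"
    and x: "bounded (range x)" and slow: "(\<lambda>k. x (Suc k) - x k) \<longlonglongrightarrow> 0"
    and r: "filterlim r at_top sequentially" and a: "(\<lambda>n. x (r n)) \<longlonglongrightarrow> a"
    and b: "(\<lambda>n. d (r n) + J (r n) *v (lam (r n) + \<rho> *\<^sub>R w (r n))) \<longlonglongrightarrow> b"
  shows "b \<in> penalty_field \<beta> \<rho> c Df Dc a"
proof -
  note f' = f[unfolded conservative_field_def] and c' = c[unfolded conservative_jacobian_def]
  have wlim: "(\<lambda>n. w (s n - m)) \<longlonglongrightarrow> c a"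
    if s: "filterlim s at_top sequentially" "(\<lambda>n. x (s n)) \<longlonglongrightarrow> a" for s m
  proof -
    have top: "filterlim (\<lambda>n. s n - m) at_top sequentially"
      by (rule filterlim_compose[OF filterlim_minus_const_nat_at_top s(1)])
    have "isCont c a"
      using locally_lipschitz_imp_continuous[of c] c' continuous_on_eq_continuous_at[OF open_UNIV]
      by (auto simp: conservative_wrt_def)
    then have "(\<lambda>n. c (x (s n - m))) \<longlonglongrightarrow> c a"
      by (rule isCont_tendsto_compose) (rule slow_sequence_shift[OF slow s])
    moreover have "(\<lambda>n. w (s n - m) - c (x (s n - m))) \<longlonglongrightarrow> 0"
      by (rule Lim_null_comparison[OF _ filterlim_compose[OF \<delta> top]]) (simp add: w)
    ultimately show ?thesis using tendsto_add by fastforce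
  qed
  have "bounded (range (\<lambda>n. (d (r n), J (r n), lam (r n))))"
  proof -
    have "\<theta>min < \<beta>" "0 < \<beta>" using \<theta>(1)[of 0] \<theta>(2,3) by linarith+
    have "norm (lam k) \<le> \<beta> + norm (lam 0)" for k
    proof -
      have "(1 - \<theta>min / \<beta>) ^ k * norm (lam 0) \<le> 1 * norm (lam 0)"
        using \<open>\<theta>min < \<beta>\<close> \<open>0 < \<beta>\<close> \<theta>(2) by (intro mult_right_mono power_le_one) auto
      then show ?thesis using multiplier_bound[where lam = lam and w = w and \<theta> = \<theta> and \<beta> = \<beta> and \<theta>min = \<theta>min and \<theta>max = \<theta>max, 
          OF lam \<theta>, of k] by simp
    qed
    then have "bounded (range lam)" by (auto simp: bounded_iff)
    then have "bounded (range d \<times> range J \<times> range lam)"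
      using expansion_bounded[OF f' d \<delta> x] expansion_bounded[OF c' J \<delta> x] by (intro bounded_Times)
    then show ?thesis by (rule bounded_subset) auto
  qed
  then obtain q s where s: "strict_mono s" "((\<lambda>n. (d (r n), J (r n), lam (r n))) \<circ> s) \<longlonglongrightarrow> q"
    using bounded_imp_convergent_subsequence by blast
  define t where "t n = r (s n)" for n
  have t: "filterlim t at_top sequentially"
    unfolding t_def[abs_def] by (rule filterlim_compose[OF r filterlim_subseq[OF s(1)]])
  have xt: "(\<lambda>n. x (t n)) \<longlonglongrightarrow> a" and \<delta>t: "(\<lambda>n. \<delta> (t n)) \<longlonglongrightarrow> 0"
    using LIMSEQ_subseq_LIMSEQ[OF a s(1)] filterlim_compose[OF \<delta> t] by (auto simp: t_def o_def)
  define d' J' l' where "d' = fst q" and "J' = fst (snd q)" and "l' = snd (snd q)"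
  have dt: "(\<lambda>n. d (t n)) \<longlonglongrightarrow> d'" and Jt: "(\<lambda>n. J (t n)) \<longlonglongrightarrow> J'" and lt: "(\<lambda>n. lam (t n)) \<longlonglongrightarrow> l'"
    using tendsto_fst[OF s(2)] tendsto_fst[OF tendsto_snd[OF s(2)]] tendsto_snd[OF tendsto_snd[OF s(2)]]
    by (auto simp: d'_def J'_def l'_def t_def o_def)
  have "d' \<in> Df a" by (rule expansion_limit[OF f' d \<delta>t xt dt])
  moreover have "J' \<in> Dc a" by (rule expansion_limit[OF c' J \<delta>t xt Jt])
  moreover obtain u where u: "u \<in> T_regu (c a)" "l' = \<beta> *\<^sub>R u"
    using multiplier_limit[where lam = lam and w = w and \<theta> = \<theta> and \<beta> = \<beta> and \<theta>min = \<theta>min and \<theta>max = \<theta>max, 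
        OF lam \<theta> t wlim[OF t xt] lt] by blast
  moreover have "b = d' + J' *v (\<beta> *\<^sub>R u + \<rho> *\<^sub>R c a)"
  proof (rule LIMSEQ_unique)
    show "(\<lambda>n. d (t n) + J (t n) *v (lam (t n) + \<rho> *\<^sub>R w (t n))) \<longlonglongrightarrow> b"
      using LIMSEQ_subseq_LIMSEQ[OF b s(1)] by (simp add: t_def o_def)
    show "(\<lambda>n. d (t n) + J (t n) *v (lam (t n) + \<rho> *\<^sub>R w (t n))) \<longlonglongrightarrow> d' + J' *v (\<beta> *\<^sub>R u + \<rho> *\<^sub>R c a)"
      using wlim[OF t xt, of 0] lt u(2)
      by (intro tendsto_add tendsto_matrix_vector_mult tendsto_scaleR tendsto_const dt Jt) auto
  qed
  ultimately show ?thesis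
    unfolding penalty_field_def by (intro hull_inc) (auto simp: set_plus_def)
qed

section \<open>Prox steps, second moments and noise\<close>

lemma prox_variational_inequality:
  assumes X: "convex X" and z: "z \<in> prox_set X x y v" and z': "z' \<in> X"
  shows "0 \<le> (y + v * (z - x)) \<bullet> (z' - z)"
proof (rule ccontr)
  define h where "h = z' - z"
  define N M where "N = (y + v * (z - x)) \<bullet> h" and "M = (v * h) \<bullet> h"
  assume "\<not> ?thesis"
  then have N: "N < 0" by (simp add: N_def h_def)
  have zX: "z \<in> X" using z by (simp add: prox_set_def is_arg_min_def)
  define t where "t = min 1 (- N / (\<bar>M\<bar> + 1))"
  have t: "0 < t" "t \<le> 1" "t \<le> - N / (\<bar>M\<bar> + 1)" using N by (auto simp: t_def divide_neg_pos)
  then have tM: "t * (\<bar>M\<bar> + 1) \<le> - N" by (subst (asm) pos_le_divide_eq) auto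
  have "z + t *\<^sub>R h \<in> X"
    using convexD_alt[OF X zX z', of t] t by (simp add: h_def algebra_simps)
  then have "y \<bullet> (z - x) + 1 / 2 * ((v * (z - x)) \<bullet> (z - x))
      \<le> y \<bullet> (z + t *\<^sub>R h - x) + 1 / 2 * ((v * (z + t *\<^sub>R h - x)) \<bullet> (z + t *\<^sub>R h - x))"
    using z by (auto simp: prox_set_def is_arg_min_def not_less)
  also have "z + t *\<^sub>R h - x = (z - x) + t *\<^sub>R h" by simp
  also have "y \<bullet> ((z - x) + t *\<^sub>R h) + 1 / 2 * ((v * ((z - x) + t *\<^sub>R h)) \<bullet> ((z - x) + t *\<^sub>R h))
      = y \<bullet> (z - x) + 1 / 2 * ((v * (z - x)) \<bullet> (z - x)) + t * (N + t / 2 * M)"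
    unfolding N_def M_def quadratic_form_vec_mult inner_add_left[of y] inner_add_right[of y] inner_scaleR_right[of y]
    by (simp add: distrib_left power2_eq_square del: inner_diff_left inner_diff_right)
  finally have "0 \<le> N + t / 2 * M" using t(1) by (simp add: zero_le_mult_iff)
  moreover have "t / 2 * M \<le> t * (\<bar>M\<bar> + 1) / 2"
    using t(1) by (simp add: mult_left_mono)
  ultimately show False using tM N by linarith
qed

context stepsizes begin

text \<open>The negative part decays at least like \<open>exp (- s * t)\<close> in elapsed time \<open>t\<close>, and the total time is infinite. It
  is applied to the second moments, whose initial values may be negative.\<close>
lemma eventually_almost_nonneg:
  assumes decay: "\<And>k. (1 - s * \<eta> k) * u k \<le> u (Suc k)" and bd: "\<And>k. \<bar>u k\<bar> \<le> B" and "0 < s" "0 < e"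
  shows "\<forall>\<^sub>F k in sequentially. - e \<le> u k"
proof -
  have B: "0 \<le> B" using order_trans[OF abs_ge_zero bd] .
  have "0 < 1 / s" using \<open>0 < s\<close> by simp
  from stepsize_eventually_small[OF this] obtain K where "\<And>k. K \<le> k \<Longrightarrow> \<eta> k < 1 / s"
    by (auto simp: eventually_sequentially)
  then have K: "s * \<eta> k < 1" if "K \<le> k" for k
    using that \<open>0 < s\<close> by (simp add: pos_less_divide_eq mult.commute)
  have low: "- (B * exp (- (s * sum \<eta> {K..<k}))) \<le> u k" if "K \<le> k" for k
    using that
  proof (induction k rule: dec_induct)
    case base then show ?case using bd[of K] by simp
  next
    case (step k)
    have "- (B * exp (- (s * sum \<eta> {K..<Suc k}))) = - (exp (- (s * \<eta> k)) * (B * exp (- (s * sum \<eta> {K..<k}))))"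
      using step.hyps by (simp add: distrib_left exp_add[symmetric])
    also have "\<dots> \<le> - ((1 - s * \<eta> k) * (B * exp (- (s * sum \<eta> {K..<k}))))"
      using exp_ge_add_one_self[of "- (s * \<eta> k)"] B by (simp add: mult_right_mono)
    also have "\<dots> = (1 - s * \<eta> k) * (- (B * exp (- (s * sum \<eta> {K..<k}))))" by simp
    also have "\<dots> \<le> (1 - s * \<eta> k) * u k"
      using K[of k] step by (intro mult_left_mono) auto
    also have "\<dots> \<le> u (Suc k)" by (rule decay)
    finally show ?case .
  qed
  obtain k0 where k0: "K \<le> k0" "B / (e * s) < sum \<eta> {K..<k0}" using time_unbounded by blast
  have "- e \<le> u k" if "k0 \<le> k" for k
  proof -
    define S where "S = s * sum \<eta> {K..<k}"
    have "B / (e * s) < sum \<eta> {K..<k}" using k0(2) time_mono[OF that, of K] by simp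
    then have S: "B < e * S" using \<open>0 < e\<close> \<open>0 < s\<close> by (simp add: S_def pos_divide_less_eq mult_ac)
    also have "\<dots> \<le> e * exp S" using exp_ge_add_one_self[of S] \<open>0 < e\<close> by (intro mult_left_mono) linarith+
    finally have "B * exp (- S) \<le> e" by (simp add: exp_minus field_simps)
    then show ?thesis using low[of k] k0(1) that by (simp add: S_def)
  qed
  then show ?thesis by (auto simp: eventually_sequentially)
qed

text \<open>Translates the supremum over step indices into windows measured by elapsed time. A window \<open>{i..<j}\<close> ends at
  the index \<open>j - 1\<close> of the supremum.\<close>
lemma windowed_sums_vanish:
  fixes \<zeta> :: "nat \<Rightarrow> 'a::real_normed_vector"
  assumes noise: "\<And>T. 0 < T \<Longrightarrow>
      (\<lambda>i. SUP j\<in>{i..time_index \<eta> ((\<Sum>k<i. \<eta> k) + T)}. norm (\<Sum>k=i..j. \<eta> k *\<^sub>R \<zeta> k)) \<longlonglongrightarrow> 0"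
    and "0 < e"
  shows "\<forall>\<^sub>F i in sequentially. \<forall>j\<ge>i. sum \<eta> {i..<j} \<le> T \<longrightarrow> norm (\<Sum>k\<in>{i..<j}. \<eta> k *\<^sub>R \<zeta> k) \<le> e"
proof -
  define U where "U = max T 1"
  have "\<forall>\<^sub>F i in sequentially. (SUP j\<in>{i..time_index \<eta> ((\<Sum>k<i. \<eta> k) + U)}. norm (\<Sum>k=i..j. \<eta> k *\<^sub>R \<zeta> k)) < e"
    by (rule order_tendstoD(2)[OF noise]) (use \<open>0 < e\<close> in \<open>auto simp: U_def\<close>)
  then show ?thesis
  proof (rule eventually_mono, intro allI impI)
    fix i j
    let ?t = "(\<Sum>k<i. \<eta> k) + U"
    assume sup: "(SUP j\<in>{i..time_index \<eta> ?t}. norm (\<Sum>k=i..j. \<eta> k *\<^sub>R \<zeta> k)) < e"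
      and j: "i \<le> j" "sum \<eta> {i..<j} \<le> T"
    show "norm (\<Sum>k\<in>{i..<j}. \<eta> k *\<^sub>R \<zeta> k) \<le> e"
    proof (cases "i = j")
      case False
      then obtain m where m: "j = Suc m" "i \<le> m" using j(1) by (cases j) auto
      have "(\<Sum>k<m. \<eta> k) = (\<Sum>k<i. \<eta> k) + sum \<eta> {i..<m}"
        using m(2) by (simp add: lessThan_atLeast0 sum.atLeastLessThan_concat)
      also have "\<dots> \<le> ?t" using time_mono[of m j i] m j by (simp add: U_def)
      finally have "(\<Sum>k<m. \<eta> k) \<le> ?t" .
      moreover have "finite {k. (\<Sum>i<k. \<eta> i) \<le> ?t}"
      proof -
        have "\<forall>\<^sub>F N in sequentially. ?t < (\<Sum>k<N. \<eta> k)" using diverge by (simp add: filterlim_at_top_dense)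
        then obtain N0 where "\<And>N. N0 \<le> N \<Longrightarrow> ?t < (\<Sum>k<N. \<eta> k)" by (auto simp: eventually_sequentially)
        then have "{k. (\<Sum>i<k. \<eta> i) \<le> ?t} \<subseteq> {..<N0}" by (force simp: not_le[symmetric])
        then show ?thesis using finite_subset by blast
      qed
      ultimately have "m \<le> time_index \<eta> ?t" unfolding time_index_def by (intro le_cSup_finite) auto
      then have "norm (\<Sum>k=i..m. \<eta> k *\<^sub>R \<zeta> k) \<le> (SUP j\<in>{i..time_index \<eta> ?t}. norm (\<Sum>k=i..j. \<eta> k *\<^sub>R \<zeta> k))"
        using m(2) by (intro cSUP_upper) auto
      then show ?thesis using sup m by (simp add: atLeastLessThanSuc_atLeastAtMost)
    qed (use \<open>0 < e\<close> in simp)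
  qed
qed

end

text \<open>Turns the recursion of a second moment into growth bounds for the metric. The lower bound is concavity
  of the root, \<open>b - a \<le> 2 \<surd>b (\<surd>b - \<surd>a)\<close>; it splits the decay \<open>- q t (a - e)\<close> into the part
  \<open>- (q / 2) \<surd>b\<close> proportional to the metric and a strictly positive part due to \<open>e\<close>.\<close>
lemma sqrt_increment:
  assumes s: "0 < s" "s\<^sup>2 \<le> a" "s\<^sup>2 \<le> b" and K: "0 < K" "sqrt b \<le> K" and t: "0 \<le> t" "0 \<le> q" "0 < e" "0 \<le> C"
    and lip: "\<bar>b - a\<bar> \<le> C * t" and drift: "- (q * t * (a - e)) \<le> b - a"
  shows "\<bar>sqrt b - sqrt a\<bar> \<le> C / (2 * s) * t"
    and "t * (q * e / (2 * K) - q / 2 * sqrt b) - q * C / (2 * s) * t\<^sup>2 \<le> sqrt b - sqrt a"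
proof -
  have sq: "s \<le> sqrt a" "s \<le> sqrt b" using s by (auto intro: real_le_rsqrt)
  have ab: "0 < a" "0 < b" using s by (auto intro: less_le_trans[OF zero_less_power])
  have fac: "b - a = (sqrt b - sqrt a) * (sqrt b + sqrt a)" using ab by (simp add: algebra_simps)
  have "\<bar>sqrt b - sqrt a\<bar> * (2 * s) \<le> \<bar>sqrt b - sqrt a\<bar> * \<bar>sqrt b + sqrt a\<bar>"
    using sq s(1) by (intro mult_left_mono) auto
  also have "\<dots> \<le> C * t" using lip fac by (simp add: abs_mult)
  finally show "\<bar>sqrt b - sqrt a\<bar> \<le> C / (2 * s) * t" using s(1) by (simp add: field_simps)
  have b0: "0 < sqrt b" using ab by simp
  have "x * x - y * y \<le> 2 * x * (x - y)" for x y :: real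
    using zero_le_square[of "x - y"] by (simp add: algebra_simps)
  from this[of "sqrt b" "sqrt a"] have "b - a \<le> 2 * sqrt b * (sqrt b - sqrt a)" using ab by simp
  moreover have "- (q * t * (b + C * t - e)) \<le> - (q * t * (a - e))"
    using lip t by (intro le_imp_neg_le mult_left_mono) auto
  ultimately have "- (q * t * (b + C * t - e)) \<le> 2 * sqrt b * (sqrt b - sqrt a)" using drift by linarith
  then have "- (q * t * (b + C * t - e)) / (2 * sqrt b) \<le> sqrt b - sqrt a"
    using b0 by (subst pos_divide_le_eq) (auto simp: mult.commute)
  moreover have "- (q * t * (b + C * t - e)) / (2 * sqrt b)
      = t * (q * e / (2 * sqrt b) - q / 2 * sqrt b) - q * C / (2 * sqrt b) * t\<^sup>2"
  proof -
    have "b / sqrt b = sqrt b" using ab by (simp add: real_div_sqrt)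
    have "- (q * t * (b + C * t - e)) / (2 * sqrt b)
      = t * (q * e / (2 * sqrt b) - q / 2 * (b / sqrt b)) - q * C / (2 * sqrt b) * t\<^sup>2"
      using b0 by (simp add: field_simps power2_eq_square)
    then show ?thesis unfolding \<open>b / sqrt b = sqrt b\<close> .
  qed
  moreover have "q * C / (2 * sqrt b) * t\<^sup>2 \<le> q * C / (2 * s) * t\<^sup>2"
    using sq s(1) t b0 by (intro mult_right_mono divide_left_mono) auto
  moreover have "t * (q * e / (2 * K)) \<le> t * (q * e / (2 * sqrt b))"
    by (intro mult_left_mono frac_le) (use K(2) t b0 in auto)
  ultimately show "t * (q * e / (2 * K) - q / 2 * sqrt b) - q * C / (2 * s) * t\<^sup>2 \<le> sqrt b - sqrt a"
    by (simp add: right_diff_distrib)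
qed

lemma norm_le_card_mult_component_bound:
  fixes u :: "real^'n"
  assumes "\<And>i. \<bar>u $ i\<bar> \<le> b"
  shows "norm u \<le> real CARD('n) * b"
  using order_trans[OF norm_le_l1_cart sum_bounded_above[of UNIV "\<lambda>i. \<bar>u $ i\<bar>" b]] assms by simp

section \<open>Stationarity of the penalty and KKT points\<close>

lemma linear_matrix_vector_mult_left: "linear (\<lambda>A :: real^'p^'n. s *\<^sub>R (A *v u))"
  by (rule linearI) (simp_all add: matrix_vector_mult_add_rdistrib scaleR_right_distrib scaleR_matrix_vector_assoc[symmetric])

text \<open>Where \<open>c a \<noteq> 0\<close> the penalty field is \<open>Df + s Dc c\<close> with \<open>s \<ge> \<beta> / norm (c a)\<close>. Dividing the stationarity
  relation by \<open>s\<close> exhibits a point of the normal cone at distance at most \<open>Mf / s\<close> from \<open>- Dc c\<close>, which is less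
  than the regularity condition permits.\<close>
lemma stationary_imp_feasible:
  fixes c :: "real^'n \<Rightarrow> real^'p"
  assumes Df: "convex (Df a)" and Dc: "convex (Dc a)" and "0 < \<beta>" "0 \<le> \<rho>" "0 < \<nu>" "Mf / \<nu> < \<beta>"
    and reg: "\<nu> * norm (c a) \<le> setdist {- (A *v c a) | A. A \<in> Dc a} (normal_cone X a)"
    and Mf: "\<And>e. e \<in> Df a \<Longrightarrow> norm e \<le> Mf"
    and a: "a \<in> stationary X (penalty_field \<beta> \<rho> c Df Dc)"
  shows "c a = 0"
proof (rule ccontr)
  assume nz: "c a \<noteq> 0"
  define s where "s = \<beta> / norm (c a) + \<rho>"
  have s: "0 < s" using nz \<open>0 < \<beta>\<close> \<open>0 \<le> \<rho>\<close> by (simp add: s_def add_pos_nonneg)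
  have "penalty_field \<beta> \<rho> c Df Dc a \<subseteq> Df a + (\<lambda>A. s *\<^sub>R (A *v c a)) ` Dc a"
    unfolding penalty_field_def
  proof (rule hull_minimal)
    show "convex (Df a + (\<lambda>A. s *\<^sub>R (A *v c a)) ` Dc a)"
      by (intro convex_set_plus Df convex_linear_image linear_matrix_vector_mult_left Dc)
    have "\<beta> *\<^sub>R u + \<rho> *\<^sub>R c a = s *\<^sub>R c a" if "u \<in> T_regu (c a)" for u
      using that nz by (simp add: T_regu_def s_def scaleR_add_left divide_inverse)
    then show "Df a + {A *v (\<beta> *\<^sub>R u + \<rho> *\<^sub>R c a) | A u. A \<in> Dc a \<and> u \<in> T_regu (c a)}
        \<subseteq> Df a + (\<lambda>A. s *\<^sub>R (A *v c a)) ` Dc a"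
      by (intro set_plus_mono2) (auto simp: matrix_vector_mult_scaleR)
  qed
  then obtain e A n where eAn: "e \<in> Df a" "A \<in> Dc a" "n \<in> normal_cone X a" "0 = e + s *\<^sub>R (A *v c a) + n"
    using a by (auto simp: stationary_def set_plus_def)
  have "(1 / s) *\<^sub>R n \<in> normal_cone X a"
    using eAn(3) s by (auto simp: normal_cone_def divide_nonpos_pos)
  then have "setdist {- (A *v c a) | A. A \<in> Dc a} (normal_cone X a) \<le> dist (- (A *v c a)) ((1 / s) *\<^sub>R n)"
    using eAn(2) by (intro setdist_le_dist) auto
  also have "n = - (e + s *\<^sub>R (A *v c a))" using eAn(4) by (metis add_eq_0_iff2 add.commute minus_unique)
  then have "- (A *v c a) - (1 / s) *\<^sub>R n = (1 / s) *\<^sub>R e"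
    using s by (simp add: scaleR_right_distrib scaleR_diff_right)
  then have "dist (- (A *v c a)) ((1 / s) *\<^sub>R n) = norm e / s"
    using s by (simp add: dist_norm)
  finally have "\<nu> * norm (c a) \<le> norm e / s" using reg by linarith
  also have "\<dots> \<le> Mf / s" using Mf[OF eAn(1)] s by (simp add: divide_right_mono)
  also have "\<dots> \<le> Mf / (\<beta> / norm (c a))"
    using nz \<open>0 < \<beta>\<close> \<open>0 \<le> \<rho>\<close> s order_trans[OF norm_ge_zero Mf[OF eAn(1)]]
    by (intro divide_left_mono) (auto simp: s_def)
  finally have "\<nu> * norm (c a) \<le> (Mf / \<beta>) * norm (c a)" by simp
  then have "\<nu> \<le> Mf / \<beta>" by (rule mult_right_le_imp_le) (use nz in simp)
  then show False using \<open>0 < \<nu>\<close> \<open>0 < \<beta>\<close> \<open>Mf / \<nu> < \<beta>\<close> by (simp add: field_simps)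
qed

lemma feasible_stationary_imp_kkt:
  fixes c :: "real^'n \<Rightarrow> real^'p"
  assumes Df: "convex (Df a)" and "c a = 0" and a: "a \<in> stationary X (penalty_field \<beta> \<rho> c Df Dc)"
  shows "kkt_point X c Df Dc a"
proof -
  have "penalty_field \<beta> \<rho> c Df Dc a \<subseteq> Df a + matrix_span (Dc a)"
    unfolding penalty_field_def
  proof (rule hull_minimal)
    show "convex (Df a + matrix_span (Dc a))"
      unfolding matrix_span_def by (intro convex_set_plus Df subspace_imp_convex subspace_span)
    show "Df a + {A *v (\<beta> *\<^sub>R u + \<rho> *\<^sub>R c a) | A u. A \<in> Dc a \<and> u \<in> T_regu (c a)} \<subseteq> Df a + matrix_span (Dc a)"
      unfolding matrix_span_def by (intro set_plus_mono2) (auto intro!: span_base)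
  qed
  then have "penalty_field \<beta> \<rho> c Df Dc a + normal_cone X a \<subseteq> Df a + matrix_span (Dc a) + normal_cone X a"
    by (intro set_plus_mono2) auto
  then show ?thesis using a \<open>c a = 0\<close> by (auto simp: stationary_def kkt_point_def)
qed

section \<open>Convergence of ADAM-LALM\<close>

text \<open>The iterates from a late step on form an \<open>adam_iteration\<close>; what has to be checked is that the metric is
  bounded below from there on and decays slowly enough, and that the estimates have their limits in the
  penalty field. For the convergence of \<open>f\<close> one uses that \<open>c\<close> tends to \<open>0\<close>, because it vanishes at every
  cluster point of the bounded sequence.\<close>
theorem theorem4p9:
  fixes X :: "(real^'n) set"
    and f :: "real^'n \<Rightarrow> real" and c :: "real^'n \<Rightarrow> real^'p"
    and D\<^sub>f :: "real^'n \<Rightarrow> (real^'n) set" and D\<^sub>c :: "real^'n \<Rightarrow> (real^'p^'n) set"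
    and \<alpha> \<beta> \<rho> \<epsilon> \<tau>\<^sub>1 \<tau>\<^sub>2 \<theta>\<^sub>m\<^sub>i\<^sub>n \<theta>\<^sub>m\<^sub>a\<^sub>x :: real
    and \<eta> \<theta> \<delta> :: "nat \<Rightarrow> real"
    and x y v d \<xi> l :: "nat \<Rightarrow> real^'n" and w lam :: "nat \<Rightarrow> real^'p"
    and J :: "nat \<Rightarrow> real^'p^'n"
  assumes X: "closed X" "convex X"
    and params: "\<beta> > 0" "\<rho> \<ge> 0" "\<alpha> > 0" "\<epsilon> > 0" "0 < \<tau>\<^sub>2" "\<tau>\<^sub>2 \<le> 4 * \<tau>\<^sub>1"
    \<comment> \<open>(A)\<close>
    and f: "conservative_field f D\<^sub>f" "\<forall>z. convex (D\<^sub>f z)"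
    and c: "conservative_jacobian c D\<^sub>c" "\<forall>z. convex (D\<^sub>c z)"
    and f_bdd: "bdd_below (f ` X)"
    \<comment> \<open>(B)\<close>
    and sard: "interior (penalty \<beta> \<rho> f c ` stationary X (penalty_field \<beta> \<rho> c D\<^sub>f D\<^sub>c)) = {}"
    \<comment> \<open>the method\<close>
    and x_0: "x 0 \<in> X"
    and l_def: "\<forall>k. l k = d k + J k *v (lam k + \<rho> *\<^sub>R w k) + \<xi> (Suc k)"
    and y_step: "\<forall>k. y (Suc k) = y k - (\<tau>\<^sub>1 * \<eta> k) *\<^sub>R (y k - l k)"
    and v_step: "\<forall>k. v (Suc k) = v k - (\<tau>\<^sub>2 * \<eta> k) *\<^sub>R (v k - l k * l k)"
    and x_step: "\<forall>k. \<exists>z \<in> prox_set X (x k) (y (Suc k)) ((1 / \<alpha>) *\<^sub>R vec_sqrt (\<chi> i. v (Suc k) $ i + \<epsilon>)).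
                   x (Suc k) = (1 - \<eta> k) *\<^sub>R x k + \<eta> k *\<^sub>R z"
    and lam_step: "\<forall>k. lam (Suc k) = lam k + \<theta> k *\<^sub>R (regu (w (Suc k)) - (1 / \<beta>) *\<^sub>R lam k)"
    \<comment> \<open>(C1)\<close>
    and in_X: "\<forall>k. x k \<in> X"
    and iter_bdd: "bounded (range (\<lambda>k. (x k, y k, v k)))"
    \<comment> \<open>(C2)\<close>
    and \<delta>: "\<forall>k. 0 \<le> \<delta> k" "\<delta> \<longlonglongrightarrow> 0"
    and approx: "\<forall>k. d k \<in> expansion (\<delta> k) D\<^sub>f (x k)"
      "\<forall>k. J k \<in> expansion (\<delta> k) D\<^sub>c (x k)"
      "\<forall>k. norm (w k - c (x k)) \<le> \<delta> k"
    \<comment> \<open>(C3)\<close>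
    and \<xi>_bdd: "bounded (range \<xi>)"
    and \<eta>: "\<forall>k. \<eta> k > 0" "\<eta> \<longlonglongrightarrow> 0" "filterlim (\<lambda>N. \<Sum>k<N. \<eta> k) at_top sequentially"
    and noise: "\<forall>T>0. (\<lambda>i. SUP j\<in>{i..time_index \<eta> ((\<Sum>k<i. \<eta> k) + T)}. norm (\<Sum>k=i..j. \<eta> k *\<^sub>R \<xi> (Suc k)))
                        \<longlonglongrightarrow> 0"
    \<comment> \<open>(C4)\<close>
    and \<theta>: "0 < \<theta>\<^sub>m\<^sub>i\<^sub>n" "\<theta>\<^sub>m\<^sub>i\<^sub>n \<le> \<theta>\<^sub>m\<^sub>a\<^sub>x" "\<theta>\<^sub>m\<^sub>a\<^sub>x < \<beta>" "\<forall>k. \<theta>\<^sub>m\<^sub>i\<^sub>n \<le> \<theta> k \<and> \<theta> k \<le> \<theta>\<^sub>m\<^sub>a\<^sub>x"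
  shows "(\<forall>a. cluster_point x a \<longrightarrow> a \<in> stationary X (penalty_field \<beta> \<rho> c D\<^sub>f D\<^sub>c)) \<and> convergent (\<lambda>k. penalty \<beta> \<rho> f c (x k)) \<and>
    (\<forall>\<nu> M\<^sub>f.
       \<nu> > 0 \<and>
       (\<forall>z\<in>X. \<nu> * norm (c z) \<le> setdist {- (A *v c z) | A. A \<in> D\<^sub>c z} (normal_cone X z)) \<and>
       M\<^sub>f-lipschitz_on UNIV f \<and> (\<forall>z\<in>X. \<forall>u\<in>D\<^sub>f z. norm u \<le> M\<^sub>f) \<and>
       \<beta> > M\<^sub>f / \<nu>
       \<longrightarrow> (\<forall>a. cluster_point x a \<longrightarrow> kkt_point X c D\<^sub>f D\<^sub>c a) \<and> convergent (\<lambda>k. f (x k)))"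
proof -
  interpret E: stepsizes \<eta> by unfold_locales (use \<eta> in auto)
  have \<tau>: "0 < \<tau>\<^sub>1" using params by linarith
  note cf = f(1)[unfolded conservative_field_def] and cc = c(1)[unfolded conservative_jacobian_def]
  have llf: "locally_lipschitz f" and llc: "locally_lipschitz c"
    using cf cc by (simp_all add: conservative_wrt_def)
  define g D where "g = penalty \<beta> \<rho> f c" and "D = penalty_field \<beta> \<rho> c D\<^sub>f D\<^sub>c"
  \<comment> \<open>boundedness of all the iterates and estimates\<close>
  obtain B0 where B0: "norm (x k) \<le> B0" "norm (y k) \<le> B0" "norm (v k) \<le> B0" for k
  proof -
    obtain B where B: "\<forall>q\<in>range (\<lambda>k. (x k, y k, v k)). norm q \<le> B" using iter_bdd unfolding bounded_iff by blast
    have "norm (x k) \<le> B" "norm (y k) \<le> B" "norm (v k) \<le> B" for k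
      using B[rule_format, OF rangeI, of k] norm_fst_le[of "x k" "(y k, v k)"] norm_snd_le[of "(y k, v k)" "x k"]
        norm_fst_le[of "y k" "v k"] norm_snd_le[of "v k" "y k"] by linarith+
    then show ?thesis by (rule that)
  qed
  have B0_nonneg: "0 \<le> B0" using order_trans[OF norm_ge_zero B0(1)] .
  have x_bdd: "bounded (range x)" using B0(1) by (auto simp: bounded_iff)
  have cont: "isCont c z" for z
    using locally_lipschitz_imp_continuous[OF llc] continuous_on_eq_continuous_at[OF open_UNIV] by blast
  define dt where "dt k = d k + J k *v (lam k + \<rho> *\<^sub>R w k)" for k
  have l: "l k = dt k + \<xi> (Suc k)" for k using l_def by (simp add: dt_def)
  have "bounded (range dt)"
  proof -
    have "\<theta>\<^sub>m\<^sub>i\<^sub>n < \<beta>" using \<theta> by linarith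
    have "norm (lam k) \<le> \<beta> + norm (lam 0)" for k
    proof -
      have "(1 - \<theta>\<^sub>m\<^sub>i\<^sub>n / \<beta>) ^ k * norm (lam 0) \<le> 1 * norm (lam 0)"
        using \<open>\<theta>\<^sub>m\<^sub>i\<^sub>n < \<beta>\<close> params(1) \<theta>(1) by (intro mult_right_mono power_le_one) auto
      moreover have "norm (lam k) \<le> \<beta> + (1 - \<theta>\<^sub>m\<^sub>i\<^sub>n / \<beta>) ^ k * norm (lam 0)"
        by (rule multiplier_bound[where w = w and \<theta> = \<theta> and \<theta>max = \<theta>\<^sub>m\<^sub>a\<^sub>x]) (use lam_step \<theta> in auto)
      ultimately show ?thesis by simp
    qed
    then have lam: "bounded (range lam)" by (auto simp: bounded_iff)
    have "bounded (range (\<lambda>k. c (x k)))"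
    proof -
      have "compact (c ` cball 0 B0)"
        using locally_lipschitz_imp_continuous[OF llc] continuous_on_subset by (intro compact_continuous_image) auto
      then show ?thesis using compact_imp_bounded B0(1) by (elim bounded_subset[OF compact_imp_bounded]) auto
    qed
    moreover have "bounded (range (\<lambda>k. w k - c (x k)))"
    proof -
      obtain E where "\<forall>q\<in>range \<delta>. norm q \<le> E" using convergent_imp_bounded[OF \<delta>(2)] unfolding bounded_iff by blast
      then have "norm (w k - c (x k)) \<le> E" for k
        using approx(3)[rule_format, of k] by (metis abs_ge_self order_trans rangeI real_norm_def)
      then show ?thesis by (auto simp: bounded_iff)
    qed
    ultimately have "bounded (range (\<lambda>k. (w k - c (x k)) + c (x k)))" using bounded_plus_comp by blast
    then have "bounded (range w)" by simp
    then have "bounded (range (\<lambda>k. lam k + \<rho> *\<^sub>R w k))"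
      using lam bounded_plus_comp[of lam UNIV "\<lambda>k. \<rho> *\<^sub>R w k"] bounded_scaleR_comp[of w UNIV \<rho>] by simp
    then have Jlw: "bounded (range (\<lambda>k. J k *v (lam k + \<rho> *\<^sub>R w k)))"
      by (rule bounded_matrix_vector_mult[rotated])
        (rule expansion_bounded[OF cc _ \<delta>(2) x_bdd], use approx in simp)
    have "bounded (range d)"
      by (rule expansion_bounded[OF cf _ \<delta>(2) x_bdd]) (use approx in simp)
    from bounded_plus_comp[OF this Jlw] show ?thesis unfolding dt_def[abs_def] .
  qed
  then obtain Bd where "\<forall>q\<in>range dt. norm q \<le> Bd" unfolding bounded_iff by blast
  then have Bd: "norm (dt k) \<le> Bd" for k by simp
  obtain Bx where "\<forall>q\<in>range \<xi>. norm q \<le> Bx" using \<xi>_bdd unfolding bounded_iff by blast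
  then have Bx: "norm (\<xi> k) \<le> Bx" for k by simp
  have Bl: "norm (l k) \<le> Bd + Bx" for k
    unfolding l by (rule order_trans[OF norm_triangle_ineq add_mono[OF Bd Bx]])
  have v_comp: "v (Suc k) $ i = v k $ i - \<tau>\<^sub>2 * \<eta> k * (v k $ i - l k $ i * l k $ i)" for k i
    by (subst v_step[rule_format]) simp
  have v_low: "(1 - \<tau>\<^sub>2 * \<eta> k) * v k $ i \<le> v (Suc k) $ i" for k i
  proof -
    have "0 \<le> \<tau>\<^sub>2 * \<eta> k * (l k $ i * l k $ i)" using params E.nonneg[of k] by (simp add: zero_le_mult_iff)
    then show ?thesis unfolding v_comp by (simp add: algebra_simps)
  qed
  \<comment> \<open>the second moments are eventually bounded away from the singularity of the metric\<close>
  have "\<forall>\<^sub>F k in sequentially. \<forall>i\<in>UNIV. - (\<epsilon> / 2) \<le> v k $ i"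
  proof (rule eventually_ball_finite, simp, rule ballI)
    fix i :: 'n
    show "\<forall>\<^sub>F k in sequentially. - (\<epsilon> / 2) \<le> v k $ i"
    proof (rule E.eventually_almost_nonneg)
      show "(1 - \<tau>\<^sub>2 * \<eta> k) * v k $ i \<le> v (Suc k) $ i" for k
        by (rule v_low)
      show "\<bar>v k $ i\<bar> \<le> B0" for k using B0(3) component_le_norm_cart order_trans by blast
    qed (use params in auto)
  qed
  then obtain K where K: "\<And>k i. K \<le> k \<Longrightarrow> - (\<epsilon> / 2) \<le> v k $ i" by (auto simp: eventually_sequentially)
  define s where "s = sqrt (\<epsilon> / 2)"
  have s: "0 < s" "s\<^sup>2 = \<epsilon> / 2" using params by (auto simp: s_def)
  define Kq where "Kq = sqrt (B0 + \<epsilon>)"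
  have Kq: "0 < Kq" using B0_nonneg params by (simp add: Kq_def add_nonneg_pos)
  have sqrt_le: "sqrt (v k $ i + \<epsilon>) \<le> Kq" for k i
    using order_trans[OF abs_ge_self order_trans[OF component_le_norm_cart B0(3)]] by (simp add: Kq_def)
  have sqrt_ge: "s \<le> sqrt (v k $ i + \<epsilon>)" if "K \<le> k" for k i
    unfolding s_def using K[OF that, of i] by simp
  define V where "V k = (1 / \<alpha>) *\<^sub>R vec_sqrt (\<chi> i. v k $ i + \<epsilon>)" for k
  have V: "V k $ i = sqrt (v k $ i + \<epsilon>) / \<alpha>" for k i by (simp add: V_def vec_sqrt_def)
  define \<mu> where "\<mu> = s / \<alpha>"
  have \<mu>: "0 < \<mu>" "\<And>k i. K \<le> k \<Longrightarrow> \<mu> \<le> V k $ i"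
    using s params sqrt_ge by (auto simp: \<mu>_def V divide_right_mono)
  define C1 where "C1 = \<tau>\<^sub>2 * (B0 + (Bd + Bx) * (Bd + Bx))"
  have C1: "0 \<le> C1" using params B0_nonneg by (simp add: C1_def)
  have v_inc: "\<bar>(v (Suc k) $ i + \<epsilon>) - (v k $ i + \<epsilon>)\<bar> \<le> C1 * \<eta> k" for k i
  proof -
    have "\<bar>l k $ i * l k $ i\<bar> \<le> (Bd + Bx) * (Bd + Bx)"
      unfolding abs_mult using component_le_norm_cart[of "l k" i] Bl[of k] by (intro mult_mono) auto
    moreover have "\<bar>v k $ i\<bar> \<le> B0" using B0(3) component_le_norm_cart order_trans by blast
    ultimately have "\<bar>v k $ i - l k $ i * l k $ i\<bar> \<le> B0 + (Bd + Bx) * (Bd + Bx)" by linarith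
    then have "(\<tau>\<^sub>2 * \<eta> k) * \<bar>v k $ i - l k $ i * l k $ i\<bar> \<le> (\<tau>\<^sub>2 * \<eta> k) * (B0 + (Bd + Bx) * (Bd + Bx))"
      using params E.nonneg[of k] by (intro mult_left_mono) auto
    then show ?thesis using params E.nonneg[of k] by (simp add: v_comp C1_def abs_mult mult_ac)
  qed
  have v_drift: "- (\<tau>\<^sub>2 * \<eta> k * ((v k $ i + \<epsilon>) - \<epsilon>)) \<le> (v (Suc k) $ i + \<epsilon>) - (v k $ i + \<epsilon>)" for k i
    using v_low[of k i] by (simp add: algebra_simps)
  define \<kappa> where "\<kappa> = \<tau>\<^sub>2 * \<epsilon> / (4 * \<tau>\<^sub>1 * Kq * \<alpha>)"
  have \<kappa>: "0 < \<kappa>" using params \<tau> Kq by (simp add: \<kappa>_def)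
  define A1 A2 where "A1 = real CARD('n) * (C1 / (2 * s) / \<alpha>)" and "A2 = \<tau>\<^sub>2 * C1 / (2 * s) / \<alpha>"
  have A: "0 \<le> A1" "0 \<le> A2" using C1 s params by (auto simp: A1_def A2_def)
  note sqrt_inc = sqrt_increment[OF s(1) _ _ Kq sqrt_le less_imp_le _ params(4) C1 v_inc v_drift]
  have V_inc: "norm (V (Suc k) - V k) \<le> (A1 + A2) * \<eta> k"
    and V_drift: "\<eta> k * (2 * \<tau>\<^sub>1 * \<kappa> - 2 * \<tau>\<^sub>1 * V (Suc k) $ i) - (A1 + A2) * (\<eta> k)\<^sup>2 \<le> V (Suc k) $ i - V k $ i"
    if k: "K \<le> k" for k i
  proof -
    have le: "s\<^sup>2 \<le> v k $ i + \<epsilon>" "s\<^sup>2 \<le> v (Suc k) $ i + \<epsilon>" for i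
      using K[OF k, of i] K[of "Suc k" i] k s(2) by auto
    have inc: "\<bar>V (Suc k) $ i - V k $ i\<bar> \<le> C1 / (2 * s) / \<alpha> * \<eta> k" for i
    proof -
      have "\<bar>sqrt (v (Suc k) $ i + \<epsilon>) - sqrt (v k $ i + \<epsilon>)\<bar> \<le> C1 / (2 * s) * \<eta> k"
        by (rule sqrt_inc(1)) (use le \<eta>(1) params in auto)
      then have "\<bar>sqrt (v (Suc k) $ i + \<epsilon>) - sqrt (v k $ i + \<epsilon>)\<bar> / \<alpha> \<le> C1 / (2 * s) * \<eta> k / \<alpha>"
        by (rule divide_right_mono) (use params in simp)
      then show ?thesis using params by (simp add: V diff_divide_distrib[symmetric] abs_divide)
    qed
    have "norm (V (Suc k) - V k) \<le> real CARD('n) * (C1 / (2 * s) / \<alpha> * \<eta> k)"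
      by (rule norm_le_card_mult_component_bound) (simp only: vector_minus_component inc)
    also have "\<dots> = A1 * \<eta> k" by (simp add: A1_def)
    also have "\<dots> \<le> (A1 + A2) * \<eta> k" using A E.nonneg[of k] by (simp add: distrib_right)
    finally show "norm (V (Suc k) - V k) \<le> (A1 + A2) * \<eta> k" .
    define R where "R = sqrt (v (Suc k) $ i + \<epsilon>)"
    have R: "0 \<le> R" using order_trans[OF less_imp_le[OF s(1)] sqrt_ge[of "Suc k" i]] k by (simp add: R_def)
    have "\<eta> k * (\<tau>\<^sub>2 * \<epsilon> / (2 * Kq) - \<tau>\<^sub>2 / 2 * R) - \<tau>\<^sub>2 * C1 / (2 * s) * (\<eta> k)\<^sup>2 \<le> R - sqrt (v k $ i + \<epsilon>)"
      unfolding R_def by (rule sqrt_inc(2)) (use le \<eta>(1) params in auto)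
    \<comment> \<open>the metric does not decay faster than optimality of the prox points allows\<close>
    moreover have "\<eta> k * (\<tau>\<^sub>2 * \<epsilon> / (2 * Kq) - 2 * \<tau>\<^sub>1 * R) \<le> \<eta> k * (\<tau>\<^sub>2 * \<epsilon> / (2 * Kq) - \<tau>\<^sub>2 / 2 * R)"
      using params R by (intro mult_left_mono E.nonneg diff_left_mono mult_right_mono) auto
    ultimately have "\<eta> k * (\<tau>\<^sub>2 * \<epsilon> / (2 * Kq) - 2 * \<tau>\<^sub>1 * R) - \<tau>\<^sub>2 * C1 / (2 * s) * (\<eta> k)\<^sup>2 \<le> R - sqrt (v k $ i + \<epsilon>)"
      by linarith
    from divide_right_mono[OF this, of \<alpha>]
    have "(\<eta> k * (\<tau>\<^sub>2 * \<epsilon> / (2 * Kq) - 2 * \<tau>\<^sub>1 * R) - \<tau>\<^sub>2 * C1 / (2 * s) * (\<eta> k)\<^sup>2) / \<alpha> \<le> V (Suc k) $ i - V k $ i"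
      using params by (simp add: V R_def diff_divide_distrib)
    moreover have "(\<eta> k * (\<tau>\<^sub>2 * \<epsilon> / (2 * Kq) - 2 * \<tau>\<^sub>1 * R) - \<tau>\<^sub>2 * C1 / (2 * s) * (\<eta> k)\<^sup>2) / \<alpha>
        = \<eta> k * (2 * \<tau>\<^sub>1 * \<kappa> - 2 * \<tau>\<^sub>1 * (R / \<alpha>)) - A2 * (\<eta> k)\<^sup>2"
      using params \<tau> Kq s by (simp add: \<kappa>_def A2_def field_simps)
    moreover have "A2 * (\<eta> k)\<^sup>2 \<le> (A1 + A2) * (\<eta> k)\<^sup>2" using A by (intro mult_right_mono) auto
    ultimately show "\<eta> k * (2 * \<tau>\<^sub>1 * \<kappa> - 2 * \<tau>\<^sub>1 * V (Suc k) $ i) - (A1 + A2) * (\<eta> k)\<^sup>2 \<le> V (Suc k) $ i - V k $ i"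
      by (simp add: V R_def)
  qed
  have V_norm: "norm (V k) \<le> real CARD('n) * (Kq / \<alpha>)" if "K \<le> k" for k
  proof (rule norm_le_card_mult_component_bound)
    fix i
    have "0 \<le> V k $ i" using \<mu>(2)[OF that, of i] \<mu>(1) by linarith
    moreover have "V k $ i \<le> Kq / \<alpha>" unfolding V using sqrt_le params by (intro divide_right_mono) auto
    ultimately show "\<bar>V k $ i\<bar> \<le> Kq / \<alpha>" by simp
  qed
  \<comment> \<open>the prox steps as velocities\<close>
  define p where "p k = (1 / \<eta> k) *\<^sub>R (x (Suc k) - x k)" for k
  have p: "x (Suc k) = x k + \<eta> k *\<^sub>R p k" for k using \<eta>(1) less_imp_neq[of 0 "\<eta> k"] by (simp add: p_def)
  have prox: "x k + p k \<in> prox_set X (x k) (y (Suc k)) (V (Suc k))" for k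
  proof -
    obtain z where z: "z \<in> prox_set X (x k) (y (Suc k)) (V (Suc k))" "x (Suc k) = (1 - \<eta> k) *\<^sub>R x k + \<eta> k *\<^sub>R z"
      using x_step unfolding V_def by blast
    have "x (Suc k) - x k = \<eta> k *\<^sub>R (z - x k)" by (simp add: z(2) algebra_simps)
    then have "p k = z - x k" using \<eta>(1) less_imp_neq[of 0 "\<eta> k"] by (simp add: p_def)
    then show ?thesis using z(1) by simp
  qed
  have vi: "0 \<le> (y (Suc k) + V (Suc k) * p k) \<bullet> (z - (x k + p k))" if "z \<in> X" for k z
    using prox_variational_inequality[OF X(2) prox that, of k] by simp
  have slow: "(\<lambda>k. x (Suc k) - x k) \<longlonglongrightarrow> 0"
  proof (rule Lim_null_comparison)
    show "(\<lambda>k. B0 / \<mu> * \<eta> k) \<longlonglongrightarrow> 0" using tendsto_mult_right_zero[OF \<eta>(2)] .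
    show "\<forall>\<^sub>F k in sequentially. norm (x (Suc k) - x k) \<le> B0 / \<mu> * \<eta> k"
      using eventually_ge_at_top[of K]
    proof eventually_elim
      case (elim k)
      have "norm (p k) \<le> norm (y (Suc k)) / \<mu>"
        using vi[OF in_X[rule_format, of k], of k] \<mu>(2)[of "Suc k"] elim
        by (intro variational_velocity_bound[OF \<mu>(1), of "V (Suc k)"]) (auto simp: inner_diff_right inner_add_right)
      also have "\<dots> \<le> B0 / \<mu>" using B0(2) \<mu>(1) by (intro divide_right_mono) auto
      finally show ?case using mult_left_mono[OF _ E.nonneg[of k]] E.nonneg[of k] by (fastforce simp: p mult.commute)
    qed
  qed
  define B where "B = max B0 (max Bd (max Bx (real CARD('n) * (Kq / \<alpha>))))"
  \<comment> \<open>the analysis starts at step \<open>K\<close>, from which on the metric is bounded below\<close>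
  interpret I: adam_iteration "\<lambda>k. \<eta> (k + K)" X g D "\<lambda>k. x (k + K)" "\<lambda>k. y (k + K)" "\<lambda>k. p (k + K)" "\<lambda>k. V (k + K)"
    "\<lambda>k. dt (k + K)" "\<lambda>k. \<xi> (Suc (k + K))" \<tau>\<^sub>1 B \<mu> \<kappa> "A1 + A2"
  proof
    show "0 < \<eta> (k + K)" for k using \<eta>(1) by simp
    show "(\<lambda>k. \<eta> (k + K)) \<longlonglongrightarrow> 0" using \<eta>(2) by (rule LIMSEQ_ignore_initial_segment)
    show "filterlim (\<lambda>N. \<Sum>k<N. \<eta> (k + K)) at_top sequentially"
    proof -
      have "filterlim (\<lambda>N. - sum \<eta> {..<K} + (\<Sum>k<N + K. \<eta> k)) at_top sequentially"
        by (intro filterlim_tendsto_add_at_top[OF tendsto_const]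
            filterlim_compose[OF \<eta>(3) filterlim_add_const_nat_at_top])
      moreover have "- sum \<eta> {..<K} + (\<Sum>k<N + K. \<eta> k) = (\<Sum>k<N. \<eta> (k + K))" for N
      proof -
        have "(\<Sum>k<N + K. \<eta> k) = sum \<eta> {..<K} + sum \<eta> {0 + K..<N + K}"
          by (simp add: lessThan_atLeast0 sum.atLeastLessThan_concat)
        then show ?thesis unfolding sum.shift_bounds_nat_ivl by (simp add: lessThan_atLeast0)
      qed
      ultimately show ?thesis by simp
    qed
    show "locally_lipschitz g" unfolding g_def by (rule locally_lipschitz_penalty[OF llf llc])
    show "chain_rule_field g D" unfolding g_def D_def by (rule penalty_field_chain_rule[OF f(1) c(1)])
    show "convex (D a)" for a unfolding D_def penalty_field_def by (rule convex_convex_hull)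
    show "compact (D a)" for a unfolding D_def by (rule penalty_field_compact[OF f(1) c(1)])
    show "x (Suc k + K) = x (k + K) + \<eta> (k + K) *\<^sub>R p (k + K)" for k using p[of "k + K"] by simp
    show "y (Suc k + K) = y (k + K) - (\<tau>\<^sub>1 * \<eta> (k + K)) *\<^sub>R (y (k + K) - (dt (k + K) + \<xi> (Suc (k + K))))" for k
      using y_step l by simp
    show "x (k + K) + p (k + K) \<in> X" for k using prox[of "k + K"] by (simp add: prox_set_def is_arg_min_def)
    show "0 \<le> (y (Suc k + K) + V (Suc k + K) * p (k + K)) \<bullet> (z - (x (k + K) + p (k + K)))" if "z \<in> X" for k z
      using vi[OF that, of "k + K"] by simp
    show "norm (x (k + K)) \<le> B" "norm (y (k + K)) \<le> B" "norm (V (k + K)) \<le> B" "norm (dt (k + K)) \<le> B"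
      "norm (\<xi> (Suc (k + K))) \<le> B" for k
      using B0(1,2)[of "k + K"] V_norm[of "k + K"] Bd[of "k + K"] Bx[of "Suc (k + K)"] unfolding B_def by linarith+
    show "\<mu> \<le> V (k + K) $ i" for k i using \<mu>(2) by simp
    show "norm (V (Suc k + K) - V (k + K)) \<le> (A1 + A2) * \<eta> (k + K)" for k using V_inc[of "k + K"] by simp
    show "\<eta> (k + K) * (2 * \<tau>\<^sub>1 * \<kappa> - 2 * \<tau>\<^sub>1 * V (Suc k + K) $ i) - (A1 + A2) * (\<eta> (k + K))\<^sup>2
        \<le> V (Suc k + K) $ i - V (k + K) $ i" for k i using V_drift[of "k + K" i] by simp
    show "\<forall>\<^sub>F i in sequentially. \<forall>j\<ge>i. (\<Sum>k\<in>{i..<j}. \<eta> (k + K)) \<le> T \<longrightarrow>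
        norm (\<Sum>k\<in>{i..<j}. \<eta> (k + K) *\<^sub>R \<xi> (Suc (k + K))) \<le> e" if "0 < e" for T e
    proof -
      have "\<forall>\<^sub>F i in sequentially. \<forall>j\<ge>i. sum \<eta> {i..<j} \<le> T \<longrightarrow> norm (\<Sum>k\<in>{i..<j}. \<eta> k *\<^sub>R \<xi> (Suc k)) \<le> e"
        by (rule E.windowed_sums_vanish[OF _ that]) (use noise in auto)
      from eventually_all_ge_at_top[OF this] obtain N where N: "\<And>i j. N \<le> i \<Longrightarrow> i \<le> j \<Longrightarrow> sum \<eta> {i..<j} \<le> T \<Longrightarrow>
          norm (\<Sum>k\<in>{i..<j}. \<eta> k *\<^sub>R \<xi> (Suc k)) \<le> e"
        by (auto simp: eventually_sequentially)
      show ?thesis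
        unfolding eventually_sequentially
      proof (intro exI[of _ N] allI impI)
        fix i j assume "N \<le> i" "i \<le> j" "(\<Sum>k\<in>{i..<j}. \<eta> (k + K)) \<le> T"
        then show "norm (\<Sum>k\<in>{i..<j}. \<eta> (k + K) *\<^sub>R \<xi> (Suc (k + K))) \<le> e"
          using N[of "i + K" "j + K"] by (simp add: sum.shift_bounds_nat_ivl)
      qed
    qed
    show "b \<in> D a" if r: "filterlim r at_top sequentially" "(\<lambda>n. x (r n + K)) \<longlonglongrightarrow> a" "(\<lambda>n. dt (r n + K)) \<longlonglongrightarrow> b" for r a b
      unfolding D_def
    proof (rule gradient_estimates_limit[where r = "\<lambda>n. r n + K" and d = d and J = J and lam = lam and w = w and x = x
          and \<delta> = \<delta> and \<theta> = \<theta> and \<theta>min = \<theta>\<^sub>m\<^sub>i\<^sub>n and \<theta>max = \<theta>\<^sub>m\<^sub>a\<^sub>x, OF f(1) c(1)])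
      show "filterlim (\<lambda>n. r n + K) at_top sequentially"
        by (rule filterlim_compose[OF filterlim_add_const_nat_at_top r(1)])
    qed (use lam_step \<theta> \<delta> approx x_bdd slow r in \<open>auto simp: dt_def\<close>)
  qed (use X in_X \<mu>(1) \<tau> \<kappa> in auto)
  have "interior (g ` stationary X D) = {}" using sard by (simp add: g_def D_def)
  note conv = I.convergence[OF this]
  have stat: "a \<in> stationary X D" if cl: "cluster_point x a" for a
  proof (rule conv(2))
    fix e :: real and N assume "0 < e"
    obtain r where r: "strict_mono r" "(x \<circ> r) \<longlonglongrightarrow> a" using cl by (auto simp: cluster_point_def)
    obtain M where M: "\<And>n. M \<le> n \<Longrightarrow> norm (x (r n) - a) < e"
      using r(2) \<open>0 < e\<close> by (auto simp: tendsto_iff dist_norm eventually_sequentially)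
    define n where "n = M + N + K"
    have "n \<le> r n" by (rule seq_suble[OF r(1)])
    then show "\<exists>i\<ge>N. norm (x (i + K) - a) < e"
      using M[of n] by (intro exI[of _ "r n - K"]) (auto simp: n_def)
  qed
  have conv_g: "convergent (\<lambda>k. g (x k))"
    using conv(1) convergent_ignore_initial_segment[of "\<lambda>k. g (x k)" K] by simp
  have kkt: "(\<forall>a. cluster_point x a \<longrightarrow> kkt_point X c D\<^sub>f D\<^sub>c a) \<and> convergent (\<lambda>k. f (x k))"
    if reg: "\<nu> > 0" "\<forall>z\<in>X. \<nu> * norm (c z) \<le> setdist {- (A *v c z) | A. A \<in> D\<^sub>c z} (normal_cone X z)"
      "\<forall>z\<in>X. \<forall>u\<in>D\<^sub>f z. norm u \<le> M\<^sub>f" "\<beta> > M\<^sub>f / \<nu>" for \<nu> M\<^sub>f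
  proof
    have feasible: "c a = 0" if "cluster_point x a" for a
    proof -
      have a: "a \<in> stationary X D" "a \<in> X" using stat[OF that] by (auto simp: stationary_def)
      show ?thesis
        by (rule stationary_imp_feasible[of D\<^sub>f a D\<^sub>c \<beta> \<rho> \<nu> M\<^sub>f c X]) (use f c params reg a in \<open>auto simp: D_def\<close>)
    qed
    then show "\<forall>a. cluster_point x a \<longrightarrow> kkt_point X c D\<^sub>f D\<^sub>c a"
      using feasible_stationary_imp_kkt[OF f(2)[rule_format] _ stat[unfolded D_def]] by blast
    have "(\<lambda>k. c (x k)) \<longlonglongrightarrow> 0"
    proof (rule tendsto_if_subsequences_have_convergent_subsequence)
      fix r :: "nat \<Rightarrow> nat" assume r: "strict_mono r"
      have "bounded (range (x \<circ> r))" using x_bdd by (rule bounded_subset) auto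
      then obtain a q where q: "strict_mono q" "((x \<circ> r) \<circ> q) \<longlonglongrightarrow> a"
        using bounded_imp_convergent_subsequence by blast
      then have "cluster_point x a"
        unfolding cluster_point_def using strict_mono_o[OF r q(1)] by (auto simp: o_assoc intro!: exI[of _ "r \<circ> q"])
      then have "c a = 0" by (rule feasible)
      moreover have "(\<lambda>n. c (x (r (q n)))) \<longlonglongrightarrow> c a"
        using q(2) by (intro isCont_tendsto_compose[OF cont]) (simp add: o_def)
      ultimately show "\<exists>q. strict_mono q \<and> (\<lambda>n. c (x (r (q n)))) \<longlonglongrightarrow> 0" using q(1) by auto
    qed
    then have c0: "(\<lambda>k. norm (c (x k))) \<longlonglongrightarrow> 0" by (rule tendsto_norm_zero)
    obtain L where "(\<lambda>k. g (x k)) \<longlonglongrightarrow> L" using conv_g by (auto simp: convergent_def)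
    then have "(\<lambda>k. g (x k) - \<beta> * norm (c (x k)) - \<rho> / 2 * (norm (c (x k)))\<^sup>2) \<longlonglongrightarrow> L - \<beta> * 0 - \<rho> / 2 * 0\<^sup>2"
      by (intro tendsto_intros c0)
    then show "convergent (\<lambda>k. f (x k))" by (auto simp: convergent_def g_def penalty_def)
  qed
  show ?thesis
    using stat conv_g kkt unfolding g_def D_def by blast
qed

end
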